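(* Let $K_1,K_2,K_3>0$, $K_4\in\mathbb{R}$ and $t\ge0$. Let $C$ be the unique constant (with $C>K_2t^2$) satisfying $$\int_0^{\pi/2}\frac{\left(K_1\cos^2u+K_3\sin^2u\right)^{1/2}}{\left(C-\frac{K_2^2t^2\cos^2u}{K_2\cos^2u+K_3\sin^2u}\right)^{1/2}}\,du=1 .$$ Let $\theta^*:[0,1]\to[0,\pi/2]$ be defined implicitly by $$\int_0^{\theta^*(z)}\frac{\left(K_1\cos^2u+K_3\sin^2u\right)^{1/2}}{\left(C-\frac{K_2^2t^2\cos^2u}{K_2\cos^2u+K_3\sin^2u}\right)^{1/2}}\,du=z,$$ (so $\theta^*(0)=0$, $\theta^*(1)=\pi/2$), and let $\phi^*$ be the solution of $$\phi^{*\prime}(z)=\frac{K_2t}{K_2\cos^2\theta^*(z)+K_3\sin^2\theta^*(z)},\qquad \phi^*(0)=0.$$ Define ${\bf n}^*(x,y,z)=(\cos\phi^*(z)\cos\theta^*(z),\ \sin\phi^*(z)\cos\theta^*(z),\ \sin\theta^*(z))$. Then ${\bf n}^*\in\mathcal{A}$, and for every ${\bf n}\in\mathcal{A}$ that depends only on $z$ we have $I({\bf n})\ge I({\bf n}^* )$, with equality if and only if ${\bf n}={\bf n}^*$.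
   Context: $\Omega=(-L_1,L_1)\times(-L_2,L_2)\times(0,1)$ with $L_1,L_2>0$. The admissible set is $$\mathcal{A}=\{{\bf n}\in W^{1,2}(\Omega,\mathbb{S}^2):\ {\bf n}|_{z=0}={\bf e}_1,\ {\bf n}|_{z=1}={\bf e}_3,\ {\bf n}|_{x=-L_1}={\bf n}|_{x=L_1},\ {\bf n}|_{y=-L_2}={\bf n}|_{y=L_2}\}$$ (boundary values in the trace sense). Here $W^{1,2}(\Omega,\mathbb{S}^2)$ is the set of $W^{1,2}(\Omega,\mathbb{R}^3)$ maps with $|{\bf n}|=1$ a.e. The energy is $I({\bf n})=\int_\Omega w({\bf n},\nabla{\bf n})\,dx$ with $$w=K_1(\nabla\cdot{\bf n})^2+K_2({\bf n}\cdot\nabla\times{\bf n}+t)^2+K_3|{\bf n}\times\nabla\times{\bf n}|^2+(K_2+K_4)\left(\operatorname{tr}((\nabla{\bf n})^2)-(\nabla\cdot{\bf n})^2\right).$$ "Depends only on $z$" means ${\bf n}(x,y,z)={\bf m}(z)$ for some function ${\bf m}$. *)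

theory Defs
  imports "HOL-Analysis.Analysis"
begin

definition Omega :: "real \<Rightarrow> real \<Rightarrow> (real^3) set" where
  "Omega L1 L2 = box (vector [-L1, -L2, 0]) (vector [L1, L2, 1])"

definition Rect :: "real \<Rightarrow> real \<Rightarrow> (real \<times> real) set" where
  "Rect L1 L2 = {-L1..L1} \<times> {-L2..L2}"

definition periodic_test :: "real \<Rightarrow> real \<Rightarrow> (real^3 \<Rightarrow> real) \<Rightarrow> (real^3 \<Rightarrow> real^3) \<Rightarrow> bool" where
  "periodic_test L1 L2 phi dphi \<longleftrightarrow>
     (\<forall>p. (phi has_derivative (\<lambda>h. dphi p \<bullet> h)) (at p)) \<and> continuous_on UNIV dphi \<and>
     (\<forall>p. phi (p + (2 * L1) *\<^sub>R axis 1 1) = phi p) \<and>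
     (\<forall>p. phi (p + (2 * L2) *\<^sub>R axis 2 1) = phi p)"

definition L2_on :: "(real^3) set \<Rightarrow> (real^3 \<Rightarrow> real) \<Rightarrow> bool" where
  "L2_on S f \<longleftrightarrow> set_borel_measurable lebesgue S f \<and> set_integrable lebesgue S (\<lambda>p. (f p)\<^sup>2)"

text \<open>g is the weak gradient of n (g p $ k $ i = d n_k / d x_i), n and g are in L^2(Omega),
  and n has the boundary values of the admissible set in the trace sense:
  n = e1 on z = 0, n = e3 on z = 1, equal traces on the opposite lateral faces.
  All of this is encoded by the Green (integration by parts) formula tested against
  all C^1 functions that are 2L1-periodic in x and 2L2-periodic in y.\<close>
definition adm_grad :: "real \<Rightarrow> real \<Rightarrow> (real^3 \<Rightarrow> real^3) \<Rightarrow> (real^3 \<Rightarrow> real^3^3) \<Rightarrow> bool" where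
  "adm_grad L1 L2 n g \<longleftrightarrow>
     (\<forall>k. L2_on (Omega L1 L2) (\<lambda>p. n p $ k)) \<and>
     (\<forall>k i. L2_on (Omega L1 L2) (\<lambda>p. g p $ k $ i)) \<and>
     (\<forall>phi dphi. periodic_test L1 L2 phi dphi \<longrightarrow>
        (\<forall>k. (\<forall>i\<in>{1,2}. (LINT p:Omega L1 L2|lebesgue. n p $ k * dphi p $ i + g p $ k $ i * phi p) = 0) \<and>
             (LINT p:Omega L1 L2|lebesgue. n p $ k * dphi p $ 3 + g p $ k $ 3 * phi p) =
               integral (Rect L1 L2) (\<lambda>(x,y). phi (vector [x, y, 1]) * (axis 3 1 :: real^3) $ k
                                            - phi (vector [x, y, 0]) * (axis 1 1 :: real^3) $ k)))"

definition admissible :: "real \<Rightarrow> real \<Rightarrow> (real^3 \<Rightarrow> real^3) \<Rightarrow> bool" where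
  "admissible L1 L2 n \<longleftrightarrow>
     (AE p in lebesgue. p \<in> Omega L1 L2 \<longrightarrow> norm (n p) = 1) \<and> (\<exists>g. adm_grad L1 L2 n g)"

text \<open>Differential quantities of a field value nv with gradient matrix G (G $ k $ i = d n_k/d x_i).\<close>
definition divg :: "real^3^3 \<Rightarrow> real" where
  "divg G = G $ 1 $ 1 + G $ 2 $ 2 + G $ 3 $ 3"

definition curlg :: "real^3^3 \<Rightarrow> real^3" where
  "curlg G = vector [G $ 3 $ 2 - G $ 2 $ 3, G $ 1 $ 3 - G $ 3 $ 1, G $ 2 $ 1 - G $ 1 $ 2]"

definition trsq :: "real^3^3 \<Rightarrow> real" where
  "trsq G = (\<Sum>i\<in>UNIV. \<Sum>j\<in>UNIV. G $ i $ j * G $ j $ i)"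

definition wdens :: "real \<Rightarrow> real \<Rightarrow> real \<Rightarrow> real \<Rightarrow> real \<Rightarrow> real^3 \<Rightarrow> real^3^3 \<Rightarrow> real" where
  "wdens K1 K2 K3 K4 t nv G =
     K1 * (divg G)\<^sup>2 + K2 * (nv \<bullet> curlg G + t)\<^sup>2 + K3 * (norm (cross3 nv (curlg G)))\<^sup>2
     + (K2 + K4) * (trsq G - (divg G)\<^sup>2)"

text \<open>The energy I(n) = integral over Omega of w(n, grad n), with grad n the weak gradient
  (unique a.e. for admissible n, so the value does not depend on the choice).\<close>
definition energy :: "real \<Rightarrow> real \<Rightarrow> real \<Rightarrow> real \<Rightarrow> real \<Rightarrow> real \<Rightarrow> real \<Rightarrow> (real^3 \<Rightarrow> real^3) \<Rightarrow> real" where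
  "energy L1 L2 K1 K2 K3 K4 t n =
     (let g = (SOME g. adm_grad L1 L2 n g) in
      LINT p:Omega L1 L2|lebesgue. wdens K1 K2 K3 K4 t (n p) (g p))"

definition depends_only_on_z :: "real \<Rightarrow> real \<Rightarrow> (real^3 \<Rightarrow> real^3) \<Rightarrow> bool" where
  "depends_only_on_z L1 L2 n \<longleftrightarrow>
     (\<exists>m :: real \<Rightarrow> real^3. AE p in lebesgue. p \<in> Omega L1 L2 \<longrightarrow> n p = m (p $ 3))"

definition Fint :: "real \<Rightarrow> real \<Rightarrow> real \<Rightarrow> real \<Rightarrow> real \<Rightarrow> real \<Rightarrow> real" where
  "Fint K1 K2 K3 t C u =
     sqrt (K1 * (cos u)\<^sup>2 + K3 * (sin u)\<^sup>2) /
     sqrt (C - K2\<^sup>2 * t\<^sup>2 * (cos u)\<^sup>2 / (K2 * (cos u)\<^sup>2 + K3 * (sin u)\<^sup>2))"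

definition nstar :: "(real \<Rightarrow> real) \<Rightarrow> (real \<Rightarrow> real) \<Rightarrow> real^3 \<Rightarrow> real^3" where
  "nstar th ph p = vector [cos (ph (p $ 3)) * cos (th (p $ 3)),
                           sin (ph (p $ 3)) * cos (th (p $ 3)),
                           sin (th (p $ 3))]"

end

theory Submission
  imports Defs
begin

text \<open>If \<open>n\<close> depends on \<open>z\<close> only, the periodic test functions of the Green formula are rich enough
  to force its weak gradient to be \<open>\<gamma>(z)\<close> in the third column and zero elsewhere, where \<open>\<gamma>\<close> is the
  derivative of an absolutely continuous curve \<open>M\<close> on the sphere from \<open>e\<^sub>1\<close> to \<open>e\<^sub>3\<close>. So the energy is
  \<open>4 L\<^sub>1 L\<^sub>2\<close> times a one-dimensional integral, in which the \<open>K\<^sub>4\<close> term vanishes.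

  With \<open>s = M\<^sub>3 = sin \<theta>\<close>, completing squares writes the density plus \<open>C - K\<^sub>2 t\<^sup>2\<close> as a nonnegative defect
  plus the derivative of \<open>2 \<Psi>(\<theta>)\<close>, with \<open>\<Psi>' = sqrt (f (C - q))\<close> for \<open>f = K\<^sub>1 cos\<^sup>2 \<theta> + K\<^sub>3 sin\<^sup>2 \<theta>\<close> and
  \<open>q = K\<^sub>2\<^sup>2 t\<^sup>2 cos\<^sup>2 \<theta> / (K\<^sub>2 cos\<^sup>2 \<theta> + K\<^sub>3 sin\<^sup>2 \<theta>)\<close>. Integrating up to the first \<open>z\<close> at which the curve
  reaches a pole gives the lower bound; a curve that reaches it before \<open>z = 1\<close> pays the positive
  constant \<open>C - K\<^sub>2 t\<^sup>2\<close> on the rest of the interval. A vanishing defect is the first-order system that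
  defines \<open>\<theta>\<^sup>*\<close> and \<open>\<phi>\<^sup>*\<close>.\<close>

section \<open>Absolutely continuous curves\<close>

text \<open>Two obstacles shape the proof. Weak derivatives and boundary values are known only
  through the Green formula, so no curve is differentiated pointwise: a curve is carried together
  with the integrand of its increments. The computation uses A = M_1 M_2' - M_2 M_1' in place of
  cos^2 \<theta> \<phi>', and \<theta> = arcsin M_3 only while |M_3| < 1.

  The constant C is a first integral. Minimising the density over A leaves f \<theta>'^2 + K_2 t^2 -
  q, for which f \<theta>'^2 + q is conserved; C is its value. The normalisation of C says that
  turning from 0 to pi/2 at the speed \<theta>' = sqrt ((C - q) / f) takes exactly the height 1.
  Adding C - K_2 t^2 turns the reduced density into f \<theta>'^2 + (C - q), and x^2 + y^2 \<ge> 2 x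
  y is sharp exactly at that speed.

  A competitor may meet the south pole first. Since \<Psi> is odd the price is the same; a sign
  \<sigma> records which pole it is.\<close>

lemma AE_zero_if_box_integrals_zero:
  fixes h :: "'a::euclidean_space \<Rightarrow> real"
  assumes h: "integrable lborel h"
    and box0: "\<And>a b. (LINT x:box a b|lborel. h x) = 0"
  shows "AE x in lborel. h x = 0"
proof -
  have [measurable]: "h \<in> borel_measurable borel" using h by (auto dest: borel_measurable_integrable)
  \<comment> \<open>\<open>ennreal\<close> sends negative reals to 0, so these two measures have the
    positive and the negative part of \<open>h\<close> as densities. They agree on boxes, an
    intersection-stable generator, hence everywhere, and uniqueness of finite densities equates the
    two parts almost everywhere.\<close>
  let ?P = "density lborel (\<lambda>x. ennreal (h x))" and ?N = "density lborel (\<lambda>x. ennreal (- h x))"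
  have fin: "(\<integral>\<^sup>+x. ennreal (f x) * indicator A x \<partial>lborel) < \<infinity>" if "integrable lborel f" "A \<in> sets borel"
    for f :: "'a \<Rightarrow> real" and A
  proof -
    have "(\<integral>\<^sup>+x. ennreal (f x) * indicator A x \<partial>lborel) \<le> (\<integral>\<^sup>+x. ennreal (norm (f x)) \<partial>lborel)"
      by (intro nn_integral_mono) (auto split: split_indicator intro: ennreal_leI)
    also have "\<dots> < \<infinity>" using that(1) by (auto simp: integrable_iff_bounded)
    finally show ?thesis .
  qed
  have box_eq: "emeasure ?P (box a b) = emeasure ?N (box a b)" for a b
  proof -
    let ?k = "\<lambda>x. indicator (box a b) x *\<^sub>R h x"
    have k: "integrable lborel ?k" using h by (intro integrable_mult_indicator) auto
    have "0 = enn2real (\<integral>\<^sup>+x. ennreal (?k x) \<partial>lborel) - enn2real (\<integral>\<^sup>+x. ennreal (- ?k x) \<partial>lborel)"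
      using real_lebesgue_integral_def[OF k] box0[of a b] by (simp add: set_lebesgue_integral_def)
    moreover have "(\<integral>\<^sup>+x. ennreal (?k x) \<partial>lborel) = (\<integral>\<^sup>+x. ennreal (h x) * indicator (box a b) x \<partial>lborel)"
      by (intro nn_integral_cong) (auto split: split_indicator)
    moreover have "(\<integral>\<^sup>+x. ennreal (- ?k x) \<partial>lborel) = (\<integral>\<^sup>+x. ennreal (- h x) * indicator (box a b) x \<partial>lborel)"
      by (intro nn_integral_cong) (auto split: split_indicator)
    moreover have "(\<integral>\<^sup>+x. ennreal (h x) * indicator (box a b) x \<partial>lborel) < \<infinity>"
       "(\<integral>\<^sup>+x. ennreal (- h x) * indicator (box a b) x \<partial>lborel) < \<infinity>"
      using fin[OF h] fin[of "\<lambda>x. - h x"] h by auto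
    ultimately have "(\<integral>\<^sup>+x. ennreal (h x) * indicator (box a b) x \<partial>lborel)
        = (\<integral>\<^sup>+x. ennreal (- h x) * indicator (box a b) x \<partial>lborel)"
      by (metis ennreal_enn2real eq_iff_diff_eq_0 infinity_ennreal_def)
    then show ?thesis by (simp add: emeasure_density)
  qed
  have "?P = ?N"
  proof (rule measure_eqI_generator_eq)
    let ?E = "range (\<lambda>(a, b). box a b::'a set)"
    show "Int_stable ?E" by (auto simp: Int_stable_def box_Int_box)
    show "?E \<subseteq> Pow UNIV" "sets ?P = sigma_sets UNIV ?E" "sets ?N = sigma_sets UNIV ?E"
      by (simp_all add: borel_eq_box)
    let ?A = "\<lambda>n::nat. box (- (real n *\<^sub>R One)) (real n *\<^sub>R One) :: 'a set"
    show "range ?A \<subseteq> ?E" "(\<Union>i. ?A i) = UNIV" unfolding UN_box_eq_UNIV by auto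
    show "emeasure ?P (?A i) \<noteq> \<infinity>" for i using fin[OF h, of "?A i"] by (simp add: emeasure_density)
    show "emeasure ?P X = emeasure ?N X" if "X \<in> ?E" for X using that box_eq by auto
  qed
  then have "AE x in lborel. ennreal (h x) = ennreal (- h x)"
    by (subst (asm) finite_density_unique) (use fin[OF h, of UNIV] in auto)
  then show ?thesis
    by eventually_elim (metis ennreal_eq_0_iff linorder_linear neg_0_le_iff_le ennreal_inj add.inverse_inverse eq_neg_iff_add_eq_0 less_eq_real_def neg_equal_zero)
qed

text \<open>Absolute continuity in integral form. The derivative \<open>g\<close> is a separate
  datum because it is determined only almost everywhere; the rules below transform the pair, and
  almost everywhere differentiability never enters.\<close>

definition AC_on :: "real \<Rightarrow> real \<Rightarrow> (real \<Rightarrow> 'a::euclidean_space) \<Rightarrow> (real \<Rightarrow> 'a) \<Rightarrow> bool" where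
  "AC_on a b M g \<longleftrightarrow> g absolutely_integrable_on {a..b} \<and>
     (\<forall>u v. a \<le> u \<longrightarrow> u \<le> v \<longrightarrow> v \<le> b \<longrightarrow> M v - M u = integral {u..v} g)"

lemma AC_onD:
  assumes "AC_on a b M g"
  shows "g absolutely_integrable_on {a..b}"
    and "\<And>u v. a \<le> u \<Longrightarrow> u \<le> v \<Longrightarrow> v \<le> b \<Longrightarrow> M v - M u = integral {u..v} g"
  using assms by (auto simp: AC_on_def)

lemma AC_on_subinterval:
  assumes "AC_on a b M g" "a \<le> c" "d \<le> b"
  shows "AC_on c d M g"
  using assms unfolding AC_on_def
  by (auto intro: absolutely_integrable_on_subinterval)

lemma AC_on_continuous:
  assumes "AC_on a b M g"
  shows "continuous_on {a..b} M"
proof -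
  have "g integrable_on {a..b}" using AC_onD(1)[OF assms] by (simp add: absolutely_integrable_on_def)
  then have "continuous_on {a..b} (\<lambda>x. M a + integral {a..x} g)"
    by (intro continuous_intros indefinite_integral_continuous_1)
  moreover have "M a + integral {a..x} g = M x" if "x \<in> {a..b}" for x
    using AC_onD(2)[OF assms, of a x] that by (auto simp: algebra_simps)
  ultimately show ?thesis by (rule continuous_on_eq)
qed

lemma AC_on_linear:
  fixes M :: "real \<Rightarrow> 'a::euclidean_space" and T :: "'a \<Rightarrow> 'b::euclidean_space"
  assumes "AC_on a b M g" "bounded_linear T"
  shows "AC_on a b (\<lambda>z. T (M z)) (\<lambda>z. T (g z))"
  unfolding AC_on_def
proof (intro conjI allI impI)
  have g: "g absolutely_integrable_on {a..b}" using AC_onD(1)[OF assms(1)] .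
  then show "(\<lambda>z. T (g z)) absolutely_integrable_on {a..b}"
    using absolutely_integrable_linear[OF g assms(2)] by (simp add: o_def)
  fix u v assume uv: "a \<le> u" "u \<le> v" "v \<le> b"
  then have "g integrable_on {u..v}"
    using integrable_subinterval_real g absolutely_integrable_on_def by (metis atLeastatMost_subset_iff)
  then have "integral {u..v} (\<lambda>z. T (g z)) = T (integral {u..v} g)"
    using integral_linear[OF _ assms(2), of g "{u..v}"] by (simp add: o_def)
  then show "T (M v) - T (M u) = integral {u..v} (\<lambda>z. T (g z))"
    using AC_onD(2)[OF assms(1) uv] by (simp add: linear_diff[OF bounded_linear.linear[OF assms(2)], symmetric])
qed

lemma AC_on_Pair:
  assumes "AC_on a b M g" "AC_on a b N h"
  shows "AC_on a b (\<lambda>z. (M z, N z)) (\<lambda>z. (g z, h z))"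
proof -
  have l: "bounded_linear (\<lambda>x::'a. (x, 0::'b))" "bounded_linear (\<lambda>y::'b. (0::'a, y))"
    by (auto intro!: bounded_linear_Pair bounded_linear_ident bounded_linear_zero)
  from AC_on_linear[OF assms(1) l(1)] AC_on_linear[OF assms(2) l(2)]
  have 1: "AC_on a b (\<lambda>z. (M z, 0::'b)) (\<lambda>z. (g z, 0::'b))" and 2: "AC_on a b (\<lambda>z. (0::'a, N z)) (\<lambda>z. (0::'a, h z))" .
  have i: "(\<lambda>z. (g z, 0::'b)) integrable_on {u..v}" "(\<lambda>z. (0::'a, h z)) integrable_on {u..v}" if "a \<le> u" "v \<le> b" for u v
    using AC_onD(1)[OF AC_on_subinterval[OF 1 that]] AC_onD(1)[OF AC_on_subinterval[OF 2 that]]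
    by (auto simp: absolutely_integrable_on_def)
  show ?thesis unfolding AC_on_def
  proof (intro conjI allI impI)
    show "(\<lambda>z. (g z, h z)) absolutely_integrable_on {a..b}"
      using set_integral_add(1)[OF AC_onD(1)[OF 1] AC_onD(1)[OF 2]] by simp
    fix u v assume uv: "a \<le> u" "u \<le> v" "v \<le> b"
    show "(M v, N v) - (M u, N u) = integral {u..v} (\<lambda>z. (g z, h z))"
      using integral_add[OF i[OF uv(1,3)]] AC_onD(2)[OF 1 uv, symmetric] AC_onD(2)[OF 2 uv, symmetric] by simp
  qed
qed

lemma AC_on_C1:
  fixes F :: "real \<Rightarrow> 'a::euclidean_space"
  assumes "\<And>z. z \<in> {a..b} \<Longrightarrow> (F has_vector_derivative f z) (at z within {a..b})" "continuous_on {a..b} f"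
  shows "AC_on a b F f"
  unfolding AC_on_def
proof (intro conjI allI impI)
  show "f absolutely_integrable_on {a..b}" using absolutely_integrable_continuous_real assms(2) .
  fix u v assume uv: "a \<le> u" "u \<le> v" "v \<le> b"
  have "(f has_integral F v - F u) {u..v}"
    using uv by (intro fundamental_theorem_of_calculus) (auto intro!: has_vector_derivative_within_subset[OF assms(1)])
  then show "F v - F u = integral {u..v} f" by (simp add: integral_unique)
qed

text \<open>Made for the profile \<open>th\<close>, whose derivative comes from the inverse function
  rule and is therefore known at interior points only.\<close>

lemma AC_on_interior_derivative:
  fixes u :: "real \<Rightarrow> real"
  assumes "continuous_on {a..b} u" "continuous_on {a..b} g" "\<And>z. z \<in> {a<..<b} \<Longrightarrow> (u has_real_derivative g z) (at z)"
  shows "AC_on a b u g"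
  unfolding AC_on_def
proof (intro conjI allI impI)
  show "g absolutely_integrable_on {a..b}" using assms(2) by (rule absolutely_integrable_continuous_real)
  fix x y assume xy: "a \<le> x" "x \<le> y" "y \<le> b"
  have "(g has_integral u y - u x) {x..y}"
  proof (rule fundamental_theorem_of_calculus_interior[OF xy(2)])
    show "continuous_on {x..y} u" by (rule continuous_on_subset[OF assms(1)]) (use xy in auto)
    show "(u has_vector_derivative g z) (at z)" if "z \<in> {x<..<y}" for z
      using assms(3)[of z] that xy by (auto simp: has_real_derivative_iff_has_vector_derivative)
  qed
  then show "u y - u x = integral {x..y} g" by (simp add: integral_unique)
qed

text \<open>Bisection proves the estimate \<open>\<bar>F (M v) - F (M u) - \<integral> D (M z) \<bullet> g z\<bar> \<le> e \<integral> norm (g z)\<close>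
  for every \<open>e > 0\<close>: it is additive in the interval and holds on short ones.\<close>

lemma AC_on_chain:
  fixes M :: "real \<Rightarrow> 'a::euclidean_space" and F :: "'a \<Rightarrow> real"
  assumes M: "AC_on a b M g" and U: "open U" "M ` {a..b} \<subseteq> U"
    and F: "\<And>x. x \<in> U \<Longrightarrow> (F has_derivative (\<lambda>h. D x \<bullet> h)) (at x)" and D: "continuous_on U D"
  shows "AC_on a b (\<lambda>z. F (M z)) (\<lambda>z. D (M z) \<bullet> g z)"
proof -
  have g: "g absolutely_integrable_on {a..b}" using AC_onD(1)[OF M] .
  have cM: "continuous_on {a..b} M" using AC_on_continuous[OF M] .
  have cD: "continuous_on {a..b} (\<lambda>z. D (M z))"
    using continuous_on_compose2[OF D cM] U(2) by blast
  have bil: "bilinear ((\<bullet>) :: 'a \<Rightarrow> 'a \<Rightarrow> real)"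
    by (simp add: bilinear_conv_bounded_bilinear bounded_bilinear_inner)
  have Dg: "(\<lambda>z. D (M z) \<bullet> g z) absolutely_integrable_on {a..b}"
    by (intro absolutely_integrable_bounded_measurable_product[OF bil] g)
       (auto intro!: continuous_imp_measurable_on_sets_lebesgue cD compact_imp_bounded compact_continuous_image)
  have sub: "f integrable_on {u..v}" if "f absolutely_integrable_on {a..b}" "a \<le> u" "v \<le> b" for f :: "real \<Rightarrow> 'c::euclidean_space" and u v
    using integrable_subinterval_real that absolutely_integrable_on_def by (metis atLeastatMost_subset_iff)
  have ng: "(\<lambda>z. norm (g z)) absolutely_integrable_on {a..b}" using absolutely_integrable_norm[OF g] by (simp add: o_def)
  have est: "\<bar>F (M v) - F (M u) - integral {u..v} (\<lambda>z. D (M z) \<bullet> g z)\<bar> \<le> e * integral {u..v} (\<lambda>z. norm (g z))"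
    if uv: "a \<le> u" "u \<le> v" "v \<le> b" and e: "e > 0" for u v e
  proof -
    have "a \<le> u \<longrightarrow> v \<le> b \<longrightarrow> ?thesis" using uv(2)
    proof (induction u v rule: Bolzano)
      case (trans p q r)
      show ?case
      proof (intro impI)
        assume pr: "a \<le> p" "r \<le> b"
        have I: "integral {p..q} (\<lambda>z. D (M z) \<bullet> g z) + integral {q..r} (\<lambda>z. D (M z) \<bullet> g z) = integral {p..r} (\<lambda>z. D (M z) \<bullet> g z)"
          "integral {p..q} (\<lambda>z. norm (g z)) + integral {q..r} (\<lambda>z. norm (g z)) = integral {p..r} (\<lambda>z. norm (g z))"
          by (rule Henstock_Kurzweil_Integration.integral_combine[OF trans(3,4) sub[OF Dg pr]], rule Henstock_Kurzweil_Integration.integral_combine[OF trans(3,4) sub[OF ng pr]])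
        have J: "\<bar>F (M q) - F (M p) - integral {p..q} (\<lambda>z. D (M z) \<bullet> g z)\<bar> \<le> e * integral {p..q} (\<lambda>z. norm (g z))"
          "\<bar>F (M r) - F (M q) - integral {q..r} (\<lambda>z. D (M z) \<bullet> g z)\<bar> \<le> e * integral {q..r} (\<lambda>z. norm (g z))"
          using trans pr by auto
        show "\<bar>F (M r) - F (M p) - integral {p..r} (\<lambda>z. D (M z) \<bullet> g z)\<bar> \<le> e * integral {p..r} (\<lambda>z. norm (g z))"
          using J unfolding I[symmetric] distrib_left by linarith
      qed
    next
      case (local x)
      have xab: "x \<in> {a..b}" using local uv by auto
      then have xU: "M x \<in> U" using U by auto
      obtain r1 where r1: "r1 > 0" "ball (M x) r1 \<subseteq> U" using U(1) xU openE by blast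
      obtain r2 where r2: "r2 > 0" "\<And>y. y \<in> U \<Longrightarrow> dist y (M x) < r2 \<Longrightarrow> dist (D y) (D (M x)) < e/2"
        using D xU e unfolding continuous_on_iff by (meson half_gt_zero)
      define r where "r = min r1 r2"
      have r: "r > 0" "ball (M x) r \<subseteq> U" "\<And>y. y \<in> ball (M x) r \<Longrightarrow> norm (D y - D (M x)) \<le> e/2"
        using r1 r2 by (auto simp: r_def dist_norm subset_iff less_imp_le norm_minus_commute)
      obtain d where d: "d > 0" "\<And>y. y \<in> {a..b} \<Longrightarrow> dist y x < d \<Longrightarrow> dist (M y) (M x) < r"
        using cM xab r(1) unfolding continuous_on_iff by blast
      show ?case
      proof (intro exI[of _ d] conjI allI impI d(1))
        fix p q assume pq: "p \<le> x \<and> x \<le> q \<and> q - p < d" "a \<le> p" "q \<le> b"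
        have B: "M z \<in> ball (M x) r" if "z \<in> {p..q}" for z
          using d(2)[of z] that pq by (auto simp: dist_real_def dist_commute)
        define c where "c = D (M x)"
        have Mq: "M q - M p = integral {p..q} g" using AC_onD(2)[OF M] pq by auto
        have nMq: "norm (M q - M p) \<le> integral {p..q} (\<lambda>z. norm (g z))"
          unfolding Mq using pq by (intro integral_norm_bound_integral sub[OF g] sub[OF ng]) auto
        \<comment> \<open>The error is split into halves. \<open>F\<close> minus its linear part
          \<open>c\<close> has gradient at most \<open>e/2\<close> on the ball, which bounds its
          increment; further down, replacing \<open>D (M z)\<close> by \<open>c\<close> under the
          integral costs another \<open>e/2\<close>.\<close>
        have "norm ((F (M q) - c \<bullet> M q) - (F (M p) - c \<bullet> M p)) \<le> e/2 * norm (M q - M p)"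
        proof (rule differentiable_bound)
          show "convex (ball (M x) r)" by simp
          fix y assume y: "y \<in> ball (M x) r"
          have "y \<in> U" using r(2) y by blast
          show "((\<lambda>y. F y - c \<bullet> y) has_derivative (\<lambda>h. D y \<bullet> h - c \<bullet> h)) (at y within ball (M x) r)"
            by (rule has_derivative_at_withinI, rule has_derivative_diff[OF F], fact, rule has_derivative_inner_right, rule has_derivative_ident)
          show "onorm (\<lambda>h. D y \<bullet> h - c \<bullet> h) \<le> e/2"
          proof (rule onorm_le)
            fix h
            have "norm (D y \<bullet> h - c \<bullet> h) \<le> norm (D y - c) * norm h"
              unfolding inner_diff_left[symmetric] real_norm_def by (rule Cauchy_Schwarz_ineq2)
            also have "\<dots> \<le> e/2 * norm h" using r(3)[OF y] unfolding c_def by (intro mult_right_mono norm_ge_zero)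
            finally show "norm (D y \<bullet> h - c \<bullet> h) \<le> e/2 * norm h" .
          qed
        qed (use B pq in auto)
        then have 1: "\<bar>F (M q) - F (M p) - c \<bullet> (M q - M p)\<bar> \<le> e/2 * integral {p..q} (\<lambda>z. norm (g z))"
          using mult_left_mono[OF nMq, of "e/2"] e unfolding inner_diff_right real_norm_def by linarith
        have cg: "(\<lambda>z. c \<bullet> g z) integrable_on {p..q}" "integral {p..q} (\<lambda>z. c \<bullet> g z) = c \<bullet> (M q - M p)"
          using integrable_linear[OF sub[OF g pq(2,3)] bounded_linear_inner_right[of c]]
            integral_linear[OF sub[OF g pq(2,3)] bounded_linear_inner_right[of c]] unfolding Mq o_def by blast+
        have "norm (integral {p..q} (\<lambda>z. D (M z) \<bullet> g z - c \<bullet> g z)) \<le> integral {p..q} (\<lambda>z. e/2 * norm (g z))"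
        proof (rule integral_norm_bound_integral)
          show "(\<lambda>z. D (M z) \<bullet> g z - c \<bullet> g z) integrable_on {p..q}" "(\<lambda>z. e/2 * norm (g z)) integrable_on {p..q}"
            by (rule integrable_diff[OF sub[OF Dg pq(2,3)] cg(1)], rule integrable_on_mult_right[OF sub[OF ng pq(2,3)]])
          fix z assume z: "z \<in> {p..q}"
          have "norm (D (M z) \<bullet> g z - c \<bullet> g z) \<le> norm (D (M z) - c) * norm (g z)"
            unfolding inner_diff_left[symmetric] real_norm_def by (rule Cauchy_Schwarz_ineq2)
          also have "\<dots> \<le> e/2 * norm (g z)" using r(3)[OF B[OF z]] unfolding c_def by (intro mult_right_mono norm_ge_zero)
          finally show "norm (D (M z) \<bullet> g z - c \<bullet> g z) \<le> e/2 * norm (g z)" .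
        qed
        then have 2: "\<bar>integral {p..q} (\<lambda>z. D (M z) \<bullet> g z) - c \<bullet> (M q - M p)\<bar> \<le> e/2 * integral {p..q} (\<lambda>z. norm (g z))"
          unfolding integral_diff[OF sub[OF Dg pq(2,3)] cg(1)] cg(2) by simp
        show "\<bar>F (M q) - F (M p) - integral {p..q} (\<lambda>z. D (M z) \<bullet> g z)\<bar> \<le> e * integral {p..q} (\<lambda>z. norm (g z))"
          using 1 2 by linarith
      qed
    qed
    then show ?thesis using uv by auto
  qed
  show ?thesis unfolding AC_on_def
  proof (intro conjI allI impI Dg)
    fix u v assume uv: "a \<le> u" "u \<le> v" "v \<le> b"
    let ?X = "\<bar>F (M v) - F (M u) - integral {u..v} (\<lambda>z. D (M z) \<bullet> g z)\<bar>" and ?Y = "integral {u..v} (\<lambda>z. norm (g z))"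
    have "?Y \<ge> 0" by (intro integral_nonneg sub[OF ng]) (use uv in auto)
    have "?X \<le> 0"
    proof (rule field_le_epsilon)
      fix e :: real assume "e > 0"
      \<comment> \<open>The denominator \<open>?Y + 1\<close> keeps the parameter meaningful when
        the integral \<open>?Y\<close> is zero.\<close>
      have "?X \<le> e / (?Y + 1) * ?Y" using \<open>?Y \<ge> 0\<close> \<open>e > 0\<close> by (intro est[OF uv] divide_pos_pos) linarith+
      also have "\<dots> = e * (?Y / (?Y + 1))" by simp
      also have "\<dots> \<le> e * 1" using \<open>?Y \<ge> 0\<close> \<open>e > 0\<close> by (intro mult_left_mono) (auto simp: divide_le_eq)
      finally show "?X \<le> 0 + e" by simp
    qed
    then show "F (M v) - F (M u) = integral {u..v} (\<lambda>z. D (M z) \<bullet> g z)" by simp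
  qed
qed

section \<open>Fubini on the slab\<close>

text \<open>The vertical coordinate comes first, so that a binary product separates it from the
  horizontal pair.\<close>

definition point_of :: "real \<times> real \<times> real \<Rightarrow> real^3" where
  "point_of w = vector [fst (snd w), snd (snd w), fst w]"

lemma point_of_nth [simp]:
  "point_of (z, x, y) $ 1 = x" "point_of (z, x, y) $ 2 = y" "point_of (z, x, y) $ 3 = z"
  "point_of (z, q) $ 3 = z"
  by (simp_all add: point_of_def)

lemma point_of_nth' [simp]: "point_of w $ 3 = fst w"
  by (simp add: point_of_def)

lemma continuous_on_vector_3 [continuous_intros]:
  fixes f :: "'a::topological_space \<Rightarrow> real"
  assumes "continuous_on S f" "continuous_on S g" "continuous_on S h"
  shows "continuous_on S (\<lambda>x. vector [f x, g x, h x] :: real^3)"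
proof -
  have eq: "(\<lambda>x. vector [f x, g x, h x] :: real^3) = (\<lambda>x. f x *\<^sub>R axis 1 1 + g x *\<^sub>R axis 2 1 + h x *\<^sub>R axis 3 1)"
    by (auto simp: fun_eq_iff vec_eq_iff forall_3 axis_def)
  show ?thesis unfolding eq by (intro continuous_intros assms)
qed

lemma continuous_point_of [continuous_intros]:
  "continuous_on S f \<Longrightarrow> continuous_on S (\<lambda>x. point_of (f x))"
  unfolding point_of_def by (intro continuous_intros)

lemma point_of_measurable [measurable]: "point_of \<in> borel_measurable borel"
  by (intro borel_measurable_continuous_onI continuous_intros continuous_on_id)

abbreviation Base :: "real \<Rightarrow> real \<Rightarrow> (real \<times> real) set" where
  "Base L1 L2 \<equiv> box (-L1, -L2) (L1, L2)"

lemma box_pair: "box (a, c) (b, d) = box a b \<times> box c d"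
  for a b :: "'a::euclidean_space" and c d :: "'b::euclidean_space"
  by (auto simp: box_def Basis_prod_def ball_Un)

lemma Rect_eq_cbox: "Rect L1 L2 = cbox (-L1, -L2) (L1, L2)"
  by (simp add: Rect_def cbox_Pair_eq)

lemma mem_Omega_iff:
  "p \<in> Omega L1 L2 \<longleftrightarrow> -L1 < p$1 \<and> p$1 < L1 \<and> -L2 < p$2 \<and> p$2 < L2 \<and> 0 < p$3 \<and> p$3 < 1"
  by (auto simp: Omega_def mem_box_cart forall_3)

lemma mem_Base_iff: "(x, y) \<in> Base L1 L2 \<longleftrightarrow> -L1 < x \<and> x < L1 \<and> -L2 < y \<and> y < L2"
  by (simp add: box_pair)

lemma point_of_mem_Omega_iff: "point_of (z, q) \<in> Omega L1 L2 \<longleftrightarrow> z \<in> {0<..<1} \<and> q \<in> Base L1 L2"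
  by (cases q) (auto simp: mem_Omega_iff mem_Base_iff)

lemma indicator_Omega_point_of:
  "(indicator (Omega L1 L2) (point_of (z, q)) :: real) = indicator {0<..<1} z * indicator (Base L1 L2) q"
  by (simp add: point_of_mem_Omega_iff split: split_indicator)

lemma Omega_sets [measurable]: "Omega L1 L2 \<in> sets borel" "Omega L1 L2 \<in> sets lebesgue"
  by (auto simp: Omega_def)

lemma emeasure_lborel_Times:
  fixes A :: "'a::euclidean_space set" and B :: "'b::euclidean_space set"
  assumes "A \<in> sets borel" "B \<in> sets borel"
  shows "emeasure lborel (A \<times> B) = emeasure lborel A * emeasure lborel B"
  unfolding lborel_prod[symmetric] using assms by (intro lborel.emeasure_pair_measure_Times) auto

lemma Basis_real_3: "(Basis :: (real^3) set) = {axis 1 1, axis 2 1, axis 3 1}"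
  by (simp add: Basis_vec_def UNIV_3 insert_commute)

text \<open>Lebesgue measure is characterised by its values on boxes, and the preimage of a box
  under a permutation of coordinates is a product of intervals.\<close>

lemma lborel_eq_distr_point_of: "lborel = distr (lborel \<Otimes>\<^sub>M (lborel \<Otimes>\<^sub>M lborel)) borel point_of"
proof (rule lborel_eqI)
  fix l u :: "real^3"
  assume le: "\<And>b. b \<in> Basis \<Longrightarrow> l \<bullet> b \<le> u \<bullet> b"
  have le': "l $ i \<le> u $ i" for i using le[of "axis i 1"] by (auto simp: inner_axis Basis_vec_def)
  have "point_of -` box l u = {l$3<..<u$3} \<times> ({l$1<..<u$1} \<times> {l$2<..<u$2})"
    by (auto simp: mem_box_cart forall_3 point_of_def)
  then have "emeasure (distr (lborel \<Otimes>\<^sub>M (lborel \<Otimes>\<^sub>M lborel)) borel point_of) (box l u)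
      = emeasure (lborel \<Otimes>\<^sub>M (lborel \<Otimes>\<^sub>M lborel)) ({l$3<..<u$3} \<times> ({l$1<..<u$1} \<times> {l$2<..<u$2}))"
    unfolding lborel_prod by (subst emeasure_distr) simp_all
  also have "\<dots> = ennreal (u$3 - l$3) * (ennreal (u$1 - l$1) * ennreal (u$2 - l$2))"
    using le' unfolding lborel_prod by (simp add: emeasure_lborel_Times borel_Times)
  also have "\<dots> = ennreal ((u$3 - l$3) * ((u$1 - l$1) * (u$2 - l$2)))"
    using le' by (simp add: ennreal_mult)
  also have "(u$3 - l$3) * ((u$1 - l$1) * (u$2 - l$2)) = (\<Prod>b\<in>Basis. (u - l) \<bullet> b)"
    unfolding Basis_real_3 by (simp add: axis_eq_axis inner_axis)
  finally show "emeasure (distr (lborel \<Otimes>\<^sub>M (lborel \<Otimes>\<^sub>M lborel)) borel point_of) (box l u) = (\<Prod>b\<in>Basis. (u - l) \<bullet> b)" .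
qed simp

lemma integrable_point_of:
  assumes "integrable lborel (h :: real^3 \<Rightarrow> real)"
  shows "integrable (lborel \<Otimes>\<^sub>M lborel) (\<lambda>(z, q). h (point_of (z, q :: real \<times> real)))"
proof -
  have "integrable (distr (lborel \<Otimes>\<^sub>M (lborel \<Otimes>\<^sub>M lborel)) borel point_of) h"
    using assms by (subst lborel_eq_distr_point_of[symmetric])
  then have "integrable (lborel \<Otimes>\<^sub>M (lborel \<Otimes>\<^sub>M lborel)) (\<lambda>w. h (point_of w))"
    by (rule integrable_distr[rotated]) (simp add: lborel_prod)
  then show ?thesis by (simp add: lborel_prod case_prod_beta')
qed

text \<open>Both orders of integration are needed: horizontal slices first for functions of z alone
  and for lateral derivatives, vertical lines first for integration by parts in z.\<close>

lemma fubini_point_of: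
  assumes h: "integrable lborel (h :: real^3 \<Rightarrow> real)"
  shows "(LINT p|lborel. h p) = (LINT z|lborel. LINT q|lborel. h (point_of (z, q)))"
    and "(LINT p|lborel. h p) = (LINT q|lborel. LINT z|lborel. h (point_of (z, q)))"
    and "integrable lborel (\<lambda>z. LINT q|lborel. h (point_of (z, q)))"
    and "AE z in lborel. integrable lborel (\<lambda>q. h (point_of (z, q)))"
    and "AE q in lborel. integrable lborel (\<lambda>z. h (point_of (z, q)))"
proof -
  note i = integrable_point_of[OF h]
  have "(LINT p|lborel. h p) = integral\<^sup>L (distr (lborel \<Otimes>\<^sub>M (lborel \<Otimes>\<^sub>M lborel)) borel point_of) h"
    by (subst lborel_eq_distr_point_of[symmetric]) (rule refl)
  also have "\<dots> = integral\<^sup>L (lborel \<Otimes>\<^sub>M (lborel \<Otimes>\<^sub>M lborel)) (\<lambda>w. h (point_of w))"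
    using h by (intro integral_distr) (auto simp: lborel_prod dest: borel_measurable_integrable)
  also have "\<dots> = integral\<^sup>L (lborel \<Otimes>\<^sub>M lborel) (\<lambda>(z, q). h (point_of (z, q)))"
    by (simp add: lborel_prod case_prod_beta')
  finally have e: "(LINT p|lborel. h p) = integral\<^sup>L (lborel \<Otimes>\<^sub>M lborel) (\<lambda>(z, q). h (point_of (z, q)))" .
  show "(LINT p|lborel. h p) = (LINT z|lborel. LINT q|lborel. h (point_of (z, q)))"
    using lborel_pair.integral_fst[OF i] e by simp
  show "(LINT p|lborel. h p) = (LINT q|lborel. LINT z|lborel. h (point_of (z, q)))"
    using lborel_pair.integral_snd[OF i] e by simp
  show "integrable lborel (\<lambda>z. LINT q|lborel. h (point_of (z, q)))"
    using lborel_pair.integrable_fst[OF i] .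
  show "AE z in lborel. integrable lborel (\<lambda>q. h (point_of (z, q)))"
    using lborel_pair.AE_integrable_fst[OF i] .
  show "AE q in lborel. integrable lborel (\<lambda>z. h (point_of (z, q)))"
    using lborel_pair.AE_integrable_snd[OF i] .
qed

lemma AE_point_of:
  assumes "AE p in lebesgue. P p"
  shows "AE z in lborel. AE q in lborel. P (point_of (z, q))"
proof -
  have "AE p in distr (lborel \<Otimes>\<^sub>M (lborel \<Otimes>\<^sub>M lborel)) borel point_of. P p"
    using assms unfolding AE_completion_iff by (subst lborel_eq_distr_point_of[symmetric])
  then have "AE w in lborel \<Otimes>\<^sub>M (lborel \<Otimes>\<^sub>M lborel). P (point_of w)"
    by (rule AE_distrD[rotated]) (simp add: lborel_prod)
  then have "AE w in (lborel :: real measure) \<Otimes>\<^sub>M (lborel :: (real \<times> real) measure). P (point_of w)"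
    unfolding lborel_prod .
  then show ?thesis using lborel_pair.AE_pair[of "\<lambda>w. P (point_of w)"] by simp
qed

lemma Base_measure:
  assumes "L1 > 0" "L2 > 0"
  shows "measure lborel (Base L1 L2) = 4 * L1 * L2" "emeasure lborel (Base L1 L2) = ennreal (4 * L1 * L2)"
proof -
  show "emeasure lborel (Base L1 L2) = ennreal (4 * L1 * L2)"
    using assms by (simp add: box_pair emeasure_lborel_Times ennreal_mult[symmetric])
  then show "measure lborel (Base L1 L2) = 4 * L1 * L2" using assms by (simp add: measure_def)
qed

lemma integrable_indicator_bounded:
  fixes f :: "'a::euclidean_space \<Rightarrow> real"
  assumes "f \<in> borel_measurable borel" "bounded S" "S \<in> sets borel" "\<And>x. x \<in> S \<Longrightarrow> \<bar>f x\<bar> \<le> B"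
  shows "integrable lborel (\<lambda>x. indicator S x * f x)"
proof -
  have "emeasure lborel S < \<infinity>" using assms(2) by (rule emeasure_bounded_finite)
  then have "integrable lborel (\<lambda>x. indicator S x * B)" using assms(3) by (intro integrable_mult_left) auto
  then show ?thesis
    by (rule Bochner_Integration.integrable_bound) (use assms in \<open>auto split: split_indicator intro!: AE_I2 order_trans[OF _ abs_ge_self]\<close>)
qed

section \<open>Periodic test functions separate integrable functions\<close>

lemma gradient_product_3:
  fixes a b c a' b' c' :: "real \<Rightarrow> real" and p :: "real^3"
  assumes "(a has_real_derivative a' (p$1)) (at (p$1))" "(b has_real_derivative b' (p$2)) (at (p$2))"
    "(c has_real_derivative c' (p$3)) (at (p$3))"
  shows "((\<lambda>p. a (p$1) * b (p$2) * c (p$3)) has_derivative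
     (\<lambda>h. vector [a' (p$1) * b (p$2) * c (p$3), a (p$1) * b' (p$2) * c (p$3), a (p$1) * b (p$2) * c' (p$3)] \<bullet> h)) (at p)"
proof -
  have l: "((\<lambda>p::real^3. p $ i) has_derivative (\<lambda>h. h $ i)) (at p)" for i
    by (rule bounded_linear.has_derivative[OF bounded_linear_vec_nth has_derivative_ident])
  have 1: "((\<lambda>p. a (p$1)) has_derivative (\<lambda>h. a' (p$1) * h$1)) (at p)"
    using has_derivative_compose[OF l] assms(1) unfolding has_field_derivative_def by auto
  have 2: "((\<lambda>p. b (p$2)) has_derivative (\<lambda>h. b' (p$2) * h$2)) (at p)"
    using has_derivative_compose[OF l] assms(2) unfolding has_field_derivative_def by auto
  have 3: "((\<lambda>p. c (p$3)) has_derivative (\<lambda>h. c' (p$3) * h$3)) (at p)"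
    using has_derivative_compose[OF l] assms(3) unfolding has_field_derivative_def by auto
  have i: "vector [u, v, w] \<bullet> h = u * h$1 + v * h$2 + w * h$3" for u v w :: real and h :: "real^3"
    by (simp add: inner_vec_def sum_3)
  have "((\<lambda>p. a (p$1) * b (p$2) * c (p$3)) has_derivative
     (\<lambda>h. (a (p$1) * b (p$2)) * (c' (p$3) * h$3) + (a (p$1) * (b' (p$2) * h$2) + a' (p$1) * h$1 * b (p$2)) * c (p$3))) (at p)"
    by (rule has_derivative_mult[OF has_derivative_mult[OF 1 2] 3])
  moreover have "(a (p$1) * b (p$2)) * (c' (p$3) * h$3) + (a (p$1) * (b' (p$2) * h$2) + a' (p$1) * h$1 * b (p$2)) * c (p$3) =
      a' (p$1) * b (p$2) * c (p$3) * h$1 + a (p$1) * b' (p$2) * c (p$3) * h$2 + a (p$1) * b (p$2) * c' (p$3) * h$3" for h :: "real^3"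
    by algebra
  ultimately show ?thesis unfolding i by (simp only:)
qed

lemma periodic_test_product:
  assumes a: "\<And>x. (a has_real_derivative a' x) (at x)" "continuous_on UNIV a'" "\<And>x. a (x + 2 * L1) = a x"
    and b: "\<And>x. (b has_real_derivative b' x) (at x)" "continuous_on UNIV b'" "\<And>x. b (x + 2 * L2) = b x"
    and c: "\<And>x. (c has_real_derivative c' x) (at x)" "continuous_on UNIV c'"
  shows "periodic_test L1 L2 (\<lambda>p. a (p$1) * b (p$2) * c (p$3))
    (\<lambda>p. vector [a' (p$1) * b (p$2) * c (p$3), a (p$1) * b' (p$2) * c (p$3), a (p$1) * b (p$2) * c' (p$3)])"
proof -
  have co: "continuous_on UNIV a" "continuous_on UNIV b" "continuous_on UNIV c"
    using DERIV_isCont[OF a(1)] DERIV_isCont[OF b(1)] DERIV_isCont[OF c(1)]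
    by (auto intro!: continuous_at_imp_continuous_on)
  have comp: "continuous_on UNIV (\<lambda>p::real^3. f (p $ i))" if "continuous_on UNIV f" for f :: "real \<Rightarrow> real" and i
    by (rule continuous_on_compose2[OF that]) (auto intro!: continuous_intros)
  show ?thesis unfolding periodic_test_def
  proof (intro conjI allI)
    fix p :: "real^3"
    show "((\<lambda>p. a (p$1) * b (p$2) * c (p$3)) has_derivative
     (\<lambda>h. vector [a' (p$1) * b (p$2) * c (p$3), a (p$1) * b' (p$2) * c (p$3), a (p$1) * b (p$2) * c' (p$3)] \<bullet> h)) (at p)"
      by (intro gradient_product_3 a b c)
    show "continuous_on UNIV (\<lambda>p::real^3. vector [a' (p$1) * b (p$2) * c (p$3), a (p$1) * b' (p$2) * c (p$3), a (p$1) * b (p$2) * c' (p$3)] :: real^3)"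
      by (intro continuous_intros comp co a b c)
  qed (simp_all add: axis_def a b)
qed

text \<open>A continuously differentiable step function: squaring the positive part makes the
  derivative continuous at \<open>0\<close>. As \<open>j\<close> grows the values tend to 1 at every
  positive \<open>s\<close> and stay 0 at all others.\<close>

definition cutoff :: "nat \<Rightarrow> real \<Rightarrow> real" where
  "cutoff j s = 1 - 1 / (1 + real j * (max s 0)\<^sup>2)"

lemma cutoff_deriv:
  "(cutoff j has_real_derivative real j * (2 * max s 0) / (1 + real j * (max s 0)\<^sup>2)\<^sup>2) (at s)"
proof -
  have m: "((\<lambda>s::real. (max s 0)\<^sup>2) has_real_derivative 2 * max s 0) (at s)"
  proof -
    consider "s > 0" | "s < 0" | "s = 0" by linarith
    then show ?thesis
    proof cases
      case 1
      have "((\<lambda>s::real. s\<^sup>2) has_real_derivative 2 * max s 0) (at s)"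
        using 1 by (auto intro!: derivative_eq_intros)
      then show ?thesis
        by (rule has_field_derivative_transform_within_open[where S = "{0<..}"]) (use 1 in auto)
    next
      case 2
      have "((\<lambda>s::real. 0) has_real_derivative 2 * max s 0) (at s)" using 2 by auto
      then show ?thesis
        by (rule has_field_derivative_transform_within_open[where S = "{..<0}"]) (use 2 in auto)
    next
      case 3
      have "((\<lambda>h::real. (max h 0)\<^sup>2 / h) \<longlongrightarrow> 0) (at 0)"
      proof (rule tendsto_rabs_zero_cancel, rule tendsto_sandwich[OF _ _ tendsto_const])
        show "((\<lambda>h::real. \<bar>h\<bar>) \<longlongrightarrow> 0) (at 0)" by (intro tendsto_rabs_zero tendsto_ident_at)
      qed (auto intro!: always_eventually simp: max_def power2_eq_square)
      then show ?thesis using 3 by (simp add: DERIV_def)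
    qed
  qed
  have p: "1 + real j * (max s 0)\<^sup>2 \<noteq> 0"
    by (metis add_pos_nonneg less_irrefl mult_nonneg_nonneg of_nat_0_le_iff zero_le_power2 zero_less_one)
  show ?thesis unfolding cutoff_def
    by (rule derivative_eq_intros m | simp add: p)+ (simp add: power2_eq_square)
qed

lemma cutoff_deriv_continuous:
  "continuous_on UNIV (\<lambda>s. real j * (2 * max s 0) / (1 + real j * (max s 0)\<^sup>2)\<^sup>2)"
proof -
  have p: "1 + real j * (max s 0)\<^sup>2 \<noteq> 0" for s
    by (metis add_pos_nonneg less_irrefl mult_nonneg_nonneg of_nat_0_le_iff zero_le_power2 zero_less_one)
  show ?thesis by (intro continuous_intros) (simp add: p)
qed

lemma cutoff_bounds: "0 \<le> cutoff j s" "cutoff j s \<le> 1"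
proof -
  have "1 + real j * (max s 0)\<^sup>2 \<ge> 1" by simp
  then show "0 \<le> cutoff j s" "cutoff j s \<le> 1" unfolding cutoff_def by (auto simp: divide_le_eq)
qed

lemma cutoff_tendsto: "(\<lambda>j. cutoff j s) \<longlonglongrightarrow> (if s > 0 then 1 else 0)"
proof (cases "s > 0")
  case True
  have "filterlim (\<lambda>j. 1 + s\<^sup>2 * real j) at_top sequentially"
    using True by (intro filterlim_tendsto_add_at_top[OF tendsto_const]
       filterlim_tendsto_pos_mult_at_top[OF tendsto_const _ filterlim_real_sequentially]) auto
  then have "(\<lambda>j. 1 / (1 + s\<^sup>2 * real j)) \<longlonglongrightarrow> 0"
    by (rule tendsto_divide_0[OF tendsto_const filterlim_at_top_imp_at_infinity])
  from tendsto_diff[OF tendsto_const this, of 1] show ?thesis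
    using True by (simp add: cutoff_def max_def mult.commute)
qed (simp add: cutoff_def max_def)

text \<open>The sign of \<open>cos (\<pi> (x - m) / L) - cos (\<pi> r / L)\<close>, a function of period \<open>2 L\<close>, detects the
  interval of centre \<open>m\<close> and radius \<open>r\<close>; composing it with a smoothed step function approximates
  the indicator of the interval.\<close>

lemma cos_detects_interval:
  assumes "L > 0" "-L \<le> \<alpha>" "\<alpha> < \<beta>" "\<beta> \<le> L" "-L < x" "x < L"
  shows "cos (pi * (x - (\<alpha> + \<beta>) / 2) / L) - cos (pi * ((\<beta> - \<alpha>) / 2) / L) > 0 \<longleftrightarrow> \<alpha> < x \<and> x < \<beta>"
proof -
  define d where "d = \<bar>x - (\<alpha> + \<beta>) / 2\<bar>"
  define r where "r = (\<beta> - \<alpha>) / 2"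
  have c: "cos (pi * (x - (\<alpha> + \<beta>) / 2) / L) = cos (pi * d / L)"
  proof -
    have "pi * d / L = \<bar>pi * (x - (\<alpha> + \<beta>) / 2) / L\<bar>"
      unfolding d_def using assms(1) by (simp only: abs_mult abs_divide abs_of_pos pi_gt_zero)
    then show ?thesis by (simp only: cos_abs_real)
  qed
  \<comment> \<open>The bound \<open>d < 2 * L - r\<close> says that \<open>x\<close> does not lie
    in a translate of the interval by one period.\<close>
  have dr: "d < 2 * L - r" "0 \<le> d" "0 < r" "r \<le> L" using assms by (auto simp: d_def r_def abs_if field_simps)
  have scale: "pi * u / L \<le> pi \<longleftrightarrow> u \<le> L" "pi * u / L \<ge> 0 \<longleftrightarrow> u \<ge> 0" "pi * u / L < pi * v / L \<longleftrightarrow> u < v" for u v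
    using assms(1) pi_gt_zero by (auto simp: pos_divide_le_eq pos_divide_less_eq pos_less_divide_eq zero_le_mult_iff zero_le_divide_iff simp del: pi_gt_zero)
  have "cos (pi * d / L) > cos (pi * r / L) \<longleftrightarrow> d < r"
  proof (cases "d \<le> L")
    case True
    then show ?thesis using dr by (subst cos_mono_less_eq) (auto simp: scale)
  next
    case False
    \<comment> \<open>Reflection at \<open>L\<close> brings the argument back into the range from 0
      to pi, where the cosine is strictly decreasing.\<close>
    have "cos (pi * d / L) = cos (pi * (2 * L - d) / L)"
      using assms(1) by (simp add: right_diff_distrib diff_divide_distrib cos_diff)
    moreover have "cos (pi * (2 * L - d) / L) > cos (pi * r / L) \<longleftrightarrow> 2 * L - d < r"
      using dr False by (subst cos_mono_less_eq) (auto simp only: scale)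
    ultimately show ?thesis using dr False by auto
  qed
  moreover have "d < r \<longleftrightarrow> \<alpha> < x \<and> x < \<beta>" by (auto simp: d_def r_def abs_if field_simps)
  ultimately show ?thesis unfolding c r_def[symmetric] by auto
qed

text \<open>Fubini is applied to Borel functions on \<open>lborel\<close>, whereas the given fields
  are only Lebesgue measurable; this is the passage between the two.\<close>

lemma integrable_lebesgue_imp_borel:
  fixes k :: "'a::euclidean_space \<Rightarrow> real"
  assumes "integrable lebesgue k"
  obtains h where "integrable lborel h" "AE p in lborel. k p = h p"
proof -
  obtain h where h: "h \<in> borel_measurable lborel" "AE p in lborel. k p = h p"
    using completion_ex_borel_measurable_real[of k lborel] assms by (auto dest: borel_measurable_integrable)
  have "AE p in lebesgue. k p = h p" using h(2) by (rule AE_completion)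
  then have "integrable lebesgue h"
    using assms h(1) by (subst integrable_cong_AE[symmetric]) (auto dest: borel_measurable_integrable intro: measurable_completion)
  then have "integrable lborel h" using integrable_completion[OF h(1)] by simp
  with h(2) show ?thesis by (rule that[rotated])
qed

lemma test_bound:
  assumes "continuous_on UNIV (f :: real^3 \<Rightarrow> real)"
  obtains B where "\<And>p. p \<in> Omega L1 L2 \<Longrightarrow> \<bar>f p\<bar> \<le> B"
proof -
  have "compact (f ` closure (Omega L1 L2))"
    by (intro compact_continuous_image continuous_on_subset[OF assms])
       (auto simp: Omega_def compact_closure)
  then have "bounded (f ` closure (Omega L1 L2))" by (rule compact_imp_bounded)
  then obtain B where "\<forall>y\<in>f ` closure (Omega L1 L2). norm y \<le> B" unfolding bounded_iff by blast
  then show ?thesis using closure_subset by (intro that[of B]) (auto simp: subset_iff)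
qed

lemma periodic_test_continuous:
  assumes "periodic_test L1 L2 phi dphi"
  shows "continuous_on UNIV phi" "continuous_on UNIV dphi" "continuous_on UNIV (\<lambda>p. dphi p $ i)"
proof -
  have d: "(phi has_derivative (\<lambda>h. dphi p \<bullet> h)) (at p)" and c: "continuous_on UNIV dphi" for p
    using assms unfolding periodic_test_def by auto
  show "continuous_on UNIV phi"
    using has_derivative_continuous[OF d] by (auto intro!: continuous_at_imp_continuous_on)
  show "continuous_on UNIV dphi" by fact
  then show "continuous_on UNIV (\<lambda>p. dphi p $ i)" by (rule continuous_on_component)
qed

text \<open>Only the horizontal coordinates need a periodic detector; in z the quadratic with roots
  \<open>a$3\<close> and \<open>b$3\<close> is positive exactly between them. The uniform bound
  serves dominated convergence.\<close>

lemma box_indicator_test_limit: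
  assumes L: "L1 > 0" "L2 > 0" and ne: "box a b \<noteq> {}" and sub: "box a b \<subseteq> Omega L1 L2"
  obtains phi dphi where "\<And>j. periodic_test L1 L2 (phi j) (dphi j)" "\<And>j p. \<bar>phi j p\<bar> \<le> 1"
    "\<And>p. p \<in> Omega L1 L2 \<Longrightarrow> (\<lambda>j. phi j p) \<longlonglongrightarrow> indicator (box a b) p"
proof -
  have ab: "a $ i < b $ i" for i using ne by (auto simp: interval_eq_empty_cart not_le)
  have "cbox a b = closure (box a b)" using ne by (simp add: closure_box)
  also have "\<dots> \<subseteq> closure (Omega L1 L2)" using sub by (rule closure_mono)
  also have "\<dots> = cbox (vector [-L1, -L2, 0]) (vector [L1, L2, 1])"
    unfolding Omega_def using L by (intro closure_box) (simp add: interval_ne_empty_cart forall_3)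
  finally have "cbox a b \<subseteq> cbox (vector [-L1, -L2, 0]) (vector [L1, L2, 1])" .
  moreover have "a \<in> cbox a b" "b \<in> cbox a b" using ab by (auto simp: mem_box_cart less_imp_le)
  ultimately have "a \<in> cbox (vector [-L1, -L2, 0]) (vector [L1, L2, 1])"
    "b \<in> cbox (vector [-L1, -L2, 0]) (vector [L1, L2, 1])" by blast+
  then have lim: "-L1 \<le> a$1" "b$1 \<le> L1" "-L2 \<le> a$2" "b$2 \<le> L2"
    by (auto simp: mem_box_cart forall_3)
  define u where "u L \<alpha> \<beta> x = cos (pi * (x - (\<alpha> + \<beta>) / 2) / L) - cos (pi * ((\<beta> - \<alpha>) / 2) / L)" for L \<alpha> \<beta> x :: real
  define u' where "u' L \<alpha> \<beta> x = - sin (pi * (x - (\<alpha> + \<beta>) / 2) / L) * (pi / L)" for L \<alpha> \<beta> x :: real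
  define w where "w z = (z - a$3) * (b$3 - z)" for z
  define w' where "w' z = (b$3 - z) - (z - a$3)" for z
  define ch' where "ch' j s = real j * (2 * max s 0) / (1 + real j * (max s 0)\<^sup>2)\<^sup>2" for j s
  have chd: "(cutoff j has_real_derivative ch' j s) (at s)" for j s unfolding ch'_def by (rule cutoff_deriv)
  have chc: "continuous_on UNIV (ch' j)" for j unfolding ch'_def by (rule cutoff_deriv_continuous)
  \<comment> \<open>The period is arbitrary here. For \<open>L = 0\<close>, division by zero makes
    both \<open>u\<close> and \<open>u'\<close> vanish identically.\<close>
  have ud: "(u L \<alpha> \<beta> has_real_derivative u' L \<alpha> \<beta> x) (at x)" for L \<alpha> \<beta> x
    unfolding u_def u'_def by (cases "L = 0") (auto intro!: derivative_eq_intros)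
  have uc: "continuous_on UNIV (u' L \<alpha> \<beta>)" for L \<alpha> \<beta>
    unfolding u'_def by (cases "L = 0") (auto intro!: continuous_intros)
  have wd: "(w has_real_derivative w' z) (at z)" for z
    unfolding w_def w'_def by (auto intro!: derivative_eq_intros)
  have wc: "continuous_on UNIV w'" unfolding w'_def by (intro continuous_intros)
  have up: "u L \<alpha> \<beta> (x + 2 * L) = u L \<alpha> \<beta> x" if "L > 0" for L \<alpha> \<beta> x
  proof -
    have "pi * (x + 2 * L - (\<alpha> + \<beta>) / 2) / L = pi * (x - (\<alpha> + \<beta>) / 2) / L + 2 * pi"
      using that by (simp add: field_simps)
    then show ?thesis by (simp add: u_def)
  qed
  have comp_d: "((\<lambda>x. cutoff j (f x)) has_real_derivative ch' j (f x) * f' x) (at x)"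
    if "(f has_real_derivative f' x) (at x)" for j f f' x
    by (rule DERIV_chain2[OF chd that])
  have comp_c: "continuous_on UNIV (\<lambda>x. ch' j (f x) * f' x)"
    if "\<And>x. (f has_real_derivative f' x) (at x)" "continuous_on UNIV f'" for j and f f' :: "real \<Rightarrow> real"
  proof (intro continuous_intros that(2))
    have "continuous_on UNIV f" using DERIV_isCont[OF that(1)] by (auto intro!: continuous_at_imp_continuous_on)
    then show "continuous_on UNIV (\<lambda>x. ch' j (f x))" by (rule continuous_on_compose2[OF chc]) auto
  qed
  let ?A = "\<lambda>j x. cutoff j (u L1 (a$1) (b$1) x)" and ?B = "\<lambda>j x. cutoff j (u L2 (a$2) (b$2) x)" and ?C = "\<lambda>j x. cutoff j (w x)"
  show ?thesis
  proof
    show "periodic_test L1 L2 (\<lambda>p. ?A j (p$1) * ?B j (p$2) * ?C j (p$3))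
      (\<lambda>p. vector [(ch' j (u L1 (a$1) (b$1) (p$1)) * u' L1 (a$1) (b$1) (p$1)) * ?B j (p$2) * ?C j (p$3),
        ?A j (p$1) * (ch' j (u L2 (a$2) (b$2) (p$2)) * u' L2 (a$2) (b$2) (p$2)) * ?C j (p$3),
        ?A j (p$1) * ?B j (p$2) * (ch' j (w (p$3)) * w' (p$3))])" for j
      by (rule periodic_test_product[of "?A j" "\<lambda>x. ch' j (u L1 (a$1) (b$1) x) * u' L1 (a$1) (b$1) x" L1
            "?B j" "\<lambda>x. ch' j (u L2 (a$2) (b$2) x) * u' L2 (a$2) (b$2) x" L2 "?C j" "\<lambda>x. ch' j (w x) * w' x"])
         (simp_all only: comp_d ud wd comp_c uc wc up L)
    have le1: "\<bar>x * y\<bar> \<le> 1" if "\<bar>x\<bar> \<le> 1" "\<bar>y\<bar> \<le> 1" for x y :: real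
      using mult_mono[OF that] by (simp add: abs_mult)
    show "\<bar>?A j (p$1) * ?B j (p$2) * ?C j (p$3)\<bar> \<le> 1" for j p
      by (intro le1) (simp_all add: cutoff_bounds abs_le_iff order_trans[OF _ cutoff_bounds(1)])
    fix p assume p: "p \<in> Omega L1 L2"
    have "u L1 (a$1) (b$1) (p$1) > 0 \<longleftrightarrow> a$1 < p$1 \<and> p$1 < b$1" "u L2 (a$2) (b$2) (p$2) > 0 \<longleftrightarrow> a$2 < p$2 \<and> p$2 < b$2"
      unfolding u_def using p lim ab L by (intro cos_detects_interval; simp add: mem_Omega_iff)+
    moreover have "w (p$3) > 0 \<longleftrightarrow> a$3 < p$3 \<and> p$3 < b$3"
      unfolding w_def using ab[of 3] by (auto simp: zero_less_mult_iff)
    ultimately have eq: "(if u L1 (a$1) (b$1) (p$1) > 0 then 1 else 0) * (if u L2 (a$2) (b$2) (p$2) > 0 then 1 else 0)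
        * (if w (p$3) > 0 then 1 else 0) = (indicator (box a b) p :: real)"
      by (auto simp: mem_box_cart forall_3 split: split_indicator)
    show "(\<lambda>j. ?A j (p$1) * ?B j (p$2) * ?C j (p$3)) \<longlonglongrightarrow> indicator (box a b) p"
      unfolding eq[symmetric] by (intro tendsto_mult cutoff_tendsto)
  qed
qed

text \<open>The fundamental lemma of the calculus of variations for periodic tests: dominated
  convergence carries orthogonality from tests to indicators of boxes, and vanishing box integrals
  force the function to vanish.\<close>

lemma AE_zero_if_orthogonal_to_tests:
  assumes L: "L1 > 0" "L2 > 0" and h: "set_integrable lebesgue (Omega L1 L2) h"
    and orth: "\<And>phi dphi. periodic_test L1 L2 phi dphi \<Longrightarrow> (LINT p:Omega L1 L2|lebesgue. h p * phi p) = 0"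
  shows "AE p in lebesgue. p \<in> Omega L1 L2 \<longrightarrow> h p = 0"
proof -
  let ?O = "Omega L1 L2"
  obtain k where k: "integrable lborel k" "AE p in lborel. indicator ?O p *\<^sub>R h p = k p"
    by (rule integrable_lebesgue_imp_borel[OF h[unfolded set_integrable_def]])
  have [measurable]: "k \<in> borel_measurable borel" using k by (auto dest: borel_measurable_integrable)
  define H where "H p = indicator ?O p * k p" for p
  have H: "integrable lborel H" using integrable_mult_indicator[OF _ k(1), of ?O] by (simp add: H_def[abs_def])
  have HA: "AE p in lborel. indicator ?O p * h p = H p"
    using k(2) by eventually_elim (auto simp: H_def split: split_indicator)
  have orthH: "(LINT p|lborel. H p * phi p) = 0" if t: "periodic_test L1 L2 phi dphi" for phi dphi
  proof -
    have [measurable]: "phi \<in> borel_measurable borel"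
      using periodic_test_continuous(1)[OF t] by (rule borel_measurable_continuous_onI)
    have [measurable]: "H \<in> borel_measurable borel" using H by (auto dest: borel_measurable_integrable)
    have m: "(\<lambda>p. H p * phi p) \<in> borel_measurable lebesgue" by (intro measurable_completion) simp
    have A: "AE p in lebesgue. H p * phi p = indicator ?O p *\<^sub>R (h p * phi p)"
      using AE_completion[OF HA] by eventually_elim auto
    have "(LINT p|lborel. H p * phi p) = (LINT p|lebesgue. H p * phi p)"
      by (simp add: integral_completion)
    also have "\<dots> = (LINT p|lebesgue. indicator ?O p *\<^sub>R (h p * phi p))"
      using m borel_measurable_AE[OF m A] A by (rule integral_cong_AE)
    finally show ?thesis using orth[OF t] by (simp add: set_lebesgue_integral_def)
  qed
  have "AE p in lborel. H p = 0"
  proof (rule AE_zero_if_box_integrals_zero[OF H])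
    fix a b :: "real^3"
    \<comment> \<open>\<open>H\<close> is zero outside the slab, and a box meets the slab in a box;
      so an arbitrary box reduces to one inside the slab, where tests approximate the
      indicator.\<close>
    obtain a' b' where ab: "box a b \<inter> ?O = box a' b'" unfolding Omega_def box_Int_box by blast
    have eq: "(LINT p:box a b|lborel. H p) = (LINT p|lborel. H p * indicator (box a' b') p)"
      unfolding set_lebesgue_integral_def
      by (intro Bochner_Integration.integral_cong) (auto simp: H_def ab[symmetric] split: split_indicator)
    show "(LINT p:box a b|lborel. H p) = 0"
    proof (cases "box a' b' = {}")
      case False
      moreover have "box a' b' \<subseteq> ?O" using ab by auto
      ultimately obtain phi dphi where t: "\<And>j. periodic_test L1 L2 (phi j) (dphi j)" "\<And>j p. \<bar>phi j p\<bar> \<le> 1"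
        "\<And>p. p \<in> ?O \<Longrightarrow> (\<lambda>j. phi j p) \<longlonglongrightarrow> indicator (box a' b') p"
        using box_indicator_test_limit[OF L] by metis
      have mp [measurable]: "phi j \<in> borel_measurable borel" for j
        using periodic_test_continuous(1)[OF t(1)] by (rule borel_measurable_continuous_onI)
      have [measurable]: "H \<in> borel_measurable borel" using H by (auto dest: borel_measurable_integrable)
      have "(\<lambda>j. LINT p|lborel. H p * phi j p) \<longlonglongrightarrow> (LINT p|lborel. H p * indicator (box a' b') p)"
      proof (rule integral_dominated_convergence)
        show "integrable lborel (\<lambda>p. \<bar>H p\<bar>)" using H by auto
        show "AE p in lborel. (\<lambda>j. H p * phi j p) \<longlonglongrightarrow> H p * indicator (box a' b') p"
        proof (intro AE_I2)
          fix p show "(\<lambda>j. H p * phi j p) \<longlonglongrightarrow> H p * indicator (box a' b') p"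
            using t(3)[of p] by (cases "p \<in> ?O") (auto simp: H_def intro: tendsto_mult_left)
        qed
        show "AE p in lborel. norm (H p * phi j p) \<le> \<bar>H p\<bar>" for j
          using t(2)[of j] by (auto simp: abs_mult mult_left_le)
      qed auto
      then show ?thesis unfolding eq using orthH[OF t(1)] by (simp add: LIMSEQ_const_iff)
    qed (simp add: eq)
  qed
  from AE_completion[OF this] AE_completion[OF HA] show ?thesis by eventually_elim auto
qed

section \<open>Green formulas for functions of z\<close>

lemma test_axis_derivative:
  assumes "periodic_test L1 L2 phi dphi"
  shows "((\<lambda>s. phi (p + s *\<^sub>R axis i 1)) has_real_derivative dphi (p + s *\<^sub>R axis i 1) $ i) (at s within S)"
proof -
  have d: "(phi has_derivative (\<lambda>h. dphi x \<bullet> h)) (at x)" for x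
    using assms unfolding periodic_test_def by auto
  have l: "((\<lambda>s::real. p + s *\<^sub>R axis i 1) has_derivative (\<lambda>h. h *\<^sub>R axis i 1)) (at s within S)"
    by (auto intro!: derivative_eq_intros)
  have "((\<lambda>s. phi (p + s *\<^sub>R axis i 1)) has_derivative (\<lambda>h. dphi (p + s *\<^sub>R axis i 1) \<bullet> (h *\<^sub>R axis i 1))) (at s within S)"
    using has_derivative_compose[OF l d] .
  then show ?thesis by (simp add: has_field_derivative_def inner_axis mult_commute_abs)
qed

lemma test_axis_integral:
  assumes "periodic_test L1 L2 phi dphi" "a \<le> b"
  shows "integral {a..b} (\<lambda>s. dphi (p + s *\<^sub>R axis i 1) $ i) = phi (p + b *\<^sub>R axis i 1) - phi (p + a *\<^sub>R axis i 1)"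
  using fundamental_theorem_of_calculus[OF assms(2), of "\<lambda>s. phi (p + s *\<^sub>R axis i 1)"]
    test_axis_derivative[OF assms(1)] by (auto simp: has_real_derivative_iff_has_vector_derivative intro!: integral_unique)

lemma vector_3_axis:
  "vector [x, y, z] = vector [0, y, z] + x *\<^sub>R (axis 1 1 :: real^3)"
  "vector [x, y, z] = vector [x, 0, z] + y *\<^sub>R (axis 2 1 :: real^3)"
  "vector [x, y, z] = vector [x, y, 0] + z *\<^sub>R (axis 3 1 :: real^3)"
  by (auto simp: vec_eq_iff forall_3 axis_def)

text \<open>Integrating first along axis \<open>i\<close> leaves the difference of
  \<open>phi\<close> on opposite faces, which periodicity cancels. For \<open>i = 1\<close> this
  requires swapping the iterated integrals.\<close>

lemma test_lateral_integral:
  assumes t: "periodic_test L1 L2 phi dphi" and L: "L1 > 0" "L2 > 0" and i: "i = 1 \<or> i = 2"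
  shows "integral (Rect L1 L2) (\<lambda>q. dphi (point_of (z, q)) $ i) = 0"
proof -
  have pt: "point_of (z, (x, y)) = vector [x, y, z]" for x y by (simp add: point_of_def)
  have c: "continuous_on S (\<lambda>(x, y). dphi (vector [x, y, z]) $ i)" for S
    unfolding case_prod_beta
    by (rule continuous_on_compose2[OF periodic_test_continuous(3)[OF t]]) (auto intro!: continuous_intros)
  have per: "phi (p + L1 *\<^sub>R axis 1 1) = phi (p + (- L1) *\<^sub>R axis 1 1)"
    "phi (p + L2 *\<^sub>R axis 2 1) = phi (p + (- L2) *\<^sub>R axis 2 1)" for p
  proof -
    have "phi (q + (2 * L1) *\<^sub>R axis 1 1) = phi q" "phi (q + (2 * L2) *\<^sub>R axis 2 1) = phi q" for q
      using t unfolding periodic_test_def by auto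
    from this(1)[of "p + (- L1) *\<^sub>R axis 1 1"] this(2)[of "p + (- L2) *\<^sub>R axis 2 1"]
    show "phi (p + L1 *\<^sub>R axis 1 1) = phi (p + (- L1) *\<^sub>R axis 1 1)"
      "phi (p + L2 *\<^sub>R axis 2 1) = phi (p + (- L2) *\<^sub>R axis 2 1)"
      by (simp_all add: add.assoc scaleR_left_distrib[symmetric] del: scaleR_minus_left)
  qed
  have 1: "integral {-L1..L1} (\<lambda>x. dphi (vector [x, y, z]) $ 1) = 0" for y
  proof -
    have "integral {-L1..L1} (\<lambda>s. dphi (vector [0, y, z] + s *\<^sub>R axis 1 1) $ 1) = 0"
      using test_axis_integral[OF t, of "-L1" L1 "vector [0, y, z]" 1] L unfolding per by simp
    then show ?thesis by (simp only: vector_3_axis(1)[symmetric])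
  qed
  have 2: "integral {-L2..L2} (\<lambda>y. dphi (vector [x, y, z]) $ 2) = 0" for x
  proof -
    have "integral {-L2..L2} (\<lambda>s. dphi (vector [x, 0, z] + s *\<^sub>R axis 2 1) $ 2) = 0"
      using test_axis_integral[OF t, of "-L2" L2 "vector [x, 0, z]" 2] L unfolding per by simp
    then show ?thesis by (simp only: vector_3_axis(2)[symmetric])
  qed
  have "integral (Rect L1 L2) (\<lambda>q. dphi (point_of (z, q)) $ i)
      = integral (cbox (-L1, -L2) (L1, L2)) (\<lambda>(x, y). dphi (vector [x, y, z]) $ i)"
    unfolding Rect_eq_cbox by (intro Henstock_Kurzweil_Integration.integral_cong) (auto simp: pt)
  also have *: "\<dots> = integral (cbox (-L1) L1) (\<lambda>x. integral (cbox (-L2) L2) (\<lambda>y. dphi (vector [x, y, z]) $ i))"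
    using integral_prod_continuous[OF c] by simp
  also have "\<dots> = 0"
  proof (cases "i = 1")
    case True
    then show ?thesis using integral_swap_continuous[OF c[unfolded True]] by (simp add: 1)
  next
    case False
    then show ?thesis using i by (simp add: 2)
  qed
  finally show ?thesis .
qed

text \<open>Links the Lebesgue integral over the open base, which Fubini produces, with the gauge
  integral over the closed \<open>Rect\<close> that states the boundary term of
  \<open>adm_grad\<close>.\<close>

lemma Base_integral:
  assumes "continuous_on UNIV (f :: real \<times> real \<Rightarrow> real)"
  shows "(LINT q|lborel. indicator (Base L1 L2) q * f q) = integral (Rect L1 L2) f"
proof -
  have m: "f \<in> borel_measurable borel" using assms by (rule borel_measurable_continuous_onI)
  have "compact (f ` Rect L1 L2)" unfolding Rect_eq_cbox
    by (intro compact_continuous_image continuous_on_subset[OF assms]) auto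
  then have "bounded (f ` Rect L1 L2)" by (rule compact_imp_bounded)
  then obtain B where "\<forall>y\<in>f ` Rect L1 L2. norm y \<le> B" unfolding bounded_iff by blast
  then have B: "\<bar>f q\<bar> \<le> B" if "q \<in> Rect L1 L2" for q using that by auto
  have "integrable lborel (\<lambda>q. indicator (Base L1 L2) q * f q)"
    by (rule integrable_indicator_bounded[OF m _ _ B]) (auto simp: Rect_eq_cbox dest: subsetD[OF box_subset_cbox])
  then have "(LINT q:Base L1 L2|lborel. f q) = integral (Base L1 L2) f"
    by (intro set_borel_integral_eq_integral) (simp add: set_integrable_def)
  then show ?thesis by (simp add: set_lebesgue_integral_def Rect_eq_cbox integral_open_interval)
qed

lemma Base_indicator_integral [simp]:
  assumes "L1 > 0" "L2 > 0"
  shows "(LINT q|lborel. indicator (Base L1 L2) q * (c::real)) = 4 * L1 * L2 * c"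
  using Base_measure[OF assms] by simp

lemma integrable_z_times:
  fixes f :: "real \<Rightarrow> real"
  assumes L: "L1 > 0" "L2 > 0" and [measurable]: "f \<in> borel_measurable borel"
    and f: "integrable lborel (\<lambda>z. indicator {0<..<1} z * f z)"
  shows "integrable lborel (\<lambda>p. indicator (Omega L1 L2) p * f (p $ 3))"
proof -
  let ?h = "\<lambda>w :: real \<times> real \<times> real. (indicator {0<..<1} (fst w) * f (fst w)) * indicator (Base L1 L2) (snd w) :: real"
  have B: "integrable lborel (indicator (Base L1 L2) :: _ \<Rightarrow> real)"
    using Base_measure[OF L] by (auto simp: integrable_indicator_iff)
  have "integrable (lborel \<Otimes>\<^sub>M lborel) ?h"
  proof (rule lborel_pair.Fubini_integrable)
    show "?h \<in> borel_measurable (lborel \<Otimes>\<^sub>M lborel)" by measurable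
    show "integrable lborel (\<lambda>x. LINT y|lborel. norm (?h (x, y)))"
      using integrable_norm[OF f] by (auto simp: abs_mult intro!: integrable_mult_left)
    show "AE x in lborel. integrable lborel (\<lambda>y. ?h (x, y))"
      using B by (auto intro!: integrable_mult_right)
  qed
  moreover have "?h = (\<lambda>w. indicator (Omega L1 L2) (point_of w) * f (point_of w $ 3))"
    by (auto simp: fun_eq_iff indicator_Omega_point_of)
  ultimately have "integrable (lborel \<Otimes>\<^sub>M (lborel \<Otimes>\<^sub>M lborel)) (\<lambda>w. indicator (Omega L1 L2) (point_of w) * f (point_of w $ 3))"
    unfolding lborel_prod by simp
  then have "integrable (distr (lborel \<Otimes>\<^sub>M (lborel \<Otimes>\<^sub>M lborel)) borel point_of) (\<lambda>p. indicator (Omega L1 L2) p * f (p $ 3))"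
    unfolding lborel_prod by (subst integrable_distr_eq) auto
  then show ?thesis by (subst lborel_eq_distr_point_of)
qed

lemma LINT_z:
  fixes f :: "real \<Rightarrow> real"
  assumes L: "L1 > 0" "L2 > 0" and f: "integrable lborel (\<lambda>p. indicator (Omega L1 L2) p * f (p $ 3))"
  shows "(LINT p|lborel. indicator (Omega L1 L2) p * f (p $ 3)) = 4 * L1 * L2 * (LINT z|lborel. indicator {0<..<1} z * f z)"
    and "integrable lborel (\<lambda>z. indicator {0<..<1} z * f z)"
proof -
  have i: "(LINT q|lborel. indicator (Omega L1 L2) (point_of (z, q)) * f (point_of (z, q) $ 3)) = 4 * L1 * L2 * (indicator {0<..<1} z * f z)" for z
  proof -
    have "(LINT q|lborel. indicator (Omega L1 L2) (point_of (z, q)) * f (point_of (z, q) $ 3))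
       = (LINT q|lborel. indicator (Base L1 L2) q * (indicator {0<..<1} z * f z))"
      by (intro Bochner_Integration.integral_cong) (auto simp: indicator_Omega_point_of)
    then show ?thesis by (simp only: Base_indicator_integral[OF L])
  qed
  show "(LINT p|lborel. indicator (Omega L1 L2) p * f (p $ 3)) = 4 * L1 * L2 * (LINT z|lborel. indicator {0<..<1} z * f z)"
    unfolding fubini_point_of(1)[OF f] i by simp
  have "integrable lborel (\<lambda>z. 4 * L1 * L2 * (indicator {0<..<1} z * f z))"
    using fubini_point_of(3)[OF f] unfolding i .
  then show "integrable lborel (\<lambda>z. indicator {0<..<1} z * f z)" using L by simp
qed

lemma set_integral_lebesgue_lborel:
  fixes f :: "'a::euclidean_space \<Rightarrow> real"
  assumes "(\<lambda>x. indicator S x * f x) \<in> borel_measurable borel"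
  shows "(LINT x:S|lebesgue. f x) = (LINT x|lborel. indicator S x * f x)"
    and "set_integrable lebesgue S f \<longleftrightarrow> integrable lborel (\<lambda>x. indicator S x * f x)"
  using assms by (simp_all add: set_lebesgue_integral_def set_integrable_def integral_completion integrable_completion)

lemma LINT_Ioo_eq_integral:
  fixes f :: "real \<Rightarrow> real"
  assumes m: "f \<in> borel_measurable borel" and f: "f absolutely_integrable_on {0..1}"
  shows "(LINT z|lborel. indicator {0<..<1} z * f z) = integral {0..1} f"
    "integrable lborel (\<lambda>z. indicator {0<..<1} z * f z)"
proof -
  have f': "f absolutely_integrable_on {0<..<1}" by (rule set_integrable_subset[OF f]) auto
  have m': "(\<lambda>z. indicator {0<..<1} z * f z) \<in> borel_measurable borel" using m by measurable
  show "integrable lborel (\<lambda>z. indicator {0<..<1} z * f z)"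
    using f' set_integral_lebesgue_lborel(2)[OF m'] by simp
  show "(LINT z|lborel. indicator {0<..<1} z * f z) = integral {0..1} f"
    using set_lebesgue_integral_eq_integral(2)[OF f'] set_integral_lebesgue_lborel(1)[OF m']
    by (simp add: integral_open_interval_real)
qed

lemma AC_on_mult:
  fixes u v :: "real \<Rightarrow> real"
  assumes "AC_on a b u g" "AC_on a b v h"
  shows "AC_on a b (\<lambda>z. u z * v z) (\<lambda>z. g z * v z + u z * h z)"
proof -
  have "AC_on a b (\<lambda>z. (\<lambda>(x, y). x * y) (u z, v z)) (\<lambda>z. (\<lambda>(x, y). (y, x)) (u z, v z) \<bullet> (g z, h z))"
  proof (rule AC_on_chain[OF AC_on_Pair[OF assms] open_UNIV])
    fix x :: "real \<times> real"
    have "((\<lambda>x::real \<times> real. fst x * snd x) has_derivative (\<lambda>h. fst x * snd h + fst h * snd x)) (at x)"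
      by (auto intro!: derivative_eq_intros)
    then show "((\<lambda>(x, y). x * y) has_derivative (\<lambda>h. (case x of (x, y) \<Rightarrow> (y, x)) \<bullet> h)) (at x)"
      by (simp add: case_prod_unfold inner_prod_def add.commute mult.commute)
    show "continuous_on UNIV (\<lambda>(x, y). (y, x :: real) :: real \<times> real)"
      unfolding case_prod_beta by (intro continuous_intros)
  qed auto
  then show ?thesis by (simp add: algebra_simps)
qed

lemma AC_on_vec:
  fixes M g :: "real \<Rightarrow> real^'n"
  assumes "\<And>k. AC_on a b (\<lambda>z. M z $ k) (\<lambda>z. g z $ k)"
  shows "AC_on a b M g"
  unfolding AC_on_def
proof (intro conjI allI impI)
  have *: "AC_on a b (\<lambda>z. M z \<bullet> e) (\<lambda>z. g z \<bullet> e)" if "e \<in> Basis" for e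
    using that assms by (auto simp: Basis_vec_def inner_axis)
  show gi: "g absolutely_integrable_on {a..b}"
    by (rule absolutely_integrable_componentwise) (use AC_onD(1)[OF *] in auto)
  fix u v assume uv: "a \<le> u" "u \<le> v" "v \<le> b"
  have "g integrable_on {a..b}" using gi by (simp add: absolutely_integrable_on_def)
  then have gu: "g integrable_on {u..v}" by (rule integrable_subinterval_real) (use uv in auto)
  show "M v - M u = integral {u..v} g"
  proof (rule euclidean_eqI)
    fix e :: "real^'n" assume e: "e \<in> Basis"
    show "(M v - M u) \<bullet> e = integral {u..v} g \<bullet> e"
      using AC_onD(2)[OF *[OF e] uv] integral_component_eq[OF gu] by (simp add: inner_diff_left)
  qed
qed

lemma integrable_z_times_test:
  fixes f :: "real \<Rightarrow> real"
  assumes L: "L1 > 0" "L2 > 0" and [measurable]: "f \<in> borel_measurable borel"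
    and f: "integrable lborel (\<lambda>z. indicator {0<..<1} z * f z)" and c: "continuous_on UNIV psi"
  shows "integrable lborel (\<lambda>p. indicator (Omega L1 L2) p * (f (p $ 3) * psi p))"
proof -
  obtain B where B: "\<And>p. p \<in> Omega L1 L2 \<Longrightarrow> \<bar>psi p\<bar> \<le> B" using test_bound[OF c] by metis
  have [measurable]: "psi \<in> borel_measurable borel" using c by (rule borel_measurable_continuous_onI)
  have "integrable lborel (\<lambda>p. B * (indicator (Omega L1 L2) p * f (p $ 3)))"
    by (intro integrable_mult_right integrable_z_times L assms)
  then show ?thesis
  proof (rule Bochner_Integration.integrable_bound)
    show "AE p in lborel. norm (indicator (Omega L1 L2) p * (f (p $ 3) * psi p)) \<le> norm (B * (indicator (Omega L1 L2) p * f (p $ 3)))"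
    proof (intro AE_I2)
      fix p
      show "norm (indicator (Omega L1 L2) p * (f (p $ 3) * psi p)) \<le> norm (B * (indicator (Omega L1 L2) p * f (p $ 3)))"
      proof (cases "p \<in> Omega L1 L2")
        case True
        then have "\<bar>psi p\<bar> * \<bar>f (p $ 3)\<bar> \<le> \<bar>B\<bar> * \<bar>f (p $ 3)\<bar>"
          using B[OF True] by (intro mult_right_mono) auto
        then show ?thesis using True by (simp add: abs_mult mult.commute)
      qed simp
    qed
  qed measurable
qed

lemma AC_on_integrable_borel:
  assumes "AC_on 0 1 u g" "u \<in> borel_measurable borel" "g \<in> borel_measurable borel"
  shows "integrable lborel (\<lambda>z. indicator {0<..<1} z * (u z :: real))" "integrable lborel (\<lambda>z. indicator {0<..<1} z * g z)"
  using assms LINT_Ioo_eq_integral(2) AC_onD(1)[OF assms(1)]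
    absolutely_integrable_continuous_real[OF AC_on_continuous[OF assms(1)]] by auto

lemma continuous_on_point_of_slice:
  assumes "continuous_on UNIV f"
  shows "continuous_on UNIV (\<lambda>q. f (point_of (z, q)))" "continuous_on UNIV (\<lambda>z. f (point_of (z, q)))"
    "continuous_on S (\<lambda>(z, q). f (point_of (z, q)))"
  unfolding case_prod_beta by (rule continuous_on_compose2[OF assms]; auto intro!: continuous_intros)+

text \<open>On a horizontal slice \<open>u\<close> is a constant factor, so only the lateral
  integral of the test derivative remains, and periodicity makes it zero.\<close>

lemma green_z_lateral:
  assumes L: "L1 > 0" "L2 > 0" and t: "periodic_test L1 L2 phi dphi" and i: "i = 1 \<or> i = 2"
    and m: "u \<in> borel_measurable borel" and u: "integrable lborel (\<lambda>z. indicator {0<..<1} z * u z)"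
  shows "(LINT p|lborel. indicator (Omega L1 L2) p * (u (p $ 3) * dphi p $ i)) = 0"
proof -
  have c: "continuous_on UNIV (\<lambda>p. dphi p $ i)" using periodic_test_continuous(3)[OF t] .
  have "(LINT q|lborel. indicator (Omega L1 L2) (point_of (z, q)) * (u (point_of (z, q) $ 3) * dphi (point_of (z, q)) $ i)) = 0" for z
  proof -
    have "(LINT q|lborel. indicator (Omega L1 L2) (point_of (z, q)) * (u (point_of (z, q) $ 3) * dphi (point_of (z, q)) $ i))
        = (LINT q|lborel. (indicator {0<..<1} z * u z) * (indicator (Base L1 L2) q * dphi (point_of (z, q)) $ i))"
      by (intro Bochner_Integration.integral_cong) (auto simp: indicator_Omega_point_of)
    also have "\<dots> = (indicator {0<..<1} z * u z) * integral (Rect L1 L2) (\<lambda>q. dphi (point_of (z, q)) $ i)"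
      using Base_integral[OF continuous_on_point_of_slice(1)[OF c]] by simp
    also have "\<dots> = 0" using test_lateral_integral[OF t L i] by simp
    finally show ?thesis .
  qed
  then show ?thesis using fubini_point_of(1)[OF integrable_z_times_test[OF L m u c]] by simp
qed

text \<open>On each vertical line the product of \<open>u\<close> and the test is absolutely
  continuous and the integrand is its derivative. Integrating vertically first therefore leaves only
  the values at the two horizontal faces.\<close>

lemma green_z_vertical:
  assumes L: "L1 > 0" "L2 > 0" and t: "periodic_test L1 L2 phi dphi"
    and m: "u \<in> borel_measurable borel" "g \<in> borel_measurable borel" and u: "AC_on 0 1 u g"
  shows "(LINT p|lborel. indicator (Omega L1 L2) p * (u (p $ 3) * dphi p $ 3 + g (p $ 3) * phi p))
    = integral (Rect L1 L2) (\<lambda>(x, y). phi (vector [x, y, 1]) * u 1 - phi (vector [x, y, 0]) * u 0)"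
proof -
  note [measurable] = m
  note c = periodic_test_continuous(3)[OF t, of 3] periodic_test_continuous(1)[OF t]
  have [measurable]: "phi \<in> borel_measurable borel" "(\<lambda>p. dphi p $ 3) \<in> borel_measurable borel"
    using c by (auto intro: borel_measurable_continuous_onI)
  have int: "integrable lborel (\<lambda>p. indicator (Omega L1 L2) p * (u (p $ 3) * dphi p $ 3 + g (p $ 3) * phi p))"
    unfolding distrib_left using AC_on_integrable_borel[OF u m]
    by (intro Bochner_Integration.integrable_add integrable_z_times_test L m c)
  have "(LINT z|lborel. indicator (Omega L1 L2) (point_of (z, q)) * (u (point_of (z, q) $ 3) * dphi (point_of (z, q)) $ 3 + g (point_of (z, q) $ 3) * phi (point_of (z, q))))
      = indicator (Base L1 L2) q * (phi (point_of (1, q)) * u 1 - phi (point_of (0, q)) * u 0)" for q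
  proof -
    obtain x y where q: "q = (x, y)" by (cases q)
    have pz: "point_of (z, q) = vector [x, y, 0] + z *\<^sub>R axis 3 1" for z
      by (simp add: q point_of_def vector_3_axis(3)[symmetric])
    have "AC_on 0 1 (\<lambda>z. phi (point_of (z, q))) (\<lambda>z. dphi (point_of (z, q)) $ 3)"
    proof (rule AC_on_C1)
      show "continuous_on {0..1} (\<lambda>z. dphi (point_of (z, q)) $ 3)"
        using continuous_on_point_of_slice(2)[OF c(1)] by (rule continuous_on_subset) simp
      show "((\<lambda>z. phi (point_of (z, q))) has_vector_derivative dphi (point_of (z, q)) $ 3) (at z within {0..1})" for z
        unfolding pz using test_axis_derivative[OF t] by (simp add: has_real_derivative_iff_has_vector_derivative)
    qed
    from AC_on_mult[OF u this]
    have ac: "AC_on 0 1 (\<lambda>z. u z * phi (point_of (z, q))) (\<lambda>z. g z * phi (point_of (z, q)) + u z * dphi (point_of (z, q)) $ 3)" .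
    have "(LINT z|lborel. indicator (Omega L1 L2) (point_of (z, q)) * (u (point_of (z, q) $ 3) * dphi (point_of (z, q)) $ 3 + g (point_of (z, q) $ 3) * phi (point_of (z, q))))
      = (LINT z|lborel. indicator (Base L1 L2) q * (indicator {0<..<1} z * (g z * phi (point_of (z, q)) + u z * dphi (point_of (z, q)) $ 3)))"
      by (intro Bochner_Integration.integral_cong) (auto simp: indicator_Omega_point_of algebra_simps)
    also have "\<dots> = indicator (Base L1 L2) q * integral {0..1} (\<lambda>z. g z * phi (point_of (z, q)) + u z * dphi (point_of (z, q)) $ 3)"
    proof -
      have "(\<lambda>z. phi (point_of (z, q))) \<in> borel_measurable borel" "(\<lambda>z. dphi (point_of (z, q)) $ 3) \<in> borel_measurable borel"
        using c continuous_on_point_of_slice(2) by (auto intro: borel_measurable_continuous_onI)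
      then have "(\<lambda>z. g z * phi (point_of (z, q)) + u z * dphi (point_of (z, q)) $ 3) \<in> borel_measurable borel"
        using m by simp
      from LINT_Ioo_eq_integral(1)[OF this AC_onD(1)[OF ac]] show ?thesis by simp
    qed
    also have "\<dots> = indicator (Base L1 L2) q * (phi (point_of (1, q)) * u 1 - phi (point_of (0, q)) * u 0)"
      using AC_onD(2)[OF ac, of 0 1] by (simp add: mult.commute)
    finally show ?thesis .
  qed
  then have "(LINT p|lborel. indicator (Omega L1 L2) p * (u (p $ 3) * dphi p $ 3 + g (p $ 3) * phi p))
      = (LINT q|lborel. indicator (Base L1 L2) q * (phi (point_of (1, q)) * u 1 - phi (point_of (0, q)) * u 0))"
    using fubini_point_of(2)[OF int] by simp
  also have "\<dots> = integral (Rect L1 L2) (\<lambda>q. phi (point_of (1, q)) * u 1 - phi (point_of (0, q)) * u 0)"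
    by (intro Base_integral continuous_intros continuous_on_point_of_slice(1)[OF c(2)])
  also have "\<dots> = integral (Rect L1 L2) (\<lambda>(x, y). phi (vector [x, y, 1]) * u 1 - phi (vector [x, y, 0]) * u 0)"
    by (intro Henstock_Kurzweil_Integration.integral_cong) (auto simp: point_of_def)
  finally show ?thesis .
qed

section \<open>Reduction to one dimension\<close>

lemma set_integral_AE_eq_borel:
  fixes f :: "'a::euclidean_space \<Rightarrow> real"
  assumes F: "F \<in> borel_measurable borel" and ae: "AE p in lborel. indicator S p * f p = F p"
  shows "(LINT p:S|lebesgue. f p) = (LINT p|lborel. F p)"
    and "set_integrable lebesgue S f \<longleftrightarrow> integrable lborel F"
proof -
  have m: "F \<in> borel_measurable lebesgue" using F by (intro measurable_completion) simp
  have A: "AE p in lebesgue. F p = indicator S p *\<^sub>R f p" using AE_completion[OF ae] by eventually_elim auto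
  note m' = borel_measurable_AE[OF m A]
  have "(LINT p|lebesgue. F p) = (LINT p|lebesgue. indicator S p *\<^sub>R f p)"
    using m m' A by (rule integral_cong_AE)
  moreover have "(LINT p|lebesgue. F p) = (LINT p|lborel. F p)" using F by (intro integral_completion) simp
  ultimately show "(LINT p:S|lebesgue. f p) = (LINT p|lborel. F p)"
    unfolding set_lebesgue_integral_def by (rule trans[OF sym])
  have "integrable lebesgue F \<longleftrightarrow> integrable lebesgue (\<lambda>p. indicator S p *\<^sub>R f p)"
    using m m' A by (rule integrable_cong_AE)
  moreover have "integrable lebesgue F \<longleftrightarrow> integrable lborel F" using F by (intro integrable_completion) simp
  ultimately show "set_integrable lebesgue S f \<longleftrightarrow> integrable lborel F"
    unfolding set_integrable_def by (rule trans[OF sym])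
qed

lemma set_integrable_borel_version:
  fixes f :: "real^3 \<Rightarrow> real"
  assumes "set_integrable lebesgue (Omega L1 L2) f"
  obtains h where "integrable lborel h" "AE p in lborel. indicator (Omega L1 L2) p * f p = h p"
    "\<And>p. p \<notin> Omega L1 L2 \<Longrightarrow> h p = 0"
proof -
  obtain k where k: "integrable lborel k" "AE p in lborel. indicator (Omega L1 L2) p *\<^sub>R f p = k p"
    by (rule integrable_lebesgue_imp_borel[OF assms[unfolded set_integrable_def]])
  show ?thesis
  proof
    show "integrable lborel (\<lambda>p. indicator (Omega L1 L2) p * k p)"
      using integrable_mult_indicator[OF _ k(1), of "Omega L1 L2"] by simp
    show "AE p in lborel. indicator (Omega L1 L2) p * f p = indicator (Omega L1 L2) p * k p"
      using k(2) by eventually_elim (auto split: split_indicator)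
  qed simp
qed

lemma L2_on_imp_set_integrable:
  assumes "L2_on (Omega L1 L2) f"
  shows "set_integrable lebesgue (Omega L1 L2) f"
proof -
  let ?O = "Omega L1 L2"
  have "emeasure lborel ?O < \<infinity>" by (rule emeasure_bounded_finite) (simp add: Omega_def)
  then have 1: "integrable lebesgue (\<lambda>p. indicator ?O p :: real)" by (simp add: integrable_indicator_iff)
  have 2: "integrable lebesgue (\<lambda>p. indicator ?O p *\<^sub>R (f p)\<^sup>2)"
    using assms by (simp add: L2_on_def set_integrable_def)
  have "integrable lebesgue (\<lambda>p. indicator ?O p + indicator ?O p *\<^sub>R (f p)\<^sup>2)"
    by (rule Bochner_Integration.integrable_add[OF 1 2])
  then show ?thesis unfolding set_integrable_def
  proof (rule Bochner_Integration.integrable_bound)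
    show "(\<lambda>p. indicator ?O p *\<^sub>R f p) \<in> borel_measurable lebesgue"
      using assms by (simp add: L2_on_def set_borel_measurable_def)
    have "\<bar>y\<bar> \<le> 1 + y\<^sup>2" for y :: real
      using zero_le_power2[of "\<bar>y\<bar> - 1"] by (simp add: power2_diff)
    then show "AE p in lebesgue. norm (indicator ?O p *\<^sub>R f p) \<le> norm (indicator ?O p + indicator ?O p *\<^sub>R (f p)\<^sup>2)"
      by (intro AE_I2) (auto split: split_indicator)
  qed
qed

lemma integrable_mult_test:
  fixes N psi :: "real^3 \<Rightarrow> real"
  assumes N: "integrable lborel N" "\<And>p. p \<notin> Omega L1 L2 \<Longrightarrow> N p = 0" and c: "continuous_on UNIV psi"
  shows "integrable lborel (\<lambda>p. N p * psi p)"
proof -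
  obtain B where B: "\<And>p. p \<in> Omega L1 L2 \<Longrightarrow> \<bar>psi p\<bar> \<le> B" using test_bound[OF c] by metis
  have [measurable]: "psi \<in> borel_measurable borel" using c by (rule borel_measurable_continuous_onI)
  have [measurable]: "N \<in> borel_measurable borel" using N(1) by (auto dest: borel_measurable_integrable)
  have "integrable lborel (\<lambda>p. B * N p)" using N(1) by (rule integrable_mult_right)
  then show ?thesis
  proof (rule Bochner_Integration.integrable_bound)
    show "AE p in lborel. norm (N p * psi p) \<le> norm (B * N p)"
    proof (intro AE_I2)
      fix p
      show "norm (N p * psi p) \<le> norm (B * N p)"
      proof (cases "p \<in> Omega L1 L2")
        case True
        then have "\<bar>psi p\<bar> * \<bar>N p\<bar> \<le> \<bar>B\<bar> * \<bar>N p\<bar>" using B[OF True] by (intro mult_right_mono) auto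
        then show ?thesis by (simp add: abs_mult mult.commute)
      qed (simp add: N(2))
    qed
  qed measurable
qed

lemma periodic_test_z:
  assumes "\<And>x. (c has_real_derivative c' x) (at x)" "continuous_on UNIV c'"
  shows "periodic_test L1 L2 (\<lambda>p. c (p$3)) (\<lambda>p. vector [0, 0, c' (p$3)])"
  using periodic_test_product[of "\<lambda>_. 1" "\<lambda>_. 0" L1 "\<lambda>_. 1" "\<lambda>_. 0" L2 c c'] assms by simp

lemma Rect_integral_const:
  assumes "L1 > 0" "L2 > 0"
  shows "integral (Rect L1 L2) (\<lambda>_. c::real) = 4 * L1 * L2 * c"
  unfolding Base_integral[OF continuous_on_const, symmetric] by (rule Base_indicator_integral[OF assms])

lemma antiderivative_exists:
  assumes "continuous_on UNIV (f :: real \<Rightarrow> real)"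
  obtains F where "\<And>x. (F has_real_derivative f x) (at x)"
  using einterval_antiderivative[of "-\<infinity>" \<infinity> f] assms
  by (auto simp: continuous_on_eq_continuous_at has_real_derivative_iff_has_vector_derivative)

lemma antiderivative_from_0:
  assumes "continuous_on UNIV (f :: real \<Rightarrow> real)"
  shows "\<exists>F. (\<forall>x. (F has_real_derivative f x) (at x)) \<and> F 0 = 0"
proof -
  obtain F where F: "\<And>x. (F has_real_derivative f x) (at x)" using antiderivative_exists[OF assms] by metis
  show ?thesis
    by (rule exI[of _ "\<lambda>x. F x - F 0"]) (auto intro!: derivative_eq_intros F)
qed

text \<open>Clamping the upper limit to \<open>{0..1}\<close> makes the primitive continuous on the
  whole line, hence Borel, as \<open>integrable_z_times\<close> requires.\<close>

lemma AC_on_integral: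
  fixes c :: real
  assumes "integrable lborel (g :: real \<Rightarrow> real)"
  defines "u \<equiv> \<lambda>z. c + integral {0..max 0 (min 1 z)} g"
  shows "AC_on 0 1 u g" "continuous_on UNIV u" "u 0 = c"
proof -
  have "set_integrable lebesgue {0..1} g"
    unfolding set_integrable_def using assms(1) by (intro integrable_mult_indicator) (auto simp: integrable_completion)
  then have g: "g absolutely_integrable_on {0..1}" .
  then have gi: "g integrable_on {0..1}" by (simp add: absolutely_integrable_on_def)
  show AC: "AC_on 0 1 u g" unfolding AC_on_def
  proof (intro conjI allI impI g)
    fix w v :: real assume wv: "0 \<le> w" "w \<le> v" "v \<le> 1"
    have "g integrable_on {0..v}" by (rule integrable_subinterval_real[OF gi]) (use wv in auto)
    then show "u v - u w = integral {w..v} g"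
      using Henstock_Kurzweil_Integration.integral_combine[of 0 w v g] wv by (simp add: u_def)
  qed
  have cl: "continuous_on UNIV (\<lambda>z::real. max 0 (min 1 z))" by (intro continuous_intros)
  have "continuous_on UNIV (\<lambda>z. integral {0..max 0 (min 1 z)} g)"
    by (rule continuous_on_compose2[OF indefinite_integral_continuous_1[OF gi] cl]) auto
  then show "continuous_on UNIV u" unfolding u_def by (intro continuous_intros)
  show "u 0 = c" by (simp add: u_def)
qed

text \<open>The candidate \<open>\<gamma>\<close> is the average of the third derivative over horizontal slices. Tests that depend
  on \<open>z\<close> only identify \<open>n\<close> with the primitive of \<open>\<gamma>\<close>; the Green formulas for that primitive then show
  that the weak gradient minus its candidate is orthogonal to all tests.\<close>

lemma z_only_component:
  assumes L: "L1 > 0" "L2 > 0"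
    and ni: "set_integrable lebesgue (Omega L1 L2) n" and gi: "\<And>i. set_integrable lebesgue (Omega L1 L2) (\<lambda>p. g p $ i)"
    and zonly: "AE p in lebesgue. p \<in> Omega L1 L2 \<longrightarrow> n p = \<mu> (p $ 3)"
    and green12: "\<And>phi dphi i. periodic_test L1 L2 phi dphi \<Longrightarrow> i = 1 \<or> i = 2 \<Longrightarrow>
        (LINT p:Omega L1 L2|lebesgue. n p * dphi p $ i + g p $ i * phi p) = 0"
    and green3: "\<And>phi dphi. periodic_test L1 L2 phi dphi \<Longrightarrow>
        (LINT p:Omega L1 L2|lebesgue. n p * dphi p $ 3 + g p $ 3 * phi p) =
          integral (Rect L1 L2) (\<lambda>(x, y). phi (vector [x, y, 1]) * d1 - phi (vector [x, y, 0]) * d0)"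
  obtains u \<gamma> where "u \<in> borel_measurable borel" "\<gamma> \<in> borel_measurable borel" "AC_on 0 1 u \<gamma>"
    "continuous_on UNIV u" "u 0 = d0" "u 1 = d1"
    "AE p in lebesgue. p \<in> Omega L1 L2 \<longrightarrow> n p = u (p $ 3) \<and> g p = (vector [0, 0, \<gamma> (p $ 3)] :: real^3)"
proof -
  let ?O = "Omega L1 L2" and ?K = "4 * L1 * L2"
  have K: "?K > 0" using L by simp
  obtain N where N: "integrable lborel N" "AE p in lborel. indicator ?O p * n p = N p" "\<And>p. p \<notin> ?O \<Longrightarrow> N p = 0"
    by (rule set_integrable_borel_version[OF ni]) blast
  have "\<exists>h. integrable lborel h \<and> (AE p in lborel. indicator ?O p * g p $ i = h p) \<and> (\<forall>p. p \<notin> ?O \<longrightarrow> h p = 0)" for i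
    by (rule set_integrable_borel_version[OF gi[of i]]) blast
  then have "\<forall>i. \<exists>h. integrable lborel h \<and> (AE p in lborel. indicator ?O p * g p $ i = h p) \<and> (\<forall>p. p \<notin> ?O \<longrightarrow> h p = 0)"
    by blast
  from choice[OF this] obtain G where "\<forall>i. integrable lborel (G i) \<and> (AE p in lborel. indicator ?O p * g p $ i = G i p) \<and> (\<forall>p. p \<notin> ?O \<longrightarrow> G i p = 0)" ..
  then have G: "\<And>i. integrable lborel (G i)" "\<And>i. AE p in lborel. indicator ?O p * g p $ i = G i p"
    "\<And>i p. p \<notin> ?O \<Longrightarrow> G i p = 0" by blast+
  have [measurable]: "N \<in> borel_measurable borel" "\<And>i. G i \<in> borel_measurable borel"
    using N(1) G(1) by (auto dest: borel_measurable_integrable)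
  define \<gamma> where "\<gamma> z = (LINT q|lborel. G 3 (point_of (z, q))) / ?K" for z
  have \<gamma>: "integrable lborel \<gamma>" unfolding \<gamma>_def using fubini_point_of(3)[OF G(1)] by simp
  then have \<gamma>m [measurable]: "\<gamma> \<in> borel_measurable borel" by (auto dest: borel_measurable_integrable)
  have \<gamma>0: "indicator {0<..<1} z * \<gamma> z = \<gamma> z" for z
  proof (cases "z \<in> {0<..<1}")
    case False
    then have "G 3 (point_of (z, q)) = 0" for q by (intro G(3)) (auto simp: point_of_mem_Omega_iff)
    then show ?thesis by (simp add: \<gamma>_def)
  qed simp
  define u where "u z = d0 + integral {0..max 0 (min 1 z)} \<gamma>" for z
  have u: "AC_on 0 1 u \<gamma>" "continuous_on UNIV u" "u 0 = d0"
    using AC_on_integral[OF \<gamma>, of d0] unfolding u_def by auto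
  have um [measurable]: "u \<in> borel_measurable borel" using u(2) by (rule borel_measurable_continuous_onI)
  note int_u = AC_on_integrable_borel[OF u(1) um \<gamma>m]
  define H where "H p = N p - indicator ?O p * u (p $ 3)" for p
  have H: "integrable lborel H" "\<And>p. p \<notin> ?O \<Longrightarrow> H p = 0"
    using N integrable_z_times[OF L um int_u(1)] unfolding H_def by auto
  have Hm [measurable]: "H \<in> borel_measurable borel" using H(1) by (auto dest: borel_measurable_integrable)
  \<comment> \<open>The Green formulas of \<open>n\<close> and of \<open>u\<close> are subtracted
    for the test \<open>c (p $ 3)\<close>. The gradient terms cancel because \<open>G 3\<close> and
    \<gamma> have the same integral over every slice, the bottom terms because
    \<open>u 0 = d0\<close>; only the mismatch at the top survives.\<close>
  have key: "(LINT p|lborel. H p * c' (p $ 3)) = ?K * (c 1 * (d1 - u 1))"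
    if c: "\<And>x. (c has_real_derivative c' x) (at x)" "continuous_on UNIV c'" for c c'
  proof -
    note t = periodic_test_z[OF c, of L1 L2]
    have cc: "continuous_on UNIV (\<lambda>p::real^3. c (p $ 3))" "continuous_on UNIV (\<lambda>p::real^3. c' (p $ 3))"
      using periodic_test_continuous(1)[OF t] periodic_test_continuous(3)[OF t, of 3] by auto
    have iN: "integrable lborel (\<lambda>p. N p * c' (p $ 3))" by (rule integrable_mult_test[OF N(1) _ cc(2)]) (rule N(3))
    have iG: "integrable lborel (\<lambda>p. G 3 p * c (p $ 3))" by (rule integrable_mult_test[OF G(1) _ cc(1)]) (rule G(3))
    note i = iN iG integrable_z_times_test[OF L um int_u(1) cc(2)] integrable_z_times_test[OF L \<gamma>m int_u(2) cc(1)]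
    have "(LINT p:?O|lebesgue. n p * c' (p $ 3) + g p $ 3 * c (p $ 3)) = (LINT p|lborel. N p * c' (p $ 3) + G 3 p * c (p $ 3))"
    proof (rule set_integral_AE_eq_borel(1))
      show "(\<lambda>p. N p * c' (p $ 3) + G 3 p * c (p $ 3)) \<in> borel_measurable borel"
        using borel_measurable_continuous_onI[OF cc(1)] borel_measurable_continuous_onI[OF cc(2)] by measurable
      show "AE p in lborel. indicator ?O p * (n p * c' (p $ 3) + g p $ 3 * c (p $ 3)) = N p * c' (p $ 3) + G 3 p * c (p $ 3)"
        using N(2) G(2)[of 3] by eventually_elim (simp add: distrib_left flip: mult.assoc)
    qed
    then have E1: "(LINT p|lborel. N p * c' (p $ 3)) + (LINT p|lborel. G 3 p * c (p $ 3)) = ?K * (c 1 * d1 - c 0 * d0)"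
      using green3[OF t] i(1,2) L by (simp add: Rect_integral_const case_prod_unfold)
    have E2: "(LINT p|lborel. indicator ?O p * (u (p $ 3) * c' (p $ 3))) + (LINT p|lborel. indicator ?O p * (\<gamma> (p $ 3) * c (p $ 3))) = ?K * (c 1 * u 1 - c 0 * u 0)"
      using green_z_vertical[OF L t um \<gamma>m u(1)] i(3,4) L by (simp add: Rect_integral_const case_prod_unfold distrib_left)
    have "(LINT p|lborel. G 3 p * c (p $ 3)) = (LINT z|lborel. ?K * (indicator {0<..<1} z * (\<gamma> z * c z)))"
      unfolding fubini_point_of(1)[OF i(2)] using L \<gamma>0
      by (intro Bochner_Integration.integral_cong) (auto simp: \<gamma>_def simp flip: mult.assoc)
    also have "\<dots> = (LINT p|lborel. indicator ?O p * (\<gamma> (p $ 3) * c (p $ 3)))"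
      using LINT_z(1)[OF L i(4)] by simp
    finally have E3: "(LINT p|lborel. G 3 p * c (p $ 3)) = (LINT p|lborel. indicator ?O p * (\<gamma> (p $ 3) * c (p $ 3)))" .
    have "(LINT p|lborel. H p * c' (p $ 3)) = (LINT p|lborel. N p * c' (p $ 3)) - (LINT p|lborel. indicator ?O p * (u (p $ 3) * c' (p $ 3)))"
      unfolding Bochner_Integration.integral_diff[OF i(1,3), symmetric]
      by (intro Bochner_Integration.integral_cong) (auto simp: H_def algebra_simps)
    then show ?thesis using E1 E2 E3 u(3) by (simp add: algebra_simps)
  qed
  \<comment> \<open>The constant test has derivative zero, so the identity reduces to the value at
    the top.\<close>
  have "(LINT p|lborel. H p * 0) = ?K * (1 * (d1 - u 1))"
    using key[of "\<lambda>_. 1" "\<lambda>_. 0"] by simp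
  then have u1: "u 1 = d1" using L by simp
  have slice: "AE z in lborel. AE q in lborel. H (point_of (z, q)) = indicator {0<..<1} z * indicator (Base L1 L2) q * (\<mu> z - u z)"
  proof -
    have "AE p in lebesgue. H p = indicator ?O p * (\<mu> (p $ 3) - u (p $ 3))"
      using zonly AE_completion[OF N(2)] by eventually_elim (auto simp: H_def split: split_indicator)
    from AE_point_of[OF this] show ?thesis by (simp add: indicator_Omega_point_of)
  qed
  \<comment> \<open>Because \<open>n\<close> depends on z alone, \<open>H\<close> is constant on
    almost every slice. A general test may thus be replaced by its slice integral
    \<open>Phi\<close>, and \<open>Phi\<close> is the derivative of a test function of z, to which
    \<open>key\<close> applies.\<close>
  have orth: "(LINT p|lborel. H p * phi p) = 0" if t: "periodic_test L1 L2 phi dphi" for phi dphi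
  proof -
    note c = periodic_test_continuous(1)[OF t]
    define Phi where "Phi z = integral (Rect L1 L2) (\<lambda>q. phi (point_of (z, q)))" for z
    have Phic: "continuous_on UNIV Phi" unfolding Phi_def Rect_eq_cbox
      by (rule integral_continuous_on_param) (rule continuous_on_point_of_slice(3)[OF c])
    then have Phic': "continuous_on UNIV (\<lambda>p::real^3. Phi (p $ 3))"
      by (rule continuous_on_compose2) (auto intro: continuous_intros)
    obtain F where F: "\<And>x. (F has_real_derivative Phi x) (at x)" using antiderivative_exists[OF Phic] by metis
    have z: "(LINT p|lborel. H p * Phi (p $ 3)) = 0" using key[OF F Phic] u1 by simp
    have iH1: "integrable lborel (\<lambda>p. H p * phi p)" by (rule integrable_mult_test[OF H(1) _ c]) (rule H(2))
    have iH2: "integrable lborel (\<lambda>p. H p * Phi (p $ 3))" by (rule integrable_mult_test[OF H(1) _ Phic']) (rule H(2))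
    note iH = iH1 iH2
    have pm: "phi \<in> borel_measurable borel" using c by (rule borel_measurable_continuous_onI)
    have "AE z in lborel. ?K * (LINT q|lborel. H (point_of (z, q)) * phi (point_of (z, q)))
        = (LINT q|lborel. H (point_of (z, q)) * Phi (point_of (z, q) $ 3))"
      using slice
    proof eventually_elim
      case (elim z)
      let ?w = "indicator {0<..<1} z * (\<mu> z - u z)"
      have ms: "(\<lambda>q. point_of (z, q)) \<in> borel_measurable borel"
        by (intro borel_measurable_continuous_onI continuous_intros)
      note [measurable] = measurable_compose[OF ms Hm] measurable_compose[OF ms pm]
      have "(LINT q|lborel. H (point_of (z, q)) * phi (point_of (z, q))) = (LINT q|lborel. ?w * (indicator (Base L1 L2) q * phi (point_of (z, q))))"
        by (rule integral_cong_AE) (measurable, use elim in eventually_elim, auto)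
      also have "\<dots> = ?w * Phi z"
        using Base_integral[OF continuous_on_point_of_slice(1)[OF c]] by (simp add: Phi_def)
      finally have 1: "(LINT q|lborel. H (point_of (z, q)) * phi (point_of (z, q))) = ?w * Phi z" .
      have "(LINT q|lborel. H (point_of (z, q)) * Phi (point_of (z, q) $ 3)) = (LINT q|lborel. H (point_of (z, q)) * Phi z)"
        by simp
      also have "\<dots> = (LINT q|lborel. indicator (Base L1 L2) q * (?w * Phi z))"
        by (rule integral_cong_AE) (measurable, use elim in eventually_elim, auto)
      finally show ?case unfolding 1 Base_indicator_integral[OF L] by (simp only: mult.assoc)
    qed
    moreover have "integrable lborel (\<lambda>z. ?K * (LINT q|lborel. H (point_of (z, q)) * phi (point_of (z, q))))"
      using fubini_point_of(3)[OF iH(1)] by simp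
    ultimately have "(LINT z|lborel. ?K * (LINT q|lborel. H (point_of (z, q)) * phi (point_of (z, q))))
        = (LINT z|lborel. LINT q|lborel. H (point_of (z, q)) * Phi (point_of (z, q) $ 3))"
      using fubini_point_of(3)[OF iH(2)] by (intro integral_cong_AE borel_measurable_integrable)
    then have "?K * (LINT p|lborel. H p * phi p) = (LINT p|lborel. H p * Phi (p $ 3))"
      unfolding fubini_point_of(1)[OF iH(1)] fubini_point_of(1)[OF iH(2)] by simp
    then show ?thesis using z L by simp
  qed
  have nu: "AE p in lborel. indicator ?O p * (n p - u (p $ 3)) = H p"
    using N(2) by eventually_elim (auto simp: H_def right_diff_distrib)
  have n_eq: "AE p in lebesgue. p \<in> ?O \<longrightarrow> n p - u (p $ 3) = 0"
  proof (rule AE_zero_if_orthogonal_to_tests[OF L])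
    show "set_integrable lebesgue ?O (\<lambda>p. n p - u (p $ 3))"
      using set_integral_AE_eq_borel(2)[OF Hm nu] H(1) by simp
    fix phi dphi assume t: "periodic_test L1 L2 phi dphi"
    have [measurable]: "phi \<in> borel_measurable borel"
      using periodic_test_continuous(1)[OF t] by (rule borel_measurable_continuous_onI)
    have "AE p in lborel. indicator ?O p * ((n p - u (p $ 3)) * phi p) = H p * phi p"
      using nu by eventually_elim (auto simp flip: mult.assoc)
    then have "(LINT p:?O|lebesgue. (n p - u (p $ 3)) * phi p) = (LINT p|lborel. H p * phi p)"
      by (intro set_integral_AE_eq_borel(1)) auto
    then show "(LINT p:?O|lebesgue. (n p - u (p $ 3)) * phi p) = 0" using orth[OF t] by simp
  qed
  then have n_eq': "AE p in lborel. indicator ?O p * n p = indicator ?O p * u (p $ 3)"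
    unfolding AE_completion_iff by eventually_elim (auto split: split_indicator)
  have green: "(LINT p:?O|lebesgue. n p * dphi p $ i + g p $ i * phi p)
      = (LINT p|lborel. indicator ?O p * (u (p $ 3) * dphi p $ i)) + (LINT p|lborel. G i p * phi p)"
    and green_int: "integrable lborel (\<lambda>p. G i p * phi p)"
    if t: "periodic_test L1 L2 phi dphi" for phi dphi i
  proof -
    note c = periodic_test_continuous(1)[OF t] periodic_test_continuous(3)[OF t, of i]
    have [measurable]: "phi \<in> borel_measurable borel" "(\<lambda>p. dphi p $ i) \<in> borel_measurable borel"
      using c by (auto intro: borel_measurable_continuous_onI)
    show gi: "integrable lborel (\<lambda>p. G i p * phi p)" by (rule integrable_mult_test[OF G(1) _ c(1)]) (rule G(3))
    have "AE p in lborel. indicator ?O p * (n p * dphi p $ i + g p $ i * phi p) = indicator ?O p * (u (p $ 3) * dphi p $ i) + G i p * phi p"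
      using n_eq' G(2)[of i] by eventually_elim (simp add: distrib_left flip: mult.assoc)
    then have "(LINT p:?O|lebesgue. n p * dphi p $ i + g p $ i * phi p) = (LINT p|lborel. indicator ?O p * (u (p $ 3) * dphi p $ i) + G i p * phi p)"
      by (intro set_integral_AE_eq_borel(1)) auto
    then show "(LINT p:?O|lebesgue. n p * dphi p $ i + g p $ i * phi p)
      = (LINT p|lborel. indicator ?O p * (u (p $ 3) * dphi p $ i)) + (LINT p|lborel. G i p * phi p)"
      using gi integrable_z_times_test[OF L um int_u(1) c(2)] by simp
  qed
  have g12: "AE p in lebesgue. p \<in> ?O \<longrightarrow> g p $ i = 0" if i: "i = 1 \<or> i = 2" for i
  proof (rule AE_zero_if_orthogonal_to_tests[OF L gi])
    fix phi dphi assume t: "periodic_test L1 L2 phi dphi"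
    have [measurable]: "phi \<in> borel_measurable borel"
      using periodic_test_continuous(1)[OF t] by (rule borel_measurable_continuous_onI)
    have "AE p in lborel. indicator ?O p * (g p $ i * phi p) = G i p * phi p"
      using G(2)[of i] by eventually_elim (simp flip: mult.assoc)
    then have "(LINT p:?O|lebesgue. g p $ i * phi p) = (LINT p|lborel. G i p * phi p)"
      by (intro set_integral_AE_eq_borel(1)) auto
    then show "(LINT p:?O|lebesgue. g p $ i * phi p) = 0"
      using green[OF t, of i] green12[OF t i] green_z_lateral[OF L t i um int_u(1)] by simp
  qed
  define J where "J p = G 3 p - indicator ?O p * \<gamma> (p $ 3)" for p
  have J: "integrable lborel J"
    using G(1) integrable_z_times[OF L \<gamma>m int_u(2)] unfolding J_def by auto
  have [measurable]: "J \<in> borel_measurable borel" using J by (auto dest: borel_measurable_integrable)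
  have gJ: "AE p in lborel. indicator ?O p * (g p $ 3 - \<gamma> (p $ 3)) = J p"
    using G(2)[of 3] by eventually_elim (auto simp: J_def right_diff_distrib)
  have g3: "AE p in lebesgue. p \<in> ?O \<longrightarrow> g p $ 3 - \<gamma> (p $ 3) = 0"
  proof (rule AE_zero_if_orthogonal_to_tests[OF L])
    show "set_integrable lebesgue ?O (\<lambda>p. g p $ 3 - \<gamma> (p $ 3))"
      using set_integral_AE_eq_borel(2)[OF _ gJ] J by simp
    fix phi dphi assume t: "periodic_test L1 L2 phi dphi"
    note c = periodic_test_continuous(1)[OF t] periodic_test_continuous(3)[OF t, of 3]
    have [measurable]: "phi \<in> borel_measurable borel" using c(1) by (rule borel_measurable_continuous_onI)
    have "AE p in lborel. indicator ?O p * ((g p $ 3 - \<gamma> (p $ 3)) * phi p) = J p * phi p"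
      using gJ by eventually_elim (simp flip: mult.assoc)
    then have "(LINT p:?O|lebesgue. (g p $ 3 - \<gamma> (p $ 3)) * phi p) = (LINT p|lborel. J p * phi p)"
      by (intro set_integral_AE_eq_borel(1)) auto
    also have "\<dots> = (LINT p|lborel. G 3 p * phi p - indicator ?O p * (\<gamma> (p $ 3) * phi p))"
      by (intro Bochner_Integration.integral_cong) (auto simp: J_def algebra_simps)
    also have "\<dots> = (LINT p|lborel. G 3 p * phi p) - (LINT p|lborel. indicator ?O p * (\<gamma> (p $ 3) * phi p))"
      using green_int[OF t] integrable_z_times_test[OF L \<gamma>m int_u(2) c(1)] by simp
    also have "\<dots> = 0"
      using green[OF t, of 3] green3[OF t] green_z_vertical[OF L t um \<gamma>m u(1)] u(3) u1
        integrable_z_times_test[OF L \<gamma>m int_u(2) c(1)] integrable_z_times_test[OF L um int_u(1) c(2)]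
      by (simp add: distrib_left)
    finally show "(LINT p:?O|lebesgue. (g p $ 3 - \<gamma> (p $ 3)) * phi p) = 0" .
  qed
  show ?thesis
  proof (rule that[OF um \<gamma>m u u1])
    show "AE p in lebesgue. p \<in> ?O \<longrightarrow> n p = u (p $ 3) \<and> g p = vector [0, 0, \<gamma> (p $ 3)]"
      using n_eq g12[OF disjI1[OF refl]] g12[OF disjI2[OF refl]] g3 by eventually_elim (auto simp: vec_eq_iff forall_3)
  qed
qed

section \<open>The Frank energy of a field of z alone\<close>

definition colg :: "real^3 \<Rightarrow> real^3^3" where
  "colg w = (\<chi> k i. if i = 3 then w $ k else 0)"

definition W1 :: "real \<Rightarrow> real \<Rightarrow> real \<Rightarrow> real \<Rightarrow> real^3 \<Rightarrow> real^3 \<Rightarrow> real" where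
  "W1 K1 K2 K3 t v w = K1 * (w$3)\<^sup>2 + K2 * (t - (v$1 * w$2 - v$2 * w$1))\<^sup>2
     + K3 * ((v$3)\<^sup>2 * ((w$1)\<^sup>2 + (w$2)\<^sup>2) + (v$1 * w$1 + v$2 * w$2)\<^sup>2)"

text \<open>The \<open>K4\<close> term cancels pointwise: with a single nonzero column, the trace of
  the squared gradient and the squared divergence both equal \<open>(w$3)\<^sup>2\<close>.\<close>

lemma wdens_colg: "wdens K1 K2 K3 K4 t v (colg w) = W1 K1 K2 K3 t v w"
proof -
  have c: "curlg (colg w) = vector [- (w$2), w$1, 0]" "divg (colg w) = w$3"
    by (simp_all add: curlg_def divg_def colg_def)
  have t: "trsq (colg w) = (w$3)\<^sup>2" by (simp add: trsq_def sum_3 colg_def power2_eq_square)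
  have i: "v \<bullet> vector [- (w$2), w$1, 0] + t = t - (v$1 * w$2 - v$2 * w$1)" by (simp add: inner_vec_def sum_3)
  have n: "(norm (cross3 v (vector [- (w$2), w$1, 0])))\<^sup>2 = (v$3)\<^sup>2 * ((w$1)\<^sup>2 + (w$2)\<^sup>2) + (v$1 * w$1 + v$2 * w$2)\<^sup>2"
    by (simp add: power2_norm_eq_inner cross3_def inner_vec_def sum_3) (simp add: power2_eq_square algebra_simps)
  show ?thesis unfolding wdens_def W1_def c t i n by simp
qed

lemma borel_measurable_vec_nth:
  fixes f :: "'a \<Rightarrow> real^'n"
  shows "f \<in> borel_measurable N \<longleftrightarrow> (\<forall>k. (\<lambda>x. f x $ k) \<in> borel_measurable N)"
proof -
  have "f \<in> borel_measurable N \<longleftrightarrow> (\<forall>e\<in>Basis. (\<lambda>x. f x \<bullet> e) \<in> borel_measurable N)"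
    by (rule borel_measurable_euclidean_space)
  also have "\<dots> \<longleftrightarrow> (\<forall>k. (\<lambda>x. f x $ k) \<in> borel_measurable N)"
    by (auto simp: Basis_vec_def inner_axis)
  finally show ?thesis .
qed

text \<open>At an exceptional height the whole base would be a null set, but its area
  \<open>4 * L1 * L2\<close> is positive.\<close>

lemma AE_Omega_z:
  assumes L: "L1 > 0" "L2 > 0" and ae: "AE p in lebesgue. p \<in> Omega L1 L2 \<longrightarrow> P (p $ 3)"
  shows "AE z in lborel. z \<in> {0<..<1} \<longrightarrow> P z"
  using AE_point_of[OF ae]
proof eventually_elim
  case (elim z)
  show ?case
  proof (intro impI, rule ccontr)
    assume z: "z \<in> {0<..<1}" and "\<not> P z"
    then have "q \<notin> Base L1 L2" if "point_of (z, q) \<in> Omega L1 L2 \<longrightarrow> P (point_of (z, q) $ 3)" for q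
      using that by (auto simp: point_of_mem_Omega_iff)
    with elim have "AE q in lborel. q \<notin> Base L1 L2" by (rule eventually_mono)
    then have "Base L1 L2 \<in> null_sets lborel" by (subst (asm) AE_iff_null_sets[symmetric]) auto
    then show False using Base_measure(2)[OF L] L by (auto simp: null_sets_def)
  qed
qed

text \<open>If the values differed, disjoint neighbourhoods of them would give a nonempty open set
  of disagreement inside the open interval, even when \<open>z\<close> is an endpoint.\<close>

lemma AE_Ioo_continuous:
  fixes f :: "real \<Rightarrow> 'a::t2_space"
  assumes ae: "AE z in lborel. z \<in> {0<..<1} \<longrightarrow> f z = g z"
    and c: "continuous_on {0..1} f" "continuous_on {0..1} g" and z: "z \<in> {0..1}"
  shows "f z = g z"
proof (rule ccontr)
  assume ne: "f z \<noteq> g z"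
  obtain U V where UV: "open U" "open V" "f z \<in> U" "g z \<in> V" "U \<inter> V = {}" using hausdorff[OF ne] by blast
  obtain A where A: "open A" "z \<in> A" "\<And>y. y \<in> A \<Longrightarrow> y \<in> {0..1} \<Longrightarrow> f y \<in> U"
    using c(1) z UV unfolding continuous_on_topological by metis
  obtain B where B: "open B" "z \<in> B" "\<And>y. y \<in> B \<Longrightarrow> y \<in> {0..1} \<Longrightarrow> g y \<in> V"
    using c(2) z UV unfolding continuous_on_topological by metis
  define S where "S = A \<inter> B \<inter> {0<..<1}"
  have S: "open S" using A B by (auto simp: S_def)
  have "z \<in> closure {0<..<1}" using z by simp
  then have "S \<noteq> {}" using A B by (metis IntI S_def closure_iff_nhds_not_empty inf_commute open_Int order_refl)
  then obtain y where y: "y \<in> S" by blast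
  have dis: "x \<notin> S" if x: "x \<in> {0<..<1} \<longrightarrow> f x = g x" for x
  proof
    assume "x \<in> S"
    then have "f x \<in> U" "g x \<in> V" "f x = g x" using A(3)[of x] B(3)[of x] x by (auto simp: S_def)
    then show False using UV(5) by auto
  qed
  from ae dis have "AE z in lborel. z \<notin> S" by (rule eventually_mono)
  then have "AE z\<in>S in lebesgue. z \<in> {}" by (auto simp: AE_completion_iff)
  from mem_closed_if_AE_lebesgue_open[OF S closed_empty this y] show False by simp
qed

text \<open>The components are treated one at a time, each with its own primitive. The constraint on
  the norm, given almost everywhere on the slab, becomes valid at every height because the resulting
  curve is continuous.\<close>

lemma z_only_reduction:
  assumes L: "L1 > 0" "L2 > 0" and adm: "adm_grad L1 L2 n g"
    and nm: "AE p in lebesgue. p \<in> Omega L1 L2 \<longrightarrow> norm (n p) = 1"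
    and zonly: "AE p in lebesgue. p \<in> Omega L1 L2 \<longrightarrow> n p = m (p $ 3)"
  obtains M \<gamma> where "AC_on 0 1 M \<gamma>" "M \<in> borel_measurable borel" "\<gamma> \<in> borel_measurable borel"
    "M 0 = axis 1 1" "M 1 = axis 3 1" "\<And>z. z \<in> {0..1} \<Longrightarrow> norm (M z) = 1"
    "\<And>k. integrable lborel (\<lambda>z. indicator {0<..<1} z * (\<gamma> z $ k)\<^sup>2)"
    "AE p in lebesgue. p \<in> Omega L1 L2 \<longrightarrow> n p = M (p $ 3) \<and> g p = colg (\<gamma> (p $ 3))"
proof -
  let ?O = "Omega L1 L2"
  have "\<exists>u \<gamma>. u \<in> borel_measurable borel \<and> \<gamma> \<in> borel_measurable borel \<and> AC_on 0 1 u \<gamma> \<and>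
      u 0 = (axis 1 1 :: real^3) $ k \<and> u 1 = (axis 3 1 :: real^3) $ k \<and>
      (AE p in lebesgue. p \<in> ?O \<longrightarrow> n p $ k = u (p $ 3) \<and> g p $ k = vector [0, 0, \<gamma> (p $ 3)])" for k
  proof -
    have *: "AE p in lebesgue. p \<in> ?O \<longrightarrow> n p $ k = m (p $ 3) $ k" using zonly by eventually_elim auto
    have n2: "L2_on ?O (\<lambda>p. n p $ k)" and g2: "L2_on ?O (\<lambda>p. g p $ k $ i)" for i
      using adm unfolding adm_grad_def by auto
    have "(LINT p:?O|lebesgue. n p $ k * dphi p $ i + g p $ k $ i * phi p) = 0"
      if "periodic_test L1 L2 phi dphi" "i = 1 \<or> i = 2" for phi dphi i
      using adm that unfolding adm_grad_def by auto
    moreover have "(LINT p:?O|lebesgue. n p $ k * dphi p $ 3 + g p $ k $ 3 * phi p) =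
        integral (Rect L1 L2) (\<lambda>(x, y). phi (vector [x, y, 1]) * (axis 3 1 :: real^3) $ k - phi (vector [x, y, 0]) * (axis 1 1 :: real^3) $ k)"
      if "periodic_test L1 L2 phi dphi" for phi dphi
      using adm that unfolding adm_grad_def by blast
    ultimately show ?thesis
      by (rule z_only_component[OF L L2_on_imp_set_integrable[OF n2] L2_on_imp_set_integrable[OF g2] *]) blast+
  qed
  then have "\<forall>k. \<exists>w. fst w \<in> borel_measurable borel \<and> snd w \<in> borel_measurable borel \<and> AC_on 0 1 (fst w) (snd w) \<and>
      fst w 0 = (axis 1 1 :: real^3) $ k \<and> fst w 1 = (axis 3 1 :: real^3) $ k \<and>
      (AE p in lebesgue. p \<in> ?O \<longrightarrow> n p $ k = fst w (p $ 3) \<and> g p $ k = vector [0, 0, snd w (p $ 3)])"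
    by simp
  from choice[OF this] obtain w where w: "\<forall>k. fst (w k) \<in> borel_measurable borel \<and> snd (w k) \<in> borel_measurable borel \<and> AC_on 0 1 (fst (w k)) (snd (w k)) \<and>
      fst (w k) 0 = (axis 1 1 :: real^3) $ k \<and> fst (w k) 1 = (axis 3 1 :: real^3) $ k \<and>
      (AE p in lebesgue. p \<in> ?O \<longrightarrow> n p $ k = fst (w k) (p $ 3) \<and> g p $ k = vector [0, 0, snd (w k) (p $ 3)])" ..
  define u \<gamma> where "u k = fst (w k)" and "\<gamma> k = snd (w k)" for k
  have u: "\<And>k. u k \<in> borel_measurable borel" "\<And>k. \<gamma> k \<in> borel_measurable borel" "\<And>k. AC_on 0 1 (u k) (\<gamma> k)"
      "\<And>k. u k 0 = (axis 1 1 :: real^3) $ k" "\<And>k. u k 1 = (axis 3 1 :: real^3) $ k"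
      "\<And>k. AE p in lebesgue. p \<in> ?O \<longrightarrow> n p $ k = u k (p $ 3) \<and> g p $ k = vector [0, 0, \<gamma> k (p $ 3)]"
    using w unfolding u_def \<gamma>_def by blast+
  define M where "M z = (\<chi> k. u k z)" for z
  define \<delta> where "\<delta> z = (\<chi> k. \<gamma> k z)" for z
  have AC: "AC_on 0 1 M \<delta>" by (rule AC_on_vec) (simp add: M_def \<delta>_def u)
  have ae: "AE p in lebesgue. p \<in> ?O \<longrightarrow> n p = M (p $ 3) \<and> g p = colg (\<delta> (p $ 3))"
    using u(6)[of 1] u(6)[of 2] u(6)[of 3]
    by eventually_elim (auto simp: vec_eq_iff forall_3 M_def \<delta>_def colg_def)
  show ?thesis
  proof (rule that[OF AC _ _ _ _ _ _ ae])
    show "M \<in> borel_measurable borel" "\<delta> \<in> borel_measurable borel"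
      unfolding borel_measurable_vec_nth by (simp_all add: M_def \<delta>_def u)
    show "M 0 = axis 1 1" "M 1 = axis 3 1" by (simp_all add: M_def u vec_eq_iff)
    show "norm (M z) = 1" if z: "z \<in> {0..1}" for z
    proof (rule AE_Ioo_continuous[OF _ _ _ z])
      have "AE p in lebesgue. p \<in> ?O \<longrightarrow> norm (M (p $ 3)) = 1" using ae nm by eventually_elim auto
      from AE_Omega_z[OF L this] show "AE z in lborel. z \<in> {0<..<1} \<longrightarrow> norm (M z) = 1" .
    qed (intro continuous_intros AC_on_continuous[OF AC])+
    fix k
    have gi: "set_integrable lebesgue ?O (\<lambda>p. (g p $ k $ 3)\<^sup>2)"
      using adm unfolding adm_grad_def L2_on_def by blast
    have ga: "AE p in lborel. indicator ?O p * (g p $ k $ 3)\<^sup>2 = indicator ?O p * (\<gamma> k (p $ 3))\<^sup>2"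
      using u(6)[of k] unfolding AE_completion_iff by eventually_elim (auto split: split_indicator)
    have gm: "(\<lambda>p::real^3. indicator ?O p * (\<gamma> k (p $ 3))\<^sup>2) \<in> borel_measurable borel"
      using u(2)[of k] by measurable
    have "integrable lborel (\<lambda>p. indicator ?O p * (\<gamma> k (p $ 3))\<^sup>2)"
      using set_integral_AE_eq_borel(2)[OF gm ga] gi by simp
    from LINT_z(2)[OF L this] show "integrable lborel (\<lambda>z. indicator {0<..<1} z * (\<delta> z $ k)\<^sup>2)"
      by (simp add: \<delta>_def)
  qed
qed

lemma measurable_W1 [measurable]:
  assumes "M \<in> borel_measurable borel" "\<gamma> \<in> borel_measurable borel"
  shows "(\<lambda>z. W1 K1 K2 K3 t (M z) (\<gamma> z)) \<in> borel_measurable borel"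
proof -
  have [measurable]: "(\<lambda>z. M z $ k) \<in> borel_measurable borel" "(\<lambda>z. \<gamma> z $ k) \<in> borel_measurable borel" for k
    using assms unfolding borel_measurable_vec_nth by auto
  show ?thesis unfolding W1_def by measurable
qed

lemma z_only_integrable_W1:
  fixes M \<gamma> :: "real \<Rightarrow> real^3"
  assumes M: "M \<in> borel_measurable borel" "\<gamma> \<in> borel_measurable borel" "\<And>z. z \<in> {0..1} \<Longrightarrow> norm (M z) = 1"
    and g2: "\<And>k. integrable lborel (\<lambda>z. indicator {0<..<1} z * (\<gamma> z $ k)\<^sup>2)"
    and K: "K1 \<ge> 0" "K2 \<ge> 0" "K3 \<ge> 0"
  shows "integrable lborel (\<lambda>z. indicator {0<..<1} z * W1 K1 K2 K3 t (M z) (\<gamma> z))"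
proof -
  \<comment> \<open>Components of a unit vector are at most 1 in modulus. The 4 comes from using
    \<open>(x - y)\<^sup>2 \<le> 2 * x\<^sup>2 + 2 * y\<^sup>2\<close> twice, the 3 from one such
    use plus the factor \<open>(v$3)\<^sup>2 \<le> 1\<close>.\<close>
  let ?b = "\<lambda>z. K1 * (\<gamma> z $ 3)\<^sup>2 + K2 * (2 * t\<^sup>2 + 4 * (\<gamma> z $ 1)\<^sup>2 + 4 * (\<gamma> z $ 2)\<^sup>2) + K3 * (3 * (\<gamma> z $ 1)\<^sup>2 + 3 * (\<gamma> z $ 2)\<^sup>2)"
  have I: "integrable lborel (\<lambda>z::real. indicator {0<..<1} z * c)" for c :: real
    by (intro integrable_mult_left integrable_real_indicator) auto
  have "integrable lborel (\<lambda>z. K1 * (indicator {0<..<1} z * (\<gamma> z $ 3)\<^sup>2) + (indicator {0<..<1} z * (K2 * (2 * t\<^sup>2)))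
     + (4 * K2 + 3 * K3) * (indicator {0<..<1} z * (\<gamma> z $ 1)\<^sup>2) + (4 * K2 + 3 * K3) * (indicator {0<..<1} z * (\<gamma> z $ 2)\<^sup>2))"
    by (intro Bochner_Integration.integrable_add integrable_mult_right g2) (rule I)
  also have "(\<lambda>z. K1 * (indicator {0<..<1} z * (\<gamma> z $ 3)\<^sup>2) + (indicator {0<..<1} z * (K2 * (2 * t\<^sup>2)))
     + (4 * K2 + 3 * K3) * (indicator {0<..<1} z * (\<gamma> z $ 1)\<^sup>2) + (4 * K2 + 3 * K3) * (indicator {0<..<1} z * (\<gamma> z $ 2)\<^sup>2))
     = (\<lambda>z. indicator {0<..<1} z * ?b z)" by (auto simp: fun_eq_iff algebra_simps)
  finally show ?thesis
  proof (rule Bochner_Integration.integrable_bound)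
    show "(\<lambda>z. indicator {0<..<1} z * W1 K1 K2 K3 t (M z) (\<gamma> z)) \<in> borel_measurable lborel"
      using measurable_W1[OF M(1,2)] by measurable
    have "\<bar>W1 K1 K2 K3 t (M z) (\<gamma> z)\<bar> \<le> \<bar>?b z\<bar>" if z: "z \<in> {0<..<1}" for z
    proof -
      have sq: "(x + y)\<^sup>2 \<le> 2 * x\<^sup>2 + 2 * y\<^sup>2" for x y :: real
        using zero_le_power2[of "x - y"] by (simp add: power2_eq_square algebra_simps)
      have sqm: "(x - y)\<^sup>2 \<le> 2 * x\<^sup>2 + 2 * y\<^sup>2" for x y :: real using sq[of x "- y"] by simp
      have b: "(M z $ k)\<^sup>2 \<le> 1" for k
        using M(3)[of z] z component_le_norm_cart[of "M z" k] abs_square_le_1[of "M z $ k"] by auto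
      have bb: "(M z $ k * \<gamma> z $ l)\<^sup>2 \<le> (\<gamma> z $ l)\<^sup>2" for k l
        using b[of k] by (simp add: power_mult_distrib mult_left_le_one_le)
      have 1: "(t - (M z$1 * \<gamma> z$2 - M z$2 * \<gamma> z$1))\<^sup>2 \<le> 2 * t\<^sup>2 + 4 * (\<gamma> z $ 1)\<^sup>2 + 4 * (\<gamma> z $ 2)\<^sup>2"
        using sqm[of t "M z$1 * \<gamma> z$2 - M z$2 * \<gamma> z$1"] sqm[of "M z$1 * \<gamma> z$2" "M z$2 * \<gamma> z$1"] bb[of 1 2] bb[of 2 1]
        by linarith
      have 2: "(M z$3)\<^sup>2 * ((\<gamma> z$1)\<^sup>2 + (\<gamma> z$2)\<^sup>2) + (M z$1 * \<gamma> z$1 + M z$2 * \<gamma> z$2)\<^sup>2 \<le> 3 * (\<gamma> z $ 1)\<^sup>2 + 3 * (\<gamma> z $ 2)\<^sup>2"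
        using sq[of "M z$1 * \<gamma> z$1" "M z$2 * \<gamma> z$2"] bb[of 1 1] bb[of 2 2] mult_left_le_one_le[OF _ zero_le_power2 b, of "(\<gamma> z$1)\<^sup>2 + (\<gamma> z$2)\<^sup>2" 3]
        by simp
      have "0 \<le> W1 K1 K2 K3 t (M z) (\<gamma> z)" unfolding W1_def using K by simp
      moreover have "W1 K1 K2 K3 t (M z) (\<gamma> z) \<le> ?b z"
        unfolding W1_def using mult_left_mono[OF 1 K(2)] mult_left_mono[OF 2 K(3)] by simp
      ultimately show ?thesis by simp
    qed
    then show "AE z in lborel. norm (indicator {0<..<1} z * W1 K1 K2 K3 t (M z) (\<gamma> z)) \<le> norm (indicator {0<..<1} z * ?b z)"
      by (intro AE_I2) (auto split: split_indicator)
  qed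
qed

lemma z_only_energy:
  assumes L: "L1 > 0" "L2 > 0" and M: "M \<in> borel_measurable borel" "\<gamma> \<in> borel_measurable borel" "\<And>z. z \<in> {0..1} \<Longrightarrow> norm (M z) = 1"
    and g2: "\<And>k. integrable lborel (\<lambda>z. indicator {0<..<1} z * (\<gamma> z $ k)\<^sup>2)"
    and ae: "AE p in lebesgue. p \<in> Omega L1 L2 \<longrightarrow> n p = M (p $ 3) \<and> g p = colg (\<gamma> (p $ 3))"
    and K: "K1 \<ge> 0" "K2 \<ge> 0" "K3 \<ge> 0"
  shows "(LINT p:Omega L1 L2|lebesgue. wdens K1 K2 K3 K4 t (n p) (g p))
    = 4 * L1 * L2 * (LINT z|lborel. indicator {0<..<1} z * W1 K1 K2 K3 t (M z) (\<gamma> z))"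
proof -
  let ?W = "\<lambda>z. W1 K1 K2 K3 t (M z) (\<gamma> z)"
  note [measurable] = measurable_W1[OF M(1,2), of K1 K2 K3 t]
  have "AE p in lborel. indicator (Omega L1 L2) p * wdens K1 K2 K3 K4 t (n p) (g p) = indicator (Omega L1 L2) p * ?W (p $ 3)"
    using ae unfolding AE_completion_iff by eventually_elim (auto simp: wdens_colg split: split_indicator)
  then have "(LINT p:Omega L1 L2|lebesgue. wdens K1 K2 K3 K4 t (n p) (g p)) = (LINT p|lborel. indicator (Omega L1 L2) p * ?W (p $ 3))"
    by (intro set_integral_AE_eq_borel(1)) auto
  also have "\<dots> = 4 * L1 * L2 * (LINT z|lborel. indicator {0<..<1} z * ?W z)"
    by (intro LINT_z(1) integrable_z_times L z_only_integrable_W1 M g2 K) auto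
  finally show ?thesis .
qed

text \<open>Supplies the admissibility of the minimiser: the two Green formulas are read in the
  direction opposite to \<open>z_only_reduction\<close>.\<close>

lemma z_only_adm_grad:
  assumes L: "L1 > 0" "L2 > 0" and M: "M \<in> borel_measurable borel" "\<gamma> \<in> borel_measurable borel" "AC_on 0 1 M \<gamma>"
    "M 0 = axis 1 1" "M 1 = axis 3 1"
    and g2: "\<And>k. integrable lborel (\<lambda>z. indicator {0<..<1} z * (\<gamma> z $ k)\<^sup>2)"
    and n: "\<And>p. p \<in> Omega L1 L2 \<Longrightarrow> n p = M (p $ 3)"
  shows "adm_grad L1 L2 n (\<lambda>p. colg (\<gamma> (p $ 3)))"
proof -
  let ?O = "Omega L1 L2"
  have m [measurable]: "(\<lambda>z. M z $ k) \<in> borel_measurable borel" "(\<lambda>z. \<gamma> z $ k) \<in> borel_measurable borel" for k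
    using M(1,2) unfolding borel_measurable_vec_nth by auto
  have AC: "AC_on 0 1 (\<lambda>z. M z $ k) (\<lambda>z. \<gamma> z $ k)" for k by (rule AC_on_linear[OF M(3) bounded_linear_vec_nth])
  have L2: "L2_on ?O f" if f: "\<And>p. p \<in> ?O \<Longrightarrow> f p = h (p $ 3)" and [measurable]: "h \<in> borel_measurable borel"
    and i: "integrable lborel (\<lambda>z. indicator {0<..<1} z * (h z)\<^sup>2)" for f h
  proof -
    have e1: "(\<lambda>p. indicator ?O p *\<^sub>R f p) = (\<lambda>p. indicator ?O p * h (p $ 3))" by (auto simp: f fun_eq_iff split: split_indicator)
    have e2: "(\<lambda>p. indicator ?O p *\<^sub>R (f p)\<^sup>2) = (\<lambda>p. indicator ?O p * (h (p $ 3))\<^sup>2)" by (auto simp: f fun_eq_iff split: split_indicator)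
    have "integrable lborel (\<lambda>p. indicator ?O p * (h (p $ 3))\<^sup>2)" by (rule integrable_z_times[OF L _ i]) measurable
    then have "integrable lebesgue (\<lambda>p. indicator ?O p * (h (p $ 3))\<^sup>2)" by (subst integrable_completion) auto
    moreover have "(\<lambda>p. indicator ?O p * h (p $ 3)) \<in> borel_measurable lebesgue" by (intro measurable_completion) measurable
    ultimately show ?thesis unfolding L2_on_def set_borel_measurable_def set_integrable_def e1 e2 by auto
  qed
  have "integrable lborel (\<lambda>z. indicator {0<..<1} z * (M z $ k)\<^sup>2)" for k
    using AC_on_continuous[OF AC[of k]] by (intro LINT_Ioo_eq_integral(2) absolutely_integrable_continuous_real continuous_on_power) auto
  then have 1: "L2_on ?O (\<lambda>p. n p $ k)" for k by (intro L2[of _ "\<lambda>z. M z $ k"]) (auto simp: n)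
  have 2: "L2_on ?O (\<lambda>p. colg (\<gamma> (p $ 3)) $ k $ i)" for k i
    by (rule L2[of _ "\<lambda>z. if i = 3 then \<gamma> z $ k else 0"]; cases "i = 3") (simp_all add: colg_def g2)
  have mt: "phi \<in> borel_measurable borel" "(\<lambda>p. dphi p $ i) \<in> borel_measurable borel" if t: "periodic_test L1 L2 phi dphi" for phi dphi i
    using periodic_test_continuous(1)[OF t] periodic_test_continuous(3)[OF t, of i] by (auto intro: borel_measurable_continuous_onI)
  have 3: "(LINT p:?O|lebesgue. n p $ k * dphi p $ i + colg (\<gamma> (p $ 3)) $ k $ i * phi p) = 0"
    if t: "periodic_test L1 L2 phi dphi" and i: "i = 1 \<or> i = 2" for phi dphi k i
  proof -
    note [measurable] = mt[OF t]
    have "(LINT p:?O|lebesgue. n p $ k * dphi p $ i + colg (\<gamma> (p $ 3)) $ k $ i * phi p) = (LINT p|lborel. indicator ?O p * (M (p $ 3) $ k * dphi p $ i))"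
      by (rule set_integral_AE_eq_borel(1)) (use i in \<open>auto simp: n colg_def split: split_indicator\<close>)
    then show ?thesis using green_z_lateral[OF L t i m(1) AC_on_integrable_borel(1)[OF AC m]] by simp
  qed
  have 4: "(LINT p:?O|lebesgue. n p $ k * dphi p $ 3 + colg (\<gamma> (p $ 3)) $ k $ 3 * phi p) =
      integral (Rect L1 L2) (\<lambda>(x, y). phi (vector [x, y, 1]) * (axis 3 1 :: real^3) $ k - phi (vector [x, y, 0]) * (axis 1 1 :: real^3) $ k)"
    if t: "periodic_test L1 L2 phi dphi" for phi dphi k
  proof -
    note [measurable] = mt[OF t]
    have "(LINT p:?O|lebesgue. n p $ k * dphi p $ 3 + colg (\<gamma> (p $ 3)) $ k $ 3 * phi p)
        = (LINT p|lborel. indicator ?O p * (M (p $ 3) $ k * dphi p $ 3 + \<gamma> (p $ 3) $ k * phi p))"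
      by (rule set_integral_AE_eq_borel(1)) (auto simp: n colg_def split: split_indicator)
    then show ?thesis using green_z_vertical[OF L t m AC] M(4,5) by simp
  qed
  show ?thesis unfolding adm_grad_def using 1 2 3 4 by blast
qed

section \<open>The one-dimensional variational problem\<close>

lemma AC_on_add:
  fixes u v :: "real \<Rightarrow> 'a::euclidean_space"
  assumes "AC_on a b u g" "AC_on a b v h"
  shows "AC_on a b (\<lambda>z. u z + v z) (\<lambda>z. g z + h z)"
proof -
  have "bounded_linear (\<lambda>x::'a \<times> 'a. fst x + snd x)"
    by (intro bounded_linear_add bounded_linear_fst bounded_linear_snd)
  from AC_on_linear[OF AC_on_Pair[OF assms] this] show ?thesis by simp
qed

lemma AC_on_cmult:
  fixes u :: "real \<Rightarrow> real"
  assumes "AC_on a b u g"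
  shows "AC_on a b (\<lambda>z. c * u z) (\<lambda>z. c * g z)"
  by (rule AC_on_linear[OF assms bounded_linear_mult_right])

lemma AC_on_diff:
  fixes u v :: "real \<Rightarrow> real"
  assumes "AC_on a b u g" "AC_on a b v h"
  shows "AC_on a b (\<lambda>z. u z - v z) (\<lambda>z. g z - h z)"
  using AC_on_add[OF assms(1) AC_on_cmult[OF assms(2), of "-1"]] by simp

lemma AC_on_real_chain:
  fixes u :: "real \<Rightarrow> real"
  assumes u: "AC_on a b u g" and U: "open U" "u ` {a..b} \<subseteq> U"
    and F: "\<And>x. x \<in> U \<Longrightarrow> (F has_real_derivative D x) (at x)" and D: "continuous_on U D"
  shows "AC_on a b (\<lambda>z. F (u z)) (\<lambda>z. D (u z) * g z)"
  using AC_on_chain[OF u U, of F D] F D by (simp add: has_field_derivative_def)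

lemma AC_on_sin_cos:
  fixes u :: "real \<Rightarrow> real"
  assumes "AC_on a b u g"
  shows "AC_on a b (\<lambda>z. sin (u z)) (\<lambda>z. cos (u z) * g z)" "AC_on a b (\<lambda>z. cos (u z)) (\<lambda>z. - sin (u z) * g z)"
  by (rule AC_on_real_chain[OF assms open_UNIV]; auto intro!: derivative_eq_intros continuous_intros)+

lemma AC_on_cong:
  assumes "AC_on a b M g" "\<And>z. z \<in> {a..b} \<Longrightarrow> M z = M' z" "\<And>z. z \<in> {a..b} \<Longrightarrow> g z = g' z"
  shows "AC_on a b M' g'"
  unfolding AC_on_def
proof (intro conjI allI impI)
  show "g' absolutely_integrable_on {a..b}"
    using AC_onD(1)[OF assms(1)] assms(3) set_integrable_cong[of lebesgue lebesgue "{a..b}" "{a..b}" g g'] by auto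
  fix u v assume uv: "a \<le> u" "u \<le> v" "v \<le> b"
  have "integral {u..v} g' = integral {u..v} g"
    using assms(3) uv by (intro Henstock_Kurzweil_Integration.integral_cong) auto
  then show "M' v - M' u = integral {u..v} g'"
    using AC_onD(2)[OF assms(1) uv] assms(2)[of u] assms(2)[of v] uv by simp
qed

lemma integral_nonneg_AE_real:
  fixes f :: "real \<Rightarrow> real"
  assumes f: "f absolutely_integrable_on {u..v}" and ae: "AE z in lborel. z \<in> {u<..<v} \<longrightarrow> 0 \<le> f z"
  shows "0 \<le> integral {u..v} f"
proof -
  have f': "f absolutely_integrable_on {u<..<v}" by (rule set_integrable_subset[OF f]) auto
  have "0 \<le> (LINT z:{u<..<v}|lebesgue. f z)"
    unfolding set_lebesgue_integral_def
    by (rule integral_nonneg_AE) (use AE_completion[OF ae] in eventually_elim, auto split: split_indicator)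
  then show ?thesis using set_lebesgue_integral_eq_integral(2)[OF f'] by (simp add: integral_open_interval_real)
qed

lemma AC_on_mono:
  fixes u :: "real \<Rightarrow> real"
  assumes u: "AC_on a b u g" and ae: "AE z in lborel. z \<in> {a<..<b} \<longrightarrow> 0 \<le> g z" and xy: "a \<le> x" "x \<le> y" "y \<le> b"
  shows "u x \<le> u y"
proof -
  have "0 \<le> integral {x..y} g"
  proof (rule integral_nonneg_AE_real)
    show "g absolutely_integrable_on {x..y}" using AC_onD(1)[OF AC_on_subinterval[OF u xy(1,3)]] .
    show "AE z in lborel. z \<in> {x<..<y} \<longrightarrow> 0 \<le> g z" using ae by eventually_elim (use xy in auto)
  qed
  then show ?thesis using AC_onD(2)[OF u xy] by simp
qed

lemma AC_on_const:
  fixes u :: "real \<Rightarrow> real"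
  assumes u: "AC_on a b u g" and ae: "AE z in lborel. z \<in> {a<..<b} \<longrightarrow> g z = 0" and x: "a \<le> x" "x \<le> b"
  shows "u x = u a"
proof (rule antisym)
  show "u a \<le> u x" by (rule AC_on_mono[OF u _ _ x(1) x(2)]) (use ae in \<open>eventually_elim, auto\<close>)
  have "-1 * u a \<le> -1 * u x"
    by (rule AC_on_mono[OF AC_on_cmult[OF u, of "-1"] _ _ x(1) x(2)]) (use ae in \<open>eventually_elim, auto\<close>)
  then show "u x \<le> u a" by simp
qed

text \<open>Every interval integral of \<open>g\<close> is an increment of a constant; the box
  criterion then applies once boxes are clipped to the interval. This is what turns equality of
  energies into differential equations.\<close>

lemma AC_on_const_imp_zero:
  fixes g :: "real \<Rightarrow> real"
  assumes u: "AC_on a b u g" and c: "\<And>z. z \<in> {a..b} \<Longrightarrow> u z = c"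
  shows "AE z in lborel. z \<in> {a<..<b} \<longrightarrow> g z = 0"
proof -
  have g: "g absolutely_integrable_on {a<..<b}" by (rule set_integrable_subset[OF AC_onD(1)[OF u]]) auto
  obtain h where h: "integrable lborel h" "AE z in lborel. indicator {a<..<b} z *\<^sub>R g z = h z"
    by (rule integrable_lebesgue_imp_borel[OF g[unfolded set_integrable_def]])
  have [measurable]: "h \<in> borel_measurable borel" using h(1) by (auto dest: borel_measurable_integrable)
  have "AE z in lborel. h z = 0"
  proof (rule AE_zero_if_box_integrals_zero[OF h(1)])
    fix p q :: real
    define x y where "x = max p a" and "y = min q b"
    have "AE z in lborel. indicator {x<..<y} z * g z = indicator (box p q) z * h z"
      using h(2) by eventually_elim (auto simp: x_def y_def split: split_indicator split_indicator_asm)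
    then have "(LINT z:{x<..<y}|lebesgue. g z) = (LINT z|lborel. indicator (box p q) z * h z)"
      by (intro set_integral_AE_eq_borel(1)) auto
    moreover have "(LINT z:{x<..<y}|lebesgue. g z) = integral {x<..<y} g"
      by (intro set_lebesgue_integral_eq_integral set_integrable_subset[OF g]) (auto simp: x_def y_def)
    moreover have "integral {x<..<y} g = 0"
    proof (cases "x \<le> y")
      case True
      then have "a \<le> x" "y \<le> b" by (auto simp: x_def y_def)
      then show ?thesis using AC_onD(2)[OF u, of x y] c[of x] c[of y] True
        by (auto simp: integral_open_interval_real[symmetric])
    qed auto
    ultimately show "(LINT z:box p q|lborel. h z) = 0" by (simp add: set_lebesgue_integral_def)
  qed
  then show ?thesis using h(2) by eventually_elim auto
qed

lemma convex_comb_pos: "0 < k * (1 - s\<^sup>2) + l * s\<^sup>2" if "k > 0" "l > 0" "\<bar>s\<bar> \<le> 1" for k l s :: real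
proof (cases "s = 0")
  case False
  then have "0 < l * s\<^sup>2" "0 \<le> 1 - s\<^sup>2" using that by (auto simp: abs_square_le_1)
  then show ?thesis using that by (simp add: add_nonneg_pos)
qed (use that in simp)

section \<open>The pointwise energy identity\<close>

locale frank =
  fixes K1 K2 K3 t C :: real
  assumes K: "K1 > 0" "K2 > 0" "K3 > 0" and C: "C > K2 * t\<^sup>2"
begin

text \<open>The argument \<open>s\<close> stands for \<open>sin \<theta>\<close>: \<open>ff\<close> and \<open>gg\<close> are \<open>K\<^sub>1 cos\<^sup>2 \<theta> + K\<^sub>3 sin\<^sup>2 \<theta>\<close> and
  \<open>K\<^sub>2 cos\<^sup>2 \<theta> + K\<^sub>3 sin\<^sup>2 \<theta>\<close>, and \<open>PP\<close> is the denominator \<open>C - q\<close> in the definition of \<open>C\<close>.\<close>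

definition ff :: "real \<Rightarrow> real" where "ff s = K1 * (1 - s\<^sup>2) + K3 * s\<^sup>2"
definition gg :: "real \<Rightarrow> real" where "gg s = K2 * (1 - s\<^sup>2) + K3 * s\<^sup>2"
definition PP :: "real \<Rightarrow> real" where "PP s = C - K2\<^sup>2 * t\<^sup>2 * (1 - s\<^sup>2) / gg s"
definition EE :: "real \<Rightarrow> real" where "EE u = sqrt (ff (sin u) * PP (sin u))"
abbreviation "FF \<equiv> Fint K1 K2 K3 t C"
abbreviation "WW \<equiv> W1 K1 K2 K3 t"
abbreviation "aa \<equiv> C - K2 * t\<^sup>2"

lemma ff_pos: "\<bar>s\<bar> \<le> 1 \<Longrightarrow> ff s > 0" and gg_pos: "\<bar>s\<bar> \<le> 1 \<Longrightarrow> gg s > 0"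
  using K by (auto simp: ff_def gg_def convex_comb_pos)

text \<open>The subtracted term is \<open>K2 * t\<^sup>2\<close> times
  \<open>K2 * (1 - s\<^sup>2) / gg s\<close>, a ratio at most 1; so the strict lower bound on
  \<open>C\<close> suffices.\<close>

lemma PP_pos: assumes "\<bar>s\<bar> \<le> 1" shows "PP s > 0"
proof -
  have "K2\<^sup>2 * t\<^sup>2 * (1 - s\<^sup>2) \<le> K2 * t\<^sup>2 * gg s"
  proof -
    have "K2 * t\<^sup>2 * gg s = K2\<^sup>2 * t\<^sup>2 * (1 - s\<^sup>2) + K2 * t\<^sup>2 * (K3 * s\<^sup>2)"
      by (simp add: gg_def power2_eq_square algebra_simps)
    moreover have "0 \<le> K2 * t\<^sup>2 * (K3 * s\<^sup>2)" using K by simp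
    ultimately show ?thesis by simp
  qed
  then have "K2\<^sup>2 * t\<^sup>2 * (1 - s\<^sup>2) / gg s \<le> K2 * t\<^sup>2" using gg_pos[OF assms] by (simp add: pos_divide_le_eq)
  then show ?thesis using C by (simp add: PP_def)
qed

lemma FF_eq: "FF u = sqrt (ff (sin u)) / sqrt (PP (sin u))"
  by (simp add: Fint_def ff_def gg_def PP_def cos_squared_eq)

lemma FF_pos: "FF u > 0"
  unfolding FF_eq using ff_pos[of "sin u"] PP_pos[of "sin u"] by simp

lemma FF_continuous: "continuous_on S FF" and EE_continuous: "continuous_on S EE"
proof -
  have p: "gg (sin u) \<noteq> 0" "PP (sin u) \<noteq> 0" for u
    using gg_pos[of "sin u"] PP_pos[of "sin u"] by auto
  have "continuous_on S (\<lambda>u. ff (sin u))" unfolding ff_def by (intro continuous_intros)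
  moreover have "continuous_on S (\<lambda>u. gg (sin u))" unfolding gg_def by (intro continuous_intros)
  then have "continuous_on S (\<lambda>u. PP (sin u))" unfolding PP_def by (intro continuous_intros) (use p in auto)
  ultimately show "continuous_on S FF" "continuous_on S EE"
    unfolding FF_eq[abs_def] EE_def[abs_def] by (auto intro!: continuous_intros simp: p)
qed

text \<open>In angles \<rho> is cos \<theta>, \<open>w$3\<close> / \<rho> is \<theta>' and
  \<open>A\<close> is \<rho>^2 \<phi>'. Lagrange's identity and \<open>v \<bullet> w = 0\<close>
  express the horizontal part of \<open>w\<close> through \<open>w$3\<close> and \<open>A\<close>.
  Completing the square in \<open>A\<close> produces the reduced potential inside \<open>PP\<close>;
  the rest is a sum of two squares, rewritten as the square of a difference plus twice the product,
  with the free sign \<sigma>.\<close>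

lemma energy_identity:
  fixes v w :: "real^3"
  assumes v: "norm v = 1" "v \<bullet> w = 0" "\<bar>v$3\<bar> < 1" and sg: "\<sigma>\<^sup>2 = 1"
  defines "\<rho> \<equiv> sqrt (1 - (v$3)\<^sup>2)" and "A \<equiv> v$1 * w$2 - v$2 * w$1"
  shows "WW v w + aa = 2 * \<sigma> * sqrt (ff (v$3) * PP (v$3)) * w$3 / \<rho>
    + ((\<sigma> * sqrt (ff (v$3)) * w$3 / \<rho> - sqrt (PP (v$3)))\<^sup>2 + gg (v$3) / \<rho>\<^sup>2 * (A - K2 * t * \<rho>\<^sup>2 / gg (v$3))\<^sup>2)"
proof -
  define s where "s = v$3"
  define r where "r = \<rho>\<^sup>2"
  have "s\<^sup>2 < 1" using v(3) by (simp add: s_def abs_square_less_1)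
  then have r: "r = 1 - s\<^sup>2" "r > 0" and rp: "\<rho> > 0" by (simp_all add: r_def \<rho>_def s_def)
  have r2: "(v$1)\<^sup>2 + (v$2)\<^sup>2 = r" using v(1) by (simp add: r s_def norm_vec_def L2_set_def sum_3 real_sqrt_eq_1_iff)
  have vw: "v$1 * w$1 + v$2 * w$2 = - s * w$3" using v(2) by (simp add: s_def inner_vec_def sum_3)
  have ffp: "ff s > 0" and ggp: "gg s > 0" and PPp: "PP s > 0"
    using ff_pos gg_pos PP_pos v(3) by (simp_all add: s_def)
  have lag: "r * ((w$1)\<^sup>2 + (w$2)\<^sup>2) = s\<^sup>2 * (w$3)\<^sup>2 + A\<^sup>2"
  proof -
    have "r * ((w$1)\<^sup>2 + (w$2)\<^sup>2) = (v$1 * w$1 + v$2 * w$2)\<^sup>2 + A\<^sup>2"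
      unfolding r2[symmetric] A_def by (simp add: power2_eq_square algebra_simps)
    then show ?thesis unfolding vw by (simp add: power_mult_distrib)
  qed
  then have w12: "(w$1)\<^sup>2 + (w$2)\<^sup>2 = (s\<^sup>2 * (w$3)\<^sup>2 + A\<^sup>2) / r" using r(2) by (simp add: field_simps)
  have W: "WW v w = ff s * (w$3)\<^sup>2 / r + K2 * (t - A)\<^sup>2 + K3 * s\<^sup>2 * A\<^sup>2 / r"
  proof -
    have "WW v w = K1 * (w$3)\<^sup>2 + K2 * (t - A)\<^sup>2 + K3 * (s\<^sup>2 * ((s\<^sup>2 * (w$3)\<^sup>2 + A\<^sup>2) / r) + (s * w$3)\<^sup>2)"
      unfolding W1_def w12 vw by (simp add: A_def s_def)
    moreover have "s\<^sup>2 * ((s\<^sup>2 * (w$3)\<^sup>2 + A\<^sup>2) / r) + (s * w$3)\<^sup>2 = s\<^sup>2 * ((w$3)\<^sup>2 + A\<^sup>2) / r"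
      using r(2) by (simp add: field_simps) (simp add: r(1) power2_eq_square power4_eq_xxxx algebra_simps)
    moreover have "K1 * (w$3)\<^sup>2 + K3 * (s\<^sup>2 * ((w$3)\<^sup>2 + A\<^sup>2) / r) = ff s * (w$3)\<^sup>2 / r + K3 * s\<^sup>2 * A\<^sup>2 / r"
      using r(2) by (simp add: field_simps) (simp add: ff_def r(1) power2_eq_square algebra_simps)
    ultimately show ?thesis by simp
  qed
  have D1: "(\<sigma> * sqrt (ff s) * w$3 / \<rho> - sqrt (PP s))\<^sup>2 = ff s * (w$3)\<^sup>2 / r - 2 * \<sigma> * sqrt (ff s * PP s) * w$3 / \<rho> + PP s"
    using sg ffp PPp by (simp add: power2_diff power_divide power_mult_distrib r_def real_sqrt_mult)
  have D2: "gg s / r * (A - K2 * t * r / gg s)\<^sup>2 = gg s * A\<^sup>2 / r - 2 * A * K2 * t + K2\<^sup>2 * t\<^sup>2 * r / gg s"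
    using r(2) ggp by (simp add: power2_eq_square field_simps)
  have P: "PP s = C - K2\<^sup>2 * t\<^sup>2 * r / gg s" by (simp add: PP_def r(1))
  have G: "gg s * A\<^sup>2 / r = K2 * A\<^sup>2 + K3 * s\<^sup>2 * A\<^sup>2 / r"
    using r(2) by (simp add: field_simps) (simp add: gg_def r(1) algebra_simps)
  show ?thesis
    unfolding s_def[symmetric] r_def[symmetric] D1 D2 W G unfolding P by (simp add: power2_eq_square algebra_simps)
qed

end

definition z_curve :: "(real \<Rightarrow> real^3) \<Rightarrow> (real \<Rightarrow> real^3) \<Rightarrow> bool" where
  "z_curve M \<gamma> \<longleftrightarrow> AC_on 0 1 M \<gamma> \<and> M \<in> borel_measurable borel \<and> \<gamma> \<in> borel_measurable borel \<and>
     M 0 = axis 1 1 \<and> M 1 = axis 3 1 \<and> (\<forall>z\<in>{0..1}. norm (M z) = 1) \<and>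
     (\<forall>k. integrable lborel (\<lambda>z. indicator {0<..<1} z * (\<gamma> z $ k)\<^sup>2))"

text \<open>The squared norm is constant along the curve, so its derivative vanishes almost
  everywhere.\<close>

lemma z_curve_orthogonal:
  assumes "z_curve M \<gamma>"
  shows "AE z in lborel. z \<in> {0<..<1} \<longrightarrow> M z \<bullet> \<gamma> z = 0"
proof -
  have AC: "AC_on 0 1 M \<gamma>" and n: "\<And>z. z \<in> {0..1} \<Longrightarrow> norm (M z) = 1" using assms by (auto simp: z_curve_def)
  have "AC_on 0 1 (\<lambda>z. M z \<bullet> M z) (\<lambda>z. (2 *\<^sub>R M z) \<bullet> \<gamma> z)"
  proof (rule AC_on_chain[OF AC open_UNIV])
    show "((\<lambda>x. x \<bullet> x) has_derivative (\<bullet>) (2 *\<^sub>R x)) (at x)" for x :: "real^3"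
      by (auto intro!: derivative_eq_intros simp: inner_commute)
  qed (auto intro: continuous_intros)
  from AC_on_const_imp_zero[OF this, of 1]
  have "AE z in lborel. z \<in> {0<..<1} \<longrightarrow> (2 *\<^sub>R M z) \<bullet> \<gamma> z = 0" using n by (simp add: dot_square_norm)
  then show ?thesis by eventually_elim auto
qed

section \<open>The lower bound and the conditions for equality\<close>

context frank
begin

text \<open>The height needed to turn from angle 0 to a given angle at optimal speed; the profile is
  its inverse. Choosing the antiderivative on the whole line gives two-sided derivatives at
  \<open>0\<close> and \<open>pi / 2\<close> and covers negative angles.\<close>

definition Phi :: "real \<Rightarrow> real" where
  "Phi = (SOME F. (\<forall>x. (F has_real_derivative FF x) (at x)) \<and> F 0 = 0)"

definition Psi :: "real \<Rightarrow> real" where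
  "Psi = (SOME F. (\<forall>x. (F has_real_derivative EE x) (at x)) \<and> F 0 = 0)"

lemma Phi_deriv: "(Phi has_real_derivative FF x) (at x)" and Phi_0: "Phi 0 = 0"
  using someI_ex[OF antiderivative_from_0[OF FF_continuous]] unfolding Phi_def[symmetric] by auto

lemma Psi_deriv: "(Psi has_real_derivative EE x) (at x)" and Psi_0: "Psi 0 = 0"
  using someI_ex[OF antiderivative_from_0[OF EE_continuous]] unfolding Psi_def[symmetric] by auto

text \<open>Turning to the south pole costs as much as turning to the north pole, so a curve that
  meets the south pole first obeys the same bound.\<close>

lemma Psi_minus: "Psi (- u) = - Psi u"
proof -
  have e: "EE (- u) = EE u" for u by (simp add: EE_def ff_def PP_def gg_def)
  have "((\<lambda>u. Psi (- u) + Psi u) has_real_derivative EE (- x) * (-1) + EE x) (at x)" for x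
    by (intro derivative_intros DERIV_chain2[OF Psi_deriv] Psi_deriv)
  then have "\<forall>x. ((\<lambda>u. Psi (- u) + Psi u) has_real_derivative 0) (at x)" unfolding e by simp
  from DERIV_isconst_all[OF this, of u 0] show ?thesis by (simp add: Psi_0)
qed

lemma Phi_less: "x < y \<Longrightarrow> Phi x < Phi y"
  by (rule DERIV_pos_imp_increasing) (use Phi_deriv FF_pos in blast)+

lemma Phi_inj: "Phi x = Phi y \<longleftrightarrow> x = y"
  using Phi_less[of x y] Phi_less[of y x] by (cases x y rule: linorder_cases) auto

lemma integral_FF: "0 \<le> y \<Longrightarrow> integral {0..y} FF = Phi y"
  using fundamental_theorem_of_calculus[of 0 y Phi FF]
    has_vector_derivative_at_within[OF Phi_deriv[unfolded has_real_derivative_iff_has_vector_derivative]]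
  by (simp add: Phi_0 integral_unique)

definition energy1 :: "(real \<Rightarrow> real^3) \<Rightarrow> (real \<Rightarrow> real^3) \<Rightarrow> real" where
  "energy1 M \<gamma> = (LINT z|lborel. indicator {0<..<1} z * WW (M z) (\<gamma> z))"

definition min_energy :: real where "min_energy = 2 * Psi (pi / 2) - aa"

text \<open>The shifted energy accumulated up to height z. The summand \<open>0\<close> and the
  clamped limit give it the shape of the primitive in \<open>AC_on_integral\<close>.\<close>

definition VV :: "(real \<Rightarrow> real^3) \<Rightarrow> (real \<Rightarrow> real^3) \<Rightarrow> real \<Rightarrow> real" where
  "VV M \<gamma> z = 0 + integral {0..max 0 (min 1 z)} (\<lambda>z. indicator {0<..<1} z * (WW (M z) (\<gamma> z) + aa))"

lemma VV_AC:
  assumes "z_curve M \<gamma>"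
  shows "AC_on 0 1 (VV M \<gamma>) (\<lambda>z. indicator {0<..<1} z * (WW (M z) (\<gamma> z) + aa))"
    and "VV M \<gamma> 0 = 0" "VV M \<gamma> 1 = energy1 M \<gamma> + aa"
proof -
  let ?g = "\<lambda>z. indicator {0<..<1} z * (WW (M z) (\<gamma> z) + aa)"
  have iW: "integrable lborel (\<lambda>z. indicator {0<..<1} z * WW (M z) (\<gamma> z))"
    using assms K by (intro z_only_integrable_W1) (auto simp: z_curve_def)
  have ia: "integrable lborel (\<lambda>z::real. indicator {0<..<1} z * aa)"
    by (intro integrable_mult_left integrable_real_indicator) auto
  have i: "integrable lborel ?g" unfolding distrib_left by (rule Bochner_Integration.integrable_add[OF iW ia])
  note V = AC_on_integral[OF i, of 0]
  show AC: "AC_on 0 1 (VV M \<gamma>) ?g" and V0: "VV M \<gamma> 0 = 0" using V(1,3) unfolding VV_def by auto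
  have "VV M \<gamma> 1 = integral {0..1} ?g" by (simp add: VV_def)
  also have "\<dots> = (LINT z|lborel. indicator {0<..<1} z * ?g z)"
    using i by (intro LINT_Ioo_eq_integral(1)[symmetric] AC_onD(1)[OF AC]) (auto dest: borel_measurable_integrable)
  also have "\<dots> = (LINT z|lborel. indicator {0<..<1} z * WW (M z) (\<gamma> z) + indicator {0<..<1} z * aa)"
    by (intro Bochner_Integration.integral_cong) (auto split: split_indicator)
  also have "\<dots> = energy1 M \<gamma> + aa"
    unfolding Bochner_Integration.integral_add[OF iW ia] energy1_def by simp
  finally show "VV M \<gamma> 1 = energy1 M \<gamma> + aa" .
qed

text \<open>\<open>arcsin\<close> is differentiable only inside \<open>{-1<..<1}\<close>, so the
  curve must stay off the poles on the whole closed interval. It is applied with \<open>Psi\<close>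
  for the bound and with \<open>Phi\<close> for the equality case.\<close>

lemma AC_on_arcsin:
  assumes "AC_on a b s g" "\<And>z. z \<in> {a..b} \<Longrightarrow> \<bar>s z\<bar> < 1"
    and F: "\<And>x. (F has_real_derivative f x) (at x)" and f: "continuous_on UNIV f"
  shows "AC_on a b (\<lambda>z. F (arcsin (s z))) (\<lambda>z. f (arcsin (s z)) / sqrt (1 - (s z)\<^sup>2) * g z)"
proof (rule AC_on_real_chain[OF assms(1), where U = "{-1<..<1}" and F = "\<lambda>x. F (arcsin x)" and D = "\<lambda>x. f (arcsin x) / sqrt (1 - x\<^sup>2)"])
  show "s ` {a..b} \<subseteq> {-1<..<1}" using assms(2) by (auto simp: abs_less_iff)
  show "((\<lambda>x. F (arcsin x)) has_real_derivative f (arcsin x) / sqrt (1 - x\<^sup>2)) (at x)" if "x \<in> {-1<..<1}" for x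
    using DERIV_chain2[OF F DERIV_arcsin, of x] that by (simp add: divide_inverse)
  have "x\<^sup>2 < 1" if "x \<in> {-1<..<1}" for x :: real using that by (simp add: abs_square_less_1 abs_less_iff)
  then have ne: "sqrt (1 - x\<^sup>2) \<noteq> 0" if "x \<in> {-1<..<1}" for x :: real using that by force
  have "continuous_on {-1<..<1} (\<lambda>x. f (arcsin x))"
    by (rule continuous_on_compose2[OF f]) (auto intro!: continuous_on_arcsin continuous_on_id)
  then show "continuous_on {-1<..<1} (\<lambda>x. f (arcsin x) / sqrt (1 - x\<^sup>2))"
    by (intro continuous_intros) (use ne in auto)
qed auto

definition defect :: "real \<Rightarrow> real^3 \<Rightarrow> real^3 \<Rightarrow> real" where
  "defect \<sigma> v w = (\<sigma> * sqrt (ff (v$3)) * w$3 / sqrt (1 - (v$3)\<^sup>2) - sqrt (PP (v$3)))\<^sup>2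
     + gg (v$3) / (1 - (v$3)\<^sup>2) * (v$1 * w$2 - v$2 * w$1 - K2 * t * (1 - (v$3)\<^sup>2) / gg (v$3))\<^sup>2"

text \<open>The part of \<open>energy_identity\<close> linear in \<open>w$3\<close> is the
  derivative of \<open>2 * \<sigma> * Psi (arcsin (M z $ 3))\<close>; removing it from the
  accumulated energy leaves just the two squares.\<close>

lemma remainder_AC:
  assumes zc: "z_curve M \<gamma>" and b: "b \<le> 1" and lt: "\<And>z. z \<in> {0..b} \<Longrightarrow> \<bar>M z $ 3\<bar> < 1" and sg: "\<sigma>\<^sup>2 = 1"
  obtains r where "AC_on 0 b (\<lambda>z. VV M \<gamma> z - 2 * \<sigma> * Psi (arcsin (M z $ 3))) r"
    "AE z in lborel. z \<in> {0<..<b} \<longrightarrow> r z = defect \<sigma> (M z) (\<gamma> z)"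
proof -
  have AC: "AC_on 0 1 M \<gamma>" and n: "\<And>z. z \<in> {0..1} \<Longrightarrow> norm (M z) = 1" using zc by (auto simp: z_curve_def)
  have s: "AC_on 0 b (\<lambda>z. M z $ 3) (\<lambda>z. \<gamma> z $ 3)"
    by (rule AC_on_linear[OF AC_on_subinterval[OF AC order_refl b] bounded_linear_vec_nth])
  from AC_on_diff[OF AC_on_subinterval[OF VV_AC(1)[OF zc] order_refl b] AC_on_cmult[OF AC_on_arcsin[OF s lt Psi_deriv EE_continuous], of "2 * \<sigma>"]]
  show ?thesis
  proof (rule that)
    show "AE z in lborel. z \<in> {0<..<b} \<longrightarrow>
      indicator {0<..<1} z * (WW (M z) (\<gamma> z) + aa) - 2 * \<sigma> * (EE (arcsin (M z $ 3)) / sqrt (1 - (M z $ 3)\<^sup>2) * \<gamma> z $ 3) = defect \<sigma> (M z) (\<gamma> z)"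
      using z_curve_orthogonal[OF zc]
    proof (eventually_elim, intro impI)
      fix z assume o: "z \<in> {0<..<1} \<longrightarrow> M z \<bullet> \<gamma> z = 0" and z: "z \<in> {0<..<b}"
      have l: "\<bar>M z $ 3\<bar> < 1" using lt z by auto
      then have "(M z $ 3)\<^sup>2 \<le> 1" by (simp add: abs_square_le_1)
      then have r2: "(sqrt (1 - (M z $ 3)\<^sup>2))\<^sup>2 = 1 - (M z $ 3)\<^sup>2" by simp
      have e: "EE (arcsin (M z $ 3)) = sqrt (ff (M z $ 3) * PP (M z $ 3))" using l by (simp add: EE_def)
      have "WW (M z) (\<gamma> z) + aa = 2 * \<sigma> * sqrt (ff (M z $ 3) * PP (M z $ 3)) * \<gamma> z $ 3 / sqrt (1 - (M z $ 3)\<^sup>2) + defect \<sigma> (M z) (\<gamma> z)"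
        using energy_identity[OF n[of z] _ l sg, of "\<gamma> z"] o z b unfolding defect_def r2 by auto
      then show "indicator {0<..<1} z * (WW (M z) (\<gamma> z) + aa) - 2 * \<sigma> * (EE (arcsin (M z $ 3)) / sqrt (1 - (M z $ 3)\<^sup>2) * \<gamma> z $ 3) = defect \<sigma> (M z) (\<gamma> z)"
        unfolding e using z b by simp
    qed
  qed
qed

lemma defect_nonneg: "\<bar>v $ 3\<bar> < 1 \<Longrightarrow> 0 \<le> defect \<sigma> v w"
  using gg_pos[of "v $ 3"] by (auto simp: defect_def abs_square_le_1 intro!: add_nonneg_nonneg mult_nonneg_nonneg divide_nonneg_nonneg)

text \<open>The accumulated energy minus the price of the angle covered so far starts at 0 and
  cannot decrease before the first pole. The equality clauses stop at \<open>b < 1\<close> because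
  \<open>defect\<close> divides by \<open>1 - (v$3)\<^sup>2\<close>, which vanishes at the
  top.\<close>

lemma energy_lower_bound:
  assumes zc: "z_curve M \<gamma>"
  shows "min_energy \<le> energy1 M \<gamma>"
    and "energy1 M \<gamma> = min_energy \<Longrightarrow> b < 1 \<Longrightarrow> z \<in> {0..b} \<Longrightarrow> \<bar>M z $ 3\<bar> < 1"
    and "energy1 M \<gamma> = min_energy \<Longrightarrow> b < 1 \<Longrightarrow> AE z in lborel. z \<in> {0<..<b} \<longrightarrow> defect 1 (M z) (\<gamma> z) = 0"
proof -
  have AC: "AC_on 0 1 M \<gamma>" and n: "\<And>z. z \<in> {0..1} \<Longrightarrow> norm (M z) = 1" and M01: "M 0 = axis 1 1" "M 1 = axis 3 1"
    using zc by (auto simp: z_curve_def)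
  define s where "s z = M z $ 3" for z
  have sc: "continuous_on {0..1} s" unfolding s_def using AC_on_continuous[OF AC] by (intro continuous_intros)
  have s01: "s 0 = 0" "s 1 = 1" by (simp_all add: s_def M01 axis_def)
  have sle: "\<bar>s z\<bar> \<le> 1" if "z \<in> {0..1}" for z
    using component_le_norm_cart[of "M z" 3] n[OF that] by (simp add: s_def)
  define S where "S = {z \<in> {0..1}. \<bar>s z\<bar> = 1}"
  have "closed S" unfolding S_def
    by (intro continuous_closed_preimage_constant continuous_intros sc)
  moreover have S1: "1 \<in> S" by (simp add: S_def s01)
  moreover have bdd: "bdd_below S" by (rule bdd_belowI[of _ 0]) (simp add: S_def)
  ultimately have zS: "Inf S \<in> S" by (intro closed_contains_Inf) auto
  \<comment> \<open>The first height at which a pole is met; \<sigma> below is the vertical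
    component there, so it tells which pole it is.\<close>
  define y where "y = Inf S"
  have y: "y \<in> {0..1}" "\<bar>s y\<bar> = 1" using zS by (auto simp: y_def S_def)
  then have y0: "0 < y" using s01(1) by (cases "y = 0") auto
  have lt: "\<bar>s z\<bar> < 1" if "z \<in> {0..<y}" for z
  proof -
    have "z \<notin> S" using cInf_lower[OF _ bdd, of z] that by (auto simp: y_def)
    then show ?thesis using sle[of z] that y(1) by (auto simp: S_def)
  qed
  define \<sigma> where "\<sigma> = s y"
  have sg: "\<sigma>\<^sup>2 = 1" using y(2) by (simp add: \<sigma>_def power2_eq_1_iff abs_if split: if_splits)
  define R where "R z = VV M \<gamma> z - 2 * \<sigma> * Psi (arcsin (s z))" for z
  have Rmono: "R p \<le> R q" if "0 \<le> p" "p \<le> q" "q < y" for p q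
  proof -
    have l: "\<bar>M z $ 3\<bar> < 1" if "z \<in> {0..q}" for z using lt[of z] that \<open>q < y\<close> by (auto simp: s_def)
    have "q \<le> 1" using that y by auto
    from remainder_AC[OF zc this l sg] obtain r where r: "AC_on 0 q (\<lambda>z. VV M \<gamma> z - 2 * \<sigma> * Psi (arcsin (M z $ 3))) r"
      "AE z in lborel. z \<in> {0<..<q} \<longrightarrow> r z = defect \<sigma> (M z) (\<gamma> z)"
      by blast
    show ?thesis unfolding R_def s_def
    proof (rule AC_on_mono[OF r(1) _ that(1,2) order_refl])
      show "AE z in lborel. z \<in> {0<..<q} \<longrightarrow> 0 \<le> r z"
        using r(2) by eventually_elim (use lt \<open>q < y\<close> in \<open>auto simp: s_def intro!: defect_nonneg\<close>)
    qed
  qed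
  have Rc: "continuous_on {0..y} R"
  proof -
    have PC: "continuous_on UNIV Psi" using DERIV_isCont[OF Psi_deriv] by (auto intro!: continuous_at_imp_continuous_on)
    have sc': "continuous_on {0..y} s" by (rule continuous_on_subset[OF sc]) (use y in auto)
    have "continuous_on {0..y} (\<lambda>z. arcsin (s z))"
      by (rule continuous_on_arcsin[OF sc']) (use sle y in \<open>force simp: abs_le_iff\<close>)
    then have "continuous_on {0..y} (\<lambda>z. Psi (arcsin (s z)))" by (rule continuous_on_compose2[OF PC]) auto
    moreover have "continuous_on {0..y} (VV M \<gamma>)"
      by (rule continuous_on_subset[OF AC_on_continuous[OF VV_AC(1)[OF zc]]]) (use y in auto)
    ultimately show ?thesis unfolding R_def by (intro continuous_intros)
  qed
  \<comment> \<open>The chain rule fails at the pole itself, so monotonicity is available only below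
    \<open>y\<close>; continuity of \<open>R\<close> carries the inequality to
    \<open>y\<close>.\<close>
  have Ry: "R p \<le> R y" if "p \<in> {0..<y}" for p
  proof -
    have cl: "closure {p..<y} = {p..y}" using that by (intro closure_atLeastLessThan) auto
    show ?thesis
    proof (rule continuous_ge_on_closure[of "{p..<y}" R y "R p"])
      show "continuous_on (closure {p..<y}) R" unfolding cl by (rule continuous_on_subset[OF Rc]) (use that in auto)
      show "y \<in> closure {p..<y}" unfolding cl using that by auto
    qed (use that in \<open>auto intro: Rmono\<close>)
  qed
  have R0: "R 0 = 0" using VV_AC(2)[OF zc] by (simp add: R_def s01 Psi_0)
  have "\<sigma> = 1 \<or> \<sigma> = -1" using sg by (simp add: power2_eq_1_iff)
  then have Ry_eq: "R y = VV M \<gamma> y - 2 * Psi (pi / 2)"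
    by (auto simp: R_def \<sigma>_def[symmetric] Psi_minus)
  \<comment> \<open>The unshifted density is nonnegative, so above the pole each unit of height
    still costs at least \<open>aa\<close>.\<close>
  have Vy: "aa * (1 - y) \<le> VV M \<gamma> 1 - VV M \<gamma> y"
  proof -
    have l: "AC_on 0 1 (\<lambda>z. aa * z) (\<lambda>_. aa)"
      by (rule AC_on_C1) (auto intro!: derivative_eq_intros simp: has_real_derivative_iff_has_vector_derivative[symmetric])
    have "VV M \<gamma> y - aa * y \<le> VV M \<gamma> 1 - aa * 1"
      by (rule AC_on_mono[OF AC_on_diff[OF VV_AC(1)[OF zc] l]]) (use y K in \<open>auto simp: W1_def intro!: AE_I2\<close>)
    then show ?thesis by (simp add: algebra_simps)
  qed
  have Ry0: "0 \<le> R y" using Ry[of 0] y0 R0 by simp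
  have aa: "aa > 0" using C by simp
  have "0 \<le> aa * (1 - y)" using aa y by simp
  then show lower: "min_energy \<le> energy1 M \<gamma>"
    using Ry0 Vy VV_AC(3)[OF zc] unfolding min_energy_def Ry_eq by linarith
  {
    assume eq: "energy1 M \<gamma> = min_energy"
    \<comment> \<open>Equality leaves nothing to pay for the part above the pole; hence the first
      pole is met at the top, where the boundary value makes it the north pole.\<close>
    have "aa * (1 - y) \<le> 0"
      using Ry0 Vy VV_AC(3)[OF zc] eq unfolding min_energy_def Ry_eq by linarith
    then have y1: "y = 1" using aa y by (simp add: mult_le_0_iff)
    then have s1: "\<sigma> = 1" by (simp add: \<sigma>_def s01)
    have "R 1 = 0" using VV_AC(3)[OF zc] eq Ry_eq unfolding y1 min_energy_def by simp
    then have Rz: "R z = 0" if "z \<in> {0..<1}" for z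
      using Rmono[of 0 z] Ry[of z] that R0 y1 by auto
    show lt': "\<bar>M z $ 3\<bar> < 1" if "b < 1" "z \<in> {0..b}" for b z
      using lt[of z] that y1 by (auto simp: s_def)
    show "AE z in lborel. z \<in> {0<..<b} \<longrightarrow> defect 1 (M z) (\<gamma> z) = 0" if b: "b < 1" for b
    proof -
      from remainder_AC[OF zc less_imp_le[OF b] lt'[OF b] sg] obtain r where r: "AC_on 0 b (\<lambda>z. VV M \<gamma> z - 2 * \<sigma> * Psi (arcsin (M z $ 3))) r"
        "AE z in lborel. z \<in> {0<..<b} \<longrightarrow> r z = defect \<sigma> (M z) (\<gamma> z)"
        by blast
      have "AE z in lborel. z \<in> {0<..<b} \<longrightarrow> r z = 0"
        by (rule AC_on_const_imp_zero[OF r(1), of 0]) (use Rz b in \<open>auto simp: R_def s_def\<close>)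
      then show ?thesis using r(2) unfolding s1 by eventually_elim auto
    qed
  }
qed

lemma defect_eq_0:
  assumes "\<bar>v $ 3\<bar> < 1" "defect 1 v w = 0"
  shows "sqrt (ff (v$3)) * w$3 / sqrt (1 - (v$3)\<^sup>2) = sqrt (PP (v$3))"
    and "v$1 * w$2 - v$2 * w$1 = K2 * t * (1 - (v$3)\<^sup>2) / gg (v$3)"
proof -
  have g: "gg (v$3) / (1 - (v$3)\<^sup>2) > 0" using gg_pos[of "v$3"] assms(1) by (simp add: abs_square_less_1)
  have sum0: "x\<^sup>2 + k * y\<^sup>2 = 0 \<Longrightarrow> k > 0 \<Longrightarrow> x = 0 \<and> y = 0" for x y k :: real
    using add_nonneg_eq_0_iff[of "x\<^sup>2" "k * y\<^sup>2"] by auto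
  from sum0[OF assms(2)[unfolded defect_def] g]
  show "sqrt (ff (v$3)) * w$3 / sqrt (1 - (v$3)\<^sup>2) = sqrt (PP (v$3))"
    "v$1 * w$2 - v$2 * w$1 = K2 * t * (1 - (v$3)\<^sup>2) / gg (v$3)" by auto
qed

end

section \<open>The minimising profile\<close>

locale profile = frank +
  fixes th ph :: "real \<Rightarrow> real"
  assumes C_eq: "integral {0..pi/2} FF = 1"
    and th_range: "\<And>z. z \<in> {0..1} \<Longrightarrow> th z \<in> {0..pi/2}"
    and th_eq: "\<And>z. z \<in> {0..1} \<Longrightarrow> integral {0..th z} FF = z"
    and ph_deriv: "\<And>z. z \<in> {0..1} \<Longrightarrow> (ph has_real_derivative K2 * t / gg (sin (th z))) (at z within {0..1})"
    and ph_0: "ph 0 = 0"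
begin

lemma Phi_th: "z \<in> {0..1} \<Longrightarrow> Phi (th z) = z"
  using integral_FF[of "th z"] th_range[of z] th_eq[of z] by simp

lemma Phi_pi_half: "Phi (pi / 2) = 1"
  using integral_FF[of "pi / 2"] C_eq by simp

lemma th_0: "th 0 = 0" and th_1: "th 1 = pi / 2"
  using Phi_th[of 0] Phi_th[of 1] Phi_0 Phi_pi_half Phi_inj[of "th 0" 0] Phi_inj[of "th 1" "pi / 2"] by auto

text \<open>No regularity of \<open>th\<close> is assumed. On \<open>{0..1}\<close> it inverts
  \<open>Phi\<close>, which is continuous and injective on the compact interval of angles, and such
  an inverse is continuous.\<close>

lemma th_continuous: "continuous_on {0..1} th"
proof -
  have c: "continuous_on S Phi" for S using DERIV_isCont[OF Phi_deriv] by (auto intro!: continuous_at_imp_continuous_on)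
  have mono: "Phi x \<le> Phi y" if "x \<le> y" for x y using Phi_less[of x y] that by (cases "x = y") auto
  have inv: "th (Phi x) = x" if "x \<in> {0..pi/2}" for x
    using Phi_th[of "Phi x"] mono[of 0 x] mono[of x "pi / 2"] that Phi_0 Phi_pi_half Phi_inj by auto
  have "continuous_on (Phi ` {0..pi/2}) th" by (rule continuous_on_inv[OF c]) (use inv in auto)
  moreover have "{0..1} \<subseteq> Phi ` {0..pi/2}"
  proof
    fix z :: real assume "z \<in> {0..1}"
    then show "z \<in> Phi ` {0..pi/2}" using Phi_th[of z] th_range[of z] by (intro image_eqI[of _ _ "th z"]) auto
  qed
  ultimately show ?thesis by (rule continuous_on_subset)
qed

lemma th_interior: "0 < z \<Longrightarrow> z < 1 \<Longrightarrow> 0 < th z" "0 \<le> z \<Longrightarrow> z < 1 \<Longrightarrow> th z < pi / 2"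
proof -
  show "0 < th z" if "0 < z" "z < 1"
    using th_range[of z] Phi_th[of z] Phi_0 that by (cases "th z = 0") auto
  show "th z < pi / 2" if "0 \<le> z" "z < 1"
    using th_range[of z] Phi_th[of z] Phi_pi_half that by (cases "th z = pi / 2") auto
qed

text \<open>\<open>th\<close> is controlled on \<open>{0..1}\<close> only, so the inverse function
  rule works inside; continuity of \<open>th\<close> and of the candidate derivative takes care of
  the endpoints.\<close>

lemma th_AC: "AC_on 0 1 th (\<lambda>z. inverse (FF (th z)))"
proof (rule AC_on_interior_derivative[OF th_continuous])
  have "continuous_on {0..1} (\<lambda>z. FF (th z))" by (rule continuous_on_compose2[OF FF_continuous[of UNIV] th_continuous]) auto
  then show "continuous_on {0..1} (\<lambda>z. inverse (FF (th z)))"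
    by (intro continuous_intros) (use FF_pos in \<open>auto simp: less_imp_neq[symmetric] intro: less_imp_neq[THEN not_sym]\<close>)
  fix z :: real assume z: "z \<in> {0<..<1}"
  show "(th has_real_derivative inverse (FF (th z))) (at z)"
  proof (rule DERIV_inverse_function[OF Phi_deriv, of _ _ 0 1])
    show "isCont th z" using continuous_on_interior[OF th_continuous, of z] z by simp
    show "FF (th z) \<noteq> 0" using FF_pos[of "th z"] by simp
  qed (use z Phi_th in auto)
qed

lemma gg_sin_th_continuous: "continuous_on {0..1} (\<lambda>z. K2 * t / gg (sin (th z)))"
proof -
  have "continuous_on {0..1} (\<lambda>z. gg (sin (th z)))" unfolding gg_def by (intro continuous_intros th_continuous)
  then show ?thesis
  proof (intro continuous_intros ballI)
    show "gg (sin (th z)) \<noteq> 0" for z using gg_pos[of "sin (th z)"] by simp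
  qed
qed

lemma ph_AC: "AC_on 0 1 ph (\<lambda>z. K2 * t / gg (sin (th z)))"
  by (rule AC_on_C1) (use ph_deriv gg_sin_th_continuous in \<open>auto simp: has_real_derivative_iff_has_vector_derivative\<close>)

section \<open>Rigidity in the equality case\<close>

definition director :: "real \<Rightarrow> real^3" where
  "director z = vector [cos (ph z) * cos (th z), sin (ph z) * cos (th z), sin (th z)]"

lemma director_nth [simp]:
  "director z $ 1 = cos (ph z) * cos (th z)" "director z $ 2 = sin (ph z) * cos (th z)" "director z $ 3 = sin (th z)"
  by (simp_all add: director_def)

lemma norm_director: "norm (director z) = 1"
proof -
  have "(cos (ph z) * cos (th z))\<^sup>2 + (sin (ph z) * cos (th z))\<^sup>2 + (sin (th z))\<^sup>2 = 1"
    by (simp add: power_mult_distrib sin_squared_eq algebra_simps)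
  then show ?thesis by (simp add: norm_vec_def L2_set_def sum_3)
qed

text \<open>The first square gives \<open>Phi (arcsin (M x $ 3))\<close> the slope 1, so the polar
  angle is \<open>th\<close>. The azimuth of \<open>M\<close> is never lifted: the horizontal part
  of \<open>M\<close>, normalised to length 1, is projected on the direction with the prescribed
  angle \<open>ph\<close>. The second square makes this projection constant; its value at 0 is 1,
  the largest possible, so the directions coincide.\<close>

lemma equality_case:
  assumes zc: "z_curve M \<gamma>" and eq: "energy1 M \<gamma> = min_energy" and z: "z \<in> {0..<1}"
  shows "M z = director z"
proof -
  have AC: "AC_on 0 1 M \<gamma>" and n: "\<And>z. z \<in> {0..1} \<Longrightarrow> norm (M z) = 1" and M0: "M 0 = axis 1 1"
    using zc by (auto simp: z_curve_def)
  have z1: "z < 1" "0 \<le> z" "z \<le> 1" using z by auto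
  have lt: "\<bar>M x $ 3\<bar> < 1" if "x \<in> {0..z}" for x using energy_lower_bound(2)[OF zc eq z1(1) that] .
  have d0: "AE x in lborel. x \<in> {0<..<z} \<longrightarrow> defect 1 (M x) (\<gamma> x) = 0" using energy_lower_bound(3)[OF zc eq z1(1)] .
  have M: "AC_on 0 z (\<lambda>x. M x $ k) (\<lambda>x. \<gamma> x $ k)" for k
    by (rule AC_on_linear[OF AC_on_subinterval[OF AC order_refl z1(3)] bounded_linear_vec_nth])
  have idc: "AC_on 0 z (\<lambda>x. x) (\<lambda>_. 1 :: real)"
    by (rule AC_on_C1) (auto intro!: derivative_eq_intros simp: has_real_derivative_iff_has_vector_derivative[symmetric])
  have sin_th: "M x $ 3 = sin (th x)" if x: "x \<in> {0..z}" for x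
  proof -
    have "Phi (arcsin (M x $ 3)) - x = Phi (arcsin (M 0 $ 3)) - 0"
    proof (rule AC_on_const[OF AC_on_diff[OF AC_on_arcsin[OF M lt Phi_deriv FF_continuous] idc]])
      show "AE x in lborel. x \<in> {0<..<z} \<longrightarrow> FF (arcsin (M x $ 3)) / sqrt (1 - (M x $ 3)\<^sup>2) * \<gamma> x $ 3 - 1 = 0"
        using d0
      proof (eventually_elim, intro impI)
        fix x assume d: "x \<in> {0<..<z} \<longrightarrow> defect 1 (M x) (\<gamma> x) = 0" and x: "x \<in> {0<..<z}"
        have l: "\<bar>M x $ 3\<bar> < 1" using lt x by auto
        have "FF (arcsin (M x $ 3)) / sqrt (1 - (M x $ 3)\<^sup>2) * \<gamma> x $ 3
            = (sqrt (ff (M x $ 3)) * \<gamma> x $ 3 / sqrt (1 - (M x $ 3)\<^sup>2)) / sqrt (PP (M x $ 3))"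
          unfolding FF_eq using l by (simp add: field_simps)
        also have "sqrt (ff (M x $ 3)) * \<gamma> x $ 3 / sqrt (1 - (M x $ 3)\<^sup>2) = sqrt (PP (M x $ 3))"
          using defect_eq_0(1)[OF l] d x by blast
        also have "sqrt (PP (M x $ 3)) / sqrt (PP (M x $ 3)) = 1" using PP_pos[of "M x $ 3"] l by simp
        finally show "FF (arcsin (M x $ 3)) / sqrt (1 - (M x $ 3)\<^sup>2) * \<gamma> x $ 3 - 1 = 0" by linarith
      qed
    qed (use x in auto)
    then have "Phi (arcsin (M x $ 3)) = Phi (th x)" using M0 Phi_th[of x] x z by (simp add: axis_def Phi_0)
    then have "arcsin (M x $ 3) = th x" by (simp add: Phi_inj)
    then show ?thesis using lt[OF x] by (metis abs_less_iff less_imp_le minus_less_iff sin_arcsin)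
  qed
  \<comment> \<open>The reciprocal of cos \<theta>, which normalises the horizontal part of
    \<open>M\<close>.\<close>
  let ?\<kappa> = "\<lambda>x. inverse (sqrt (1 - (M x $ 3)\<^sup>2))"
  have \<kappa>: "AC_on 0 z ?\<kappa> (\<lambda>x. (M x $ 3 * ?\<kappa> x ^ 3) * \<gamma> x $ 3)"
  proof (rule AC_on_real_chain[OF M, where U = "{-1<..<1}" and F = "\<lambda>s. inverse (sqrt (1 - s\<^sup>2))" and D = "\<lambda>s. s * inverse (sqrt (1 - s\<^sup>2)) ^ 3"])
    show "(\<lambda>x. M x $ 3) ` {0..z} \<subseteq> {-1<..<1}" using lt by (auto simp: abs_less_iff)
    have p: "0 < 1 - s\<^sup>2" if "s \<in> {-1<..<1}" for s :: real using that by (simp add: abs_square_less_1 abs_less_iff)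
    show "((\<lambda>s. inverse (sqrt (1 - s\<^sup>2))) has_real_derivative s * inverse (sqrt (1 - s\<^sup>2)) ^ 3) (at s)" if "s \<in> {-1<..<1}" for s
      using p[OF that] by (auto intro!: derivative_eq_intros simp: field_simps power2_eq_square power3_eq_cube)
    show "continuous_on {-1<..<1} (\<lambda>s::real. s * inverse (sqrt (1 - s\<^sup>2)) ^ 3)"
      by (intro continuous_intros) (use p in force)
  qed auto
  note phz = AC_on_subinterval[OF ph_AC order_refl z1(3)]
  note X = AC_on_mult[OF AC_on_add[OF AC_on_mult[OF M[of 1] AC_on_sin_cos(2)[OF phz]] AC_on_mult[OF M[of 2] AC_on_sin_cos(1)[OF phz]]] \<kappa>]
  have "(M z $ 1 * cos (ph z) + M z $ 2 * sin (ph z)) * ?\<kappa> z = (M 0 $ 1 * cos (ph 0) + M 0 $ 2 * sin (ph 0)) * ?\<kappa> 0"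
  proof (rule AC_on_const[OF X])
    let ?p = "\<lambda>x. K2 * t / gg (sin (th x))"
    have "AE x in lborel. x \<in> {0<..<z} \<longrightarrow> M x \<bullet> \<gamma> x = 0"
      using z_curve_orthogonal[OF zc] by eventually_elim (use z in auto)
    then show "AE x in lborel. x \<in> {0<..<z} \<longrightarrow>
       ((\<gamma> x $ 1 * cos (ph x) + M x $ 1 * (- sin (ph x) * ?p x)) + (\<gamma> x $ 2 * sin (ph x) + M x $ 2 * (cos (ph x) * ?p x))) * ?\<kappa> x
        + (M x $ 1 * cos (ph x) + M x $ 2 * sin (ph x)) * ((M x $ 3 * ?\<kappa> x ^ 3) * \<gamma> x $ 3) = 0"
      using d0
    proof (eventually_elim, intro impI)
      fix x assume o: "x \<in> {0<..<z} \<longrightarrow> M x \<bullet> \<gamma> x = 0" and d: "x \<in> {0<..<z} \<longrightarrow> defect 1 (M x) (\<gamma> x) = 0" and x: "x \<in> {0<..<z}"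
      have l: "\<bar>M x $ 3\<bar> < 1" using lt x by auto
      define r where "r = 1 - (M x $ 3)\<^sup>2"
      have r: "r > 0" using l by (simp add: r_def abs_square_less_1)
      define k where "k = inverse (sqrt r)"
      have k2: "r * k\<^sup>2 = 1" using r by (simp add: k_def power_inverse)
      define A where "A = M x $ 1 * \<gamma> x $ 2 - M x $ 2 * \<gamma> x $ 1"
      have r12: "r = (M x $ 1)\<^sup>2 + (M x $ 2)\<^sup>2"
        using n[of x] x z by (simp add: r_def norm_vec_def L2_set_def sum_3 real_sqrt_eq_1_iff)
      have o': "M x $ 1 * \<gamma> x $ 1 + M x $ 2 * \<gamma> x $ 2 = - M x $ 3 * \<gamma> x $ 3"
        using o x by (simp add: inner_vec_def sum_3)
      have "A = K2 * t * r / gg (M x $ 3)" using defect_eq_0(2)[OF l] d x by (simp add: A_def r_def)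
      then have pA: "r * ?p x = A" using sin_th[of x] x by simp
      \<comment> \<open>The horizontal part of \<gamma> is decomposed along
        \<open>(M x $ 1, M x $ 2)\<close> and its rotation by a right angle. Orthogonality to
        \<open>M x\<close> gives the first coefficient, the vanishing second square gives the
        other.\<close>
      have g1: "r * \<gamma> x $ 1 = - M x $ 3 * \<gamma> x $ 3 * M x $ 1 - M x $ 2 * A"
        unfolding o'[symmetric] r12 A_def by (simp add: power2_eq_square algebra_simps)
      have g2: "r * \<gamma> x $ 2 = - M x $ 3 * \<gamma> x $ 3 * M x $ 2 + M x $ 1 * A"
        unfolding o'[symmetric] r12 A_def by (simp add: power2_eq_square algebra_simps)
      let ?L = "((\<gamma> x $ 1 * cos (ph x) + M x $ 1 * (- sin (ph x) * ?p x)) + (\<gamma> x $ 2 * sin (ph x) + M x $ 2 * (cos (ph x) * ?p x)))"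
      let ?Q = "M x $ 1 * cos (ph x) + M x $ 2 * sin (ph x)"
      have "r * ?L = (r * \<gamma> x $ 1) * cos (ph x) - M x $ 1 * sin (ph x) * (r * ?p x) + (r * \<gamma> x $ 2) * sin (ph x) + M x $ 2 * cos (ph x) * (r * ?p x)"
        by (simp add: algebra_simps)
      also have "\<dots> = - ?Q * (M x $ 3 * \<gamma> x $ 3)"
        unfolding g1 g2 pA by (simp add: algebra_simps)
      finally have rL0: "r * ?L = - ?Q * (M x $ 3 * \<gamma> x $ 3)" .
      have rL: "r * ?L + ?Q * (M x $ 3 * \<gamma> x $ 3) = 0" unfolding rL0 by algebra
      \<comment> \<open>The inserted factor \<open>r * k\<^sup>2 = 1\<close> makes both summands
        multiples of \<open>k ^ 3\<close>.\<close>
      have "?L * k + ?Q * ((M x $ 3 * k ^ 3) * \<gamma> x $ 3) = (r * k\<^sup>2) * ?L * k + ?Q * ((M x $ 3 * k ^ 3) * \<gamma> x $ 3)"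
        unfolding k2 by simp
      also have "\<dots> = k ^ 3 * (r * ?L + ?Q * (M x $ 3 * \<gamma> x $ 3))"
        by (simp only: power2_eq_square power3_eq_cube) algebra
      finally have "?L * k + ?Q * ((M x $ 3 * k ^ 3) * \<gamma> x $ 3) = 0" unfolding rL by (simp only: mult_zero_right)
      then show "?L * ?\<kappa> x + ?Q * ((M x $ 3 * ?\<kappa> x ^ 3) * \<gamma> x $ 3) = 0"
        unfolding k_def r_def .
    qed
  qed (use z in auto)
  then have X1: "(M z $ 1 * cos (ph z) + M z $ 2 * sin (ph z)) * ?\<kappa> z = 1"
    by (simp add: M0 axis_def ph_0)
  have zz: "z \<in> {0..z}" using z by simp
  have cp: "cos (th z) > 0" using th_interior(2)[of z] th_range[of z] z by (intro cos_gt_zero_pi) auto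
  have r: "sqrt (1 - (M z $ 3)\<^sup>2) = cos (th z)"
    unfolding sin_th[OF zz] using cp by (simp add: cos_squared_eq[symmetric])
  have Q: "M z $ 1 * cos (ph z) + M z $ 2 * sin (ph z) = cos (th z)" using X1 cp unfolding r by (simp add: field_simps)
  have "(M z $ 1)\<^sup>2 + (M z $ 2)\<^sup>2 = (cos (th z))\<^sup>2"
    using n[of z] z sin_th[OF zz] by (simp add: norm_vec_def L2_set_def sum_3 cos_squared_eq real_sqrt_eq_1_iff)
  \<comment> \<open>Pythagoras in the frame turned by \<open>ph z\<close>: the first component
    already has the full length \<open>cos (th z)\<close>, so the transverse one must
    vanish.\<close>
  moreover have "(M z $ 1)\<^sup>2 + (M z $ 2)\<^sup>2 = (M z $ 1 * cos (ph z) + M z $ 2 * sin (ph z))\<^sup>2 + (M z $ 2 * cos (ph z) - M z $ 1 * sin (ph z))\<^sup>2"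
    using sin_cos_squared_add[of "ph z"] by algebra
  ultimately have "M z $ 2 * cos (ph z) - M z $ 1 * sin (ph z) = 0" unfolding Q by simp
  then have "M z $ 1 = cos (ph z) * cos (th z)" "M z $ 2 = sin (ph z) * cos (th z)"
    using Q sin_cos_squared_add[of "ph z"] by algebra+
  then show ?thesis using sin_th[OF zz] by (simp add: vec_eq_iff forall_3)
qed

section \<open>The director as a competitor\<close>

definition director_deriv :: "real \<Rightarrow> real^3" where
  "director_deriv z = (let p = K2 * t / gg (sin (th z)); q = inverse (FF (th z)) in
     vector [- sin (ph z) * p * cos (th z) + cos (ph z) * (- sin (th z) * q),
             cos (ph z) * p * cos (th z) + sin (ph z) * (- sin (th z) * q),
             cos (th z) * q])"

lemma ph_continuous: "continuous_on {0..1} ph"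
  by (rule AC_on_continuous[OF ph_AC])

lemma director_AC: "AC_on 0 1 director director_deriv"
proof (rule AC_on_vec)
  fix k :: 3
  have "AC_on 0 1 (\<lambda>z. director z $ 1) (\<lambda>z. director_deriv z $ 1)"
    "AC_on 0 1 (\<lambda>z. director z $ 2) (\<lambda>z. director_deriv z $ 2)"
    "AC_on 0 1 (\<lambda>z. director z $ 3) (\<lambda>z. director_deriv z $ 3)"
    using AC_on_mult[OF AC_on_sin_cos(2)[OF ph_AC] AC_on_sin_cos(2)[OF th_AC]]
      AC_on_mult[OF AC_on_sin_cos(1)[OF ph_AC] AC_on_sin_cos(2)[OF th_AC]] AC_on_sin_cos(1)[OF th_AC]
    by (simp_all add: director_deriv_def Let_def)
  then show "AC_on 0 1 (\<lambda>z. director z $ k) (\<lambda>z. director_deriv z $ k)"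
    using exhaust_3[of k] by auto
qed

lemma director_deriv_continuous: "continuous_on {0..1} director_deriv"
proof -
  have "continuous_on {0..1} (\<lambda>z. FF (th z))" by (rule continuous_on_compose2[OF FF_continuous[of UNIV] th_continuous]) auto
  then have "continuous_on {0..1} (\<lambda>z. inverse (FF (th z)))"
    by (intro continuous_intros) (use FF_pos in \<open>auto simp: less_imp_neq[symmetric] intro: less_imp_neq[THEN not_sym]\<close>)
  moreover have "continuous_on {0..1} (\<lambda>z. vector [- sin (ph z) * p z * cos (th z) + cos (ph z) * (- sin (th z) * q z),
       cos (ph z) * p z * cos (th z) + sin (ph z) * (- sin (th z) * q z), cos (th z) * q z] :: real^3)"
    if "continuous_on {0..1} p" "continuous_on {0..1} q" for p q
    by (intro continuous_intros th_continuous ph_continuous that)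
  ultimately show ?thesis unfolding director_deriv_def Let_def using gg_sin_th_continuous by blast
qed

text \<open>The hypotheses constrain \<open>th\<close> and \<open>ph\<close> only on \<open>{0..1}\<close>, so measurability on the whole
  line requires a modification outside.\<close>

definition ext_director :: "real \<Rightarrow> real^3" where
  "ext_director z = director (max 0 (min 1 z))"

definition ext_director_deriv :: "real \<Rightarrow> real^3" where
  "ext_director_deriv z = indicator {0..1} z *\<^sub>R director_deriv z"

lemma ext_director_eq: "z \<in> {0..1} \<Longrightarrow> ext_director z = director z"
  and ext_director_deriv_eq: "z \<in> {0..1} \<Longrightarrow> ext_director_deriv z = director_deriv z"
  by (auto simp: ext_director_def ext_director_deriv_def)

lemma z_curve_ext_director: "z_curve ext_director ext_director_deriv"
  unfolding z_curve_def
proof (intro conjI ballI allI)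
  show "AC_on 0 1 ext_director ext_director_deriv"
    by (rule AC_on_cong[OF director_AC]) (simp_all add: ext_director_eq ext_director_deriv_eq)
  have cl: "continuous_on UNIV (\<lambda>z::real. max 0 (min 1 z))" by (intro continuous_intros)
  have "continuous_on UNIV ext_director" unfolding ext_director_def
    by (rule continuous_on_compose2[OF AC_on_continuous[OF director_AC] cl]) auto
  then show "ext_director \<in> borel_measurable borel" by (rule borel_measurable_continuous_onI)
  show m: "ext_director_deriv \<in> borel_measurable borel" unfolding ext_director_deriv_def
    by (rule borel_measurable_continuous_on_indicator[OF _ director_deriv_continuous]) simp
  show "ext_director 0 = axis 1 1" "ext_director 1 = axis 3 1"
    by (simp_all add: ext_director_def vec_eq_iff forall_3 th_0 th_1 ph_0 axis_def)
  show "norm (ext_director z) = 1" for z by (simp add: ext_director_def norm_director)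
  fix k :: 3
  have "(\<lambda>z. ext_director_deriv z $ k) \<in> borel_measurable borel"
    using m unfolding borel_measurable_vec_nth by blast
  then have "(\<lambda>z. (ext_director_deriv z $ k)\<^sup>2) \<in> borel_measurable borel"
    by (rule borel_measurable_power)
  moreover have "continuous_on {0..1} (\<lambda>z. (director_deriv z $ k)\<^sup>2)"
    by (intro continuous_intros director_deriv_continuous)
  then have "continuous_on {0..1} (\<lambda>z. (ext_director_deriv z $ k)\<^sup>2)"
    by (rule continuous_on_eq) (simp add: ext_director_deriv_eq)
  ultimately show "integrable lborel (\<lambda>z. indicator {0<..<1} z * (ext_director_deriv z $ k)\<^sup>2)"
    by (intro LINT_Ioo_eq_integral(2) absolutely_integrable_continuous_real)
qed

text \<open>Along the director both squares of \<open>energy_identity\<close> vanish, and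
  \<open>sqrt (ff (sin (th z))) * q = sqrt (PP (sin (th z)))\<close> turns the remaining product
  into \<open>2 * PP (sin (th z))\<close>. The top is excluded, since the director is at the pole
  there.\<close>

lemma director_density:
  assumes z: "z \<in> {0<..<1}"
  shows "WW (director z) (director_deriv z) + aa = 2 * PP (sin (th z))"
proof -
  have th: "0 < th z" "th z < pi / 2" using th_interior z by auto
  then have cp: "cos (th z) > 0" and sp: "sin (th z) > 0" by (auto intro: cos_gt_zero_pi sin_gt_zero)
  have l: "\<bar>director z $ 3\<bar> < 1"
  proof -
    have "(sin (th z))\<^sup>2 < 1" using cp sin_squared_eq[of "th z"] by simp
    then show ?thesis by (simp add: abs_square_less_1)
  qed
  have sq: "1 - (director z $ 3)\<^sup>2 = (cos (th z))\<^sup>2" by (simp add: cos_squared_eq)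
  have rho: "sqrt (1 - (director z $ 3)\<^sup>2) = cos (th z)" unfolding sq using cp by simp
  define p q where "p = K2 * t / gg (sin (th z))" and "q = inverse (FF (th z))"
  have w: "director_deriv z $ 1 = - sin (ph z) * p * cos (th z) + cos (ph z) * (- sin (th z) * q)"
    "director_deriv z $ 2 = cos (ph z) * p * cos (th z) + sin (ph z) * (- sin (th z) * q)"
    "director_deriv z $ 3 = cos (th z) * q"
    by (simp_all add: director_deriv_def p_def q_def Let_def)
  have sc: "(sin (ph z))\<^sup>2 + (cos (ph z))\<^sup>2 = 1" by simp
  have o: "director z \<bullet> director_deriv z = 0"
  proof -
    have "cos (ph z) * cos (th z) * (- sin (ph z) * p * cos (th z) + cos (ph z) * (- sin (th z) * q))
       + sin (ph z) * cos (th z) * (cos (ph z) * p * cos (th z) + sin (ph z) * (- sin (th z) * q))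
       + sin (th z) * (cos (th z) * q) = 0"
      using sc by algebra
    then show ?thesis unfolding inner_vec_def sum_3 w by simp
  qed
  have A: "director z $ 1 * director_deriv z $ 2 - director z $ 2 * director_deriv z $ 1 = K2 * t * (cos (th z))\<^sup>2 / gg (sin (th z))"
  proof -
    have "cos (ph z) * cos (th z) * (cos (ph z) * p * cos (th z) + sin (ph z) * (- sin (th z) * q))
       - sin (ph z) * cos (th z) * (- sin (ph z) * p * cos (th z) + cos (ph z) * (- sin (th z) * q)) = p * (cos (th z))\<^sup>2"
      using sc by algebra
    then show ?thesis unfolding w by (simp add: p_def)
  qed
  have f: "ff (sin (th z)) > 0" and P: "PP (sin (th z)) > 0" using ff_pos PP_pos by simp_all
  have q: "q = sqrt (PP (sin (th z))) / sqrt (ff (sin (th z)))" by (simp add: q_def FF_eq)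
  have fq: "sqrt (ff (sin (th z))) * q = sqrt (PP (sin (th z)))" unfolding q using f by simp
  have "WW (director z) (director_deriv z) + aa = 2 * 1 * sqrt (ff (director z $ 3) * PP (director z $ 3)) * director_deriv z $ 3 / sqrt (1 - (director z $ 3)\<^sup>2)
     + ((1 * sqrt (ff (director z $ 3)) * director_deriv z $ 3 / sqrt (1 - (director z $ 3)\<^sup>2) - sqrt (PP (director z $ 3)))\<^sup>2
      + gg (director z $ 3) / (sqrt (1 - (director z $ 3)\<^sup>2))\<^sup>2 * (director z $ 1 * director_deriv z $ 2 - director z $ 2 * director_deriv z $ 1 - K2 * t * (sqrt (1 - (director z $ 3)\<^sup>2))\<^sup>2 / gg (director z $ 3))\<^sup>2)"
    by (rule energy_identity[OF norm_director o l]) simp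
  also have "\<dots> = 2 * sqrt (ff (sin (th z)) * PP (sin (th z))) * q"
    unfolding rho A w(3) using cp fq by (simp add: power2_eq_square)
  also have "\<dots> = 2 * sqrt (PP (sin (th z))) * (sqrt (ff (sin (th z))) * q)" by (simp add: real_sqrt_mult)
  also have "\<dots> = 2 * PP (sin (th z))" unfolding fq using P by simp
  finally show ?thesis .
qed

lemma energy1_ext_director: "energy1 ext_director ext_director_deriv = min_energy"
proof -
  let ?V = "VV ext_director ext_director_deriv"
  note V = VV_AC[OF z_curve_ext_director]
  have P: "AC_on 0 1 (\<lambda>z. Psi (th z)) (\<lambda>z. EE (th z) * inverse (FF (th z)))"
    by (rule AC_on_real_chain[OF th_AC open_UNIV _ Psi_deriv EE_continuous]) simp
  have "?V 1 - 2 * Psi (th 1) = ?V 0 - 2 * Psi (th 0)"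
  proof (rule AC_on_const[OF AC_on_diff[OF V(1) AC_on_cmult[OF P, of 2]]])
    have "indicator {0<..<1} z * (WW (ext_director z) (ext_director_deriv z) + aa) - 2 * (EE (th z) * inverse (FF (th z))) = 0"
      if z: "z \<in> {0<..<1}" for z
    proof -
      have "EE (th z) * inverse (FF (th z)) = PP (sin (th z))"
        using ff_pos[of "sin (th z)"] PP_pos[of "sin (th z)"] by (simp add: EE_def FF_eq real_sqrt_mult field_simps)
      then show ?thesis using director_density[OF z] z by (simp add: ext_director_eq ext_director_deriv_eq)
    qed
    then show "AE z in lborel. z \<in> {0<..<1} \<longrightarrow>
        indicator {0<..<1} z * (WW (ext_director z) (ext_director_deriv z) + aa) - 2 * (EE (th z) * inverse (FF (th z))) = 0"
      by (intro AE_I2) auto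
  qed auto
  then show ?thesis using V(2,3) by (simp add: th_0 th_1 Psi_0 min_energy_def)
qed

text \<open>For the backward direction, curves that agree have the same derivative almost
  everywhere, whichever representative \<gamma> is, and therefore the same energy.\<close>

lemma energy1_eq_min_iff:
  assumes zc: "z_curve M \<gamma>"
  shows "energy1 M \<gamma> = min_energy \<longleftrightarrow> (\<forall>z\<in>{0<..<1}. M z = director z)"
proof
  assume "energy1 M \<gamma> = min_energy"
  then show "\<forall>z\<in>{0<..<1}. M z = director z" using equality_case[OF zc] by auto
next
  assume eq: "\<forall>z\<in>{0<..<1}. M z = director z"
  have AC: "AC_on 0 1 M \<gamma>" and AC': "AC_on 0 1 ext_director ext_director_deriv"
    and m: "M \<in> borel_measurable borel" "\<gamma> \<in> borel_measurable borel"
       "ext_director \<in> borel_measurable borel" "ext_director_deriv \<in> borel_measurable borel"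
    and bd: "M 0 = axis 1 1" "M 1 = axis 3 1" "ext_director 0 = axis 1 1" "ext_director 1 = axis 3 1"
    using zc z_curve_ext_director by (auto simp: z_curve_def)
  have eq': "M z = ext_director z" if "z \<in> {0..1}" for z
    using eq that bd by (cases "z = 0"; cases "z = 1") (auto simp: ext_director_eq)
  have "AE z in lborel. z \<in> {0<..<1} \<longrightarrow> \<gamma> z $ k - ext_director_deriv z $ k = 0" for k
    by (rule AC_on_const_imp_zero[OF AC_on_diff[OF AC_on_linear[OF AC bounded_linear_vec_nth] AC_on_linear[OF AC' bounded_linear_vec_nth]], where c = 0])
       (simp add: eq')
  from this[of 1] this[of 2] this[of 3]
  have "AE z in lborel. z \<in> {0<..<1} \<longrightarrow> \<gamma> z = ext_director_deriv z"
    by eventually_elim (auto simp: vec_eq_iff forall_3)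
  then have "AE z in lborel. indicator {0<..<1} z * WW (M z) (\<gamma> z) = indicator {0<..<1} z * WW (ext_director z) (ext_director_deriv z)"
    by eventually_elim (auto simp: eq' split: split_indicator)
  then have "energy1 M \<gamma> = energy1 ext_director ext_director_deriv"
    unfolding energy1_def by (intro integral_cong_AE) (use m in measurable)
  then show "energy1 M \<gamma> = min_energy" using energy1_ext_director by simp
qed

section \<open>Return to fields on the slab\<close>

lemma nstar_eq: "nstar th ph p = director (p $ 3)"
  by (simp add: nstar_def director_def)

text \<open>\<open>energy\<close> picks a weak gradient by \<open>SOME\<close>. The reduction
  applies to every weak gradient, in particular to the chosen one.\<close>

lemma z_only_energy_eq:
  assumes L: "L1 > 0" "L2 > 0" and adm: "admissible L1 L2 n" and zonly: "depends_only_on_z L1 L2 n"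
  obtains M \<gamma> where "z_curve M \<gamma>" "energy L1 L2 K1 K2 K3 K4 t n = 4 * L1 * L2 * energy1 M \<gamma>"
    "AE p in lebesgue. p \<in> Omega L1 L2 \<longrightarrow> n p = M (p $ 3)"
proof -
  define g where "g = (SOME g. adm_grad L1 L2 n g)"
  have g: "adm_grad L1 L2 n g" using adm someI_ex unfolding admissible_def g_def by metis
  obtain m where m: "AE p in lebesgue. p \<in> Omega L1 L2 \<longrightarrow> n p = m (p $ 3)"
    using zonly unfolding depends_only_on_z_def by blast
  have nm: "AE p in lebesgue. p \<in> Omega L1 L2 \<longrightarrow> norm (n p) = 1" using adm unfolding admissible_def by blast
  show ?thesis
  proof (rule z_only_reduction[OF L g nm m])
    fix M \<gamma>
    assume M: "AC_on 0 1 M \<gamma>" "M \<in> borel_measurable borel" "\<gamma> \<in> borel_measurable borel"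
      "M 0 = axis 1 1" "M 1 = axis 3 1" "\<And>z. z \<in> {0..1} \<Longrightarrow> norm (M z) = 1"
      "\<And>k. integrable lborel (\<lambda>z. indicator {0<..<1} z * (\<gamma> z $ k)\<^sup>2)"
      and ae: "AE p in lebesgue. p \<in> Omega L1 L2 \<longrightarrow> n p = M (p $ 3) \<and> g p = colg (\<gamma> (p $ 3))"
    show ?thesis
    proof (rule that)
      show "z_curve M \<gamma>" using M by (simp add: z_curve_def)
      show "energy L1 L2 K1 K2 K3 K4 t n = 4 * L1 * L2 * energy1 M \<gamma>"
        unfolding energy_def Let_def g_def[symmetric] energy1_def
        by (rule z_only_energy[OF L M(2,3,6,7) ae]) (use K in auto)
      show "AE p in lebesgue. p \<in> Omega L1 L2 \<longrightarrow> n p = M (p $ 3)" using ae by eventually_elim auto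
    qed
  qed
qed

lemma admissible_nstar:
  assumes L: "L1 > 0" "L2 > 0"
  shows "admissible L1 L2 (nstar th ph)"
proof -
  have "adm_grad L1 L2 (nstar th ph) (\<lambda>p. colg (ext_director_deriv (p $ 3)))"
  proof (rule z_only_adm_grad[OF L])
    show "nstar th ph p = ext_director (p $ 3)" if "p \<in> Omega L1 L2" for p
      using that by (simp add: nstar_eq ext_director_eq mem_Omega_iff)
  qed (use z_curve_ext_director in \<open>auto simp: z_curve_def\<close>)
  then show ?thesis unfolding admissible_def by (auto simp: nstar_eq norm_director)
qed

lemma AE_eq_nstar_iff:
  assumes L: "L1 > 0" "L2 > 0" and zc: "z_curve M \<gamma>"
    and M: "AE p in lebesgue. p \<in> Omega L1 L2 \<longrightarrow> n p = M (p $ 3)"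
  shows "(AE p in lebesgue. p \<in> Omega L1 L2 \<longrightarrow> n p = nstar th ph p) \<longleftrightarrow> energy1 M \<gamma> = min_energy"
  unfolding energy1_eq_min_iff[OF zc]
proof
  assume "AE p in lebesgue. p \<in> Omega L1 L2 \<longrightarrow> n p = nstar th ph p"
  with M have "AE p in lebesgue. p \<in> Omega L1 L2 \<longrightarrow> M (p $ 3) = director (p $ 3)"
    by eventually_elim (auto simp: nstar_eq)
  from AE_Omega_z[OF L this] have ae: "AE z in lborel. z \<in> {0<..<1} \<longrightarrow> M z = director z" .
  have c: "continuous_on {0..1} M" using zc unfolding z_curve_def by (blast intro: AC_on_continuous)
  show "\<forall>z\<in>{0<..<1}. M z = director z"
    using AE_Ioo_continuous[OF ae c AC_on_continuous[OF director_AC]] by auto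
next
  assume "\<forall>z\<in>{0<..<1}. M z = director z"
  with M show "AE p in lebesgue. p \<in> Omega L1 L2 \<longrightarrow> n p = nstar th ph p"
    by (auto simp: nstar_eq mem_Omega_iff elim!: eventually_mono)
qed

end

theorem mainTheorem3:
  fixes L1 L2 K1 K2 K3 K4 t C :: real and th ph :: "real \<Rightarrow> real"
  assumes "L1 > 0" and "L2 > 0"
    and "K1 > 0" and "K2 > 0" and "K3 > 0" and "t \<ge> 0"
    and C_gt: "C > K2 * t\<^sup>2"
    and C_eq: "integral {0..pi/2} (Fint K1 K2 K3 t C) = 1"
    and th_range: "\<forall>z\<in>{0..1}. th z \<in> {0..pi/2}"
    and th_eq: "\<forall>z\<in>{0..1}. integral {0..th z} (Fint K1 K2 K3 t C) = z"
    and ph_deriv: "\<forall>z\<in>{0..1}. (ph has_real_derivative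
                      K2 * t / (K2 * (cos (th z))\<^sup>2 + K3 * (sin (th z))\<^sup>2)) (at z within {0..1})"
    and ph_0: "ph 0 = 0"
  shows "admissible L1 L2 (nstar th ph) \<and>
    (\<forall>n. admissible L1 L2 n \<and> depends_only_on_z L1 L2 n \<longrightarrow>
       energy L1 L2 K1 K2 K3 K4 t n \<ge> energy L1 L2 K1 K2 K3 K4 t (nstar th ph) \<and>
       (energy L1 L2 K1 K2 K3 K4 t n = energy L1 L2 K1 K2 K3 K4 t (nstar th ph) \<longleftrightarrow>
        (AE p in lebesgue. p \<in> Omega L1 L2 \<longrightarrow> n p = nstar th ph p)))"
proof -
  interpret frank K1 K2 K3 t C by unfold_locales (use assms in auto)
  interpret profile K1 K2 K3 t C th ph
    by unfold_locales (use C_eq th_range th_eq ph_deriv ph_0 in \<open>auto simp: gg_def cos_squared_eq\<close>)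
  note L = \<open>L1 > 0\<close> \<open>L2 > 0\<close>
  have LL: "4 * L1 * L2 > 0" using L by simp
  have adm: "admissible L1 L2 (nstar th ph)" by (rule admissible_nstar[OF L])
  have zst: "depends_only_on_z L1 L2 (nstar th ph)"
    unfolding depends_only_on_z_def by (intro exI[of _ director]) (simp add: nstar_eq)
  obtain M0 \<gamma>0 where M0: "z_curve M0 \<gamma>0"
    "energy L1 L2 K1 K2 K3 K4 t (nstar th ph) = 4 * L1 * L2 * energy1 M0 \<gamma>0"
    "AE p in lebesgue. p \<in> Omega L1 L2 \<longrightarrow> nstar th ph p = M0 (p $ 3)" by (rule z_only_energy_eq[OF L adm zst])
  \<comment> \<open>The equality criterion is applied to \<open>nstar\<close> itself, where its left
    side is trivially true; this gives the energy of \<open>nstar\<close> without comparing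
    \<open>M0\<close> with the director.\<close>
  have E0: "energy L1 L2 K1 K2 K3 K4 t (nstar th ph) = 4 * L1 * L2 * min_energy"
    using AE_eq_nstar_iff[OF L M0(1,3)] M0(2) by simp
  have "energy L1 L2 K1 K2 K3 K4 t (nstar th ph) \<le> energy L1 L2 K1 K2 K3 K4 t n \<and>
      (energy L1 L2 K1 K2 K3 K4 t n = energy L1 L2 K1 K2 K3 K4 t (nstar th ph) \<longleftrightarrow>
        (AE p in lebesgue. p \<in> Omega L1 L2 \<longrightarrow> n p = nstar th ph p))"
    if n: "admissible L1 L2 n" "depends_only_on_z L1 L2 n" for n
  proof -
    obtain M \<gamma> where M: "z_curve M \<gamma>" "energy L1 L2 K1 K2 K3 K4 t n = 4 * L1 * L2 * energy1 M \<gamma>"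
      "AE p in lebesgue. p \<in> Omega L1 L2 \<longrightarrow> n p = M (p $ 3)"
      by (rule z_only_energy_eq[OF L n])
    show ?thesis unfolding AE_eq_nstar_iff[OF L M(1,3)] E0 M(2)
      using energy_lower_bound(1)[OF M(1)] LL L by (auto intro!: mult_left_mono)
  qed
  with adm show ?thesis by blast
qed

end
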